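(* Let $(M,\rho)$ be a hyperbolic manifold admitting a totally geodesic immersion to a compact, right-angled Coxeter orbifold of dimension 3 or 4. Then the geodesic residual finiteness growth of $(M,\rho)$ is at most linear, i.e. $\mathrm{F}_{M,\rho} \preceq n$.
   Context: A hyperbolic manifold $(M,\rho)$ is a connected manifold with a complete Riemannian metric $\rho$ of constant curvature $-1$; $\mathbf{H}^m$ is hyperbolic $m$-space. $M$ need not be compact. An all right polyhedron in $\mathbf{H}^m$ is a (convex, $m$-dimensional) polyhedron all of whose dihedral angles equal $\pi/2$. For a compact all right polyhedron $P \subset \mathbf{H}^m$, $\Gamma_P$ denotes the (discrete) group of isometries of $\mathbf{H}^m$ generated by the reflections in the codimension-1 faces of $P$. The quotient orbifold $\mathcal{O}_P = \mathbf{H}^m/\Gamma_P$ is the compact right-angled Coxeter orbifold of dimension $m$ defined by $P$, with orbifold fundamental group $\Gamma_P$. A totally geodesic immersion $f : M \to \mathcal{O}_P$ is a map of orbifolds that lifts to a totally geodesic isometric immersion of the universal cover of $M$ into $\mathbf{H}^m$, equivariant with respect to the induced homomorphism $f_* : \pi_1(M) \to \Gamma_P$. In this situation $f_*$ is injective and every $\alpha \in \pi_1(M)-\{1\}$ has a unique geodesic representative, whose length $\ell_\rho(\alpha)$ equals the translation length of $f_*(\alpha)$ on $\mathbf{H}^m$. The dimension of $M$ need not equal $m$. For a group $G$ and $g \in G-\{1\}$ the divisibility function is $D_G(g) = \min\{[G:H] : H \le G,\ g \notin H\} \in \mathbf{N}\cup\{\infty\}$. The geodesic residual finiteness function $\mathrm{F}_{M,\rho}(n)$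 is the maximum of $D_{\pi_1(M)}(\alpha)$ over all $\alpha \in \pi_1(M)-\{1\}$ with $\ell_\rho(\alpha) \le n$ (this makes sense for any real $n>0$; the value is taken to be $1$ if there is no such $\alpha$). Its growth is called the geodesic residual finiteness growth. For functions $f,g$ on the positive integers, $f \preceq g$ means there is a constant $C>0$ such that $f(n) \le C\, g(Cn)$ for all $n$; here $g(n)=n$. *)

theory Defs
  imports
    "HOL-Analysis.Analysis"
    "HOL-Algebra.Coset"
    "HOL-Algebra.Generated_Groups"
    "HOL-Algebra.Group_Action"
begin

section \<open>Smooth maps between Euclidean spaces\<close>

definition partial_deriv :: "'a::euclidean_space \<Rightarrow> ('a \<Rightarrow> 'b::real_normed_vector) \<Rightarrow> 'a \<Rightarrow> 'b" where
  "partial_deriv b f x = frechet_derivative f (at x) b"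

text \<open>Only meant for open sets: the derivatives are two-sided.\<close>

primrec Ck_on :: "nat \<Rightarrow> 'a set \<Rightarrow> ('a::euclidean_space \<Rightarrow> 'b::real_normed_vector) \<Rightarrow> bool" where
  "Ck_on 0 W f \<longleftrightarrow> continuous_on W f"
| "Ck_on (Suc n) W f \<longleftrightarrow>
     (\<forall>x\<in>W. f differentiable (at x)) \<and> (\<forall>b\<in>Basis. Ck_on n W (partial_deriv b f))"

definition smooth_on :: "'a set \<Rightarrow> ('a::euclidean_space \<Rightarrow> 'b::real_normed_vector) \<Rightarrow> bool" where
  "smooth_on W f \<longleftrightarrow> (\<forall>n. Ck_on n W f)"


section \<open>Riemannian metrics in local coordinates\<close>

abbreviation coord_deriv :: "'k \<Rightarrow> (real^'k \<Rightarrow> 'b::real_normed_vector) \<Rightarrow> real^'k \<Rightarrow> 'b" where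
  "coord_deriv i \<equiv> partial_deriv (axis i 1)"

definition metric_inner :: "real^'k^'k \<Rightarrow> real^'k \<Rightarrow> real^'k \<Rightarrow> real" where
  "metric_inner G u v = u \<bullet> (G *v v)"

definition christoffel ::
  "(real^'k \<Rightarrow> real^'k^'k) \<Rightarrow> 'k \<Rightarrow> 'k \<Rightarrow> 'k \<Rightarrow> real^'k \<Rightarrow> real" where
  "christoffel g l i j x =
     (1/2) * (\<Sum>h\<in>UNIV. matrix_inv (g x) $ l $ h *
       (coord_deriv i (\<lambda>y. g y $ j $ h) x + coord_deriv j (\<lambda>y. g y $ i $ h) x
         - coord_deriv h (\<lambda>y. g y $ i $ j) x))"

text \<open>The coefficients in \<open>R(\<partial>\<^sub>i, \<partial>\<^sub>j) \<partial>\<^sub>k = (\<Sum>l. riemann g l k i j \<partial>\<^sub>l)\<close>, with the sign convention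
  \<open>R(X, Y) = \<nabla>\<^sub>X \<nabla>\<^sub>Y - \<nabla>\<^sub>Y \<nabla>\<^sub>X - \<nabla>\<^sub>[\<^sub>X\<^sub>,\<^sub>Y\<^sub>]\<close>.\<close>

definition riemann ::
  "(real^'k \<Rightarrow> real^'k^'k) \<Rightarrow> 'k \<Rightarrow> 'k \<Rightarrow> 'k \<Rightarrow> 'k \<Rightarrow> real^'k \<Rightarrow> real" where
  "riemann g l k i j x =
     coord_deriv i (christoffel g l j k) x - coord_deriv j (christoffel g l i k) x
     + (\<Sum>h\<in>UNIV. christoffel g l i h x * christoffel g h j k x
                  - christoffel g l j h x * christoffel g h i k x)"

definition curvature_operator ::
  "(real^'k \<Rightarrow> real^'k^'k) \<Rightarrow> real^'k \<Rightarrow> real^'k \<Rightarrow> real^'k \<Rightarrow> real^'k \<Rightarrow> real^'k" where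
  "curvature_operator g x u v w =
     (\<chi> l. \<Sum>k\<in>UNIV. \<Sum>i\<in>UNIV. \<Sum>j\<in>UNIV. riemann g l k i j x * w $ k * u $ i * v $ j)"

definition sectional_curvature ::
  "(real^'k \<Rightarrow> real^'k^'k) \<Rightarrow> real^'k \<Rightarrow> real^'k \<Rightarrow> real^'k \<Rightarrow> real" where
  "sectional_curvature g x u v =
     metric_inner (g x) (curvature_operator g x u v v) u
     / (metric_inner (g x) u u * metric_inner (g x) v v - (metric_inner (g x) u v)\<^sup>2)"


section \<open>Riemannian manifolds\<close>

text \<open>The points of a manifold are the elements of a type \<open>'a\<close>, with its type class topology.
  The Riemannian metric is recorded chart by chart, as the Gram matrix \<open>gram c\<close> of the coordinate
  frame; it is relevant only on the open set \<open>chart_image c\<close>.\<close>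

record ('a, 'k) rchart =
  chart_dom :: "'a set"
  coord :: "'a \<Rightarrow> real^'k"
  gram :: "real^'k \<Rightarrow> real^'k^'k"

definition chart_image :: "('a, 'k::finite) rchart \<Rightarrow> (real^'k) set" where
  "chart_image c = coord c ` chart_dom c"

definition param :: "('a, 'k::finite) rchart \<Rightarrow> real^'k \<Rightarrow> 'a" where
  "param c = inv_into (chart_dom c) (coord c)"

definition riemannian_chart :: "('a::topological_space, 'k::finite) rchart \<Rightarrow> bool" where
  "riemannian_chart c \<longleftrightarrow>
     open (chart_dom c) \<and> open (chart_image c) \<and>
     homeomorphism (chart_dom c) (chart_image c) (coord c) (param c) \<and>
     smooth_on (chart_image c) (gram c) \<and>
     (\<forall>x\<in>chart_image c. transpose (gram c x) = gram c x \<and>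
        (\<forall>u. u \<noteq> 0 \<longrightarrow> metric_inner (gram c x) u u > 0))"

definition transition ::
  "('a, 'k::finite) rchart \<Rightarrow> ('a, 'k) rchart \<Rightarrow> real^'k \<Rightarrow> real^'k" where
  "transition c d = coord d \<circ> param c"

definition compatible_charts :: "('a, 'k::finite) rchart \<Rightarrow> ('a, 'k) rchart \<Rightarrow> bool" where
  "compatible_charts c d \<longleftrightarrow>
     smooth_on (coord c ` (chart_dom c \<inter> chart_dom d)) (transition c d) \<and>
     (\<forall>x\<in>coord c ` (chart_dom c \<inter> chart_dom d). \<forall>u v.
        metric_inner (gram c x) u v =
        metric_inner (gram d (transition c d x))
          (frechet_derivative (transition c d) (at x) u)
          (frechet_derivative (transition c d) (at x) v))"

definition riemannian_atlas :: "('a::topological_space, 'k::finite) rchart set \<Rightarrow> bool" where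
  "riemannian_atlas A \<longleftrightarrow>
     (\<Union>c\<in>A. chart_dom c) = UNIV \<and> (\<forall>c\<in>A. riemannian_chart c) \<and> (\<forall>c\<in>A. \<forall>d\<in>A. compatible_charts c d)"

definition constant_curvature :: "('a, 'k::finite) rchart set \<Rightarrow> real \<Rightarrow> bool" where
  "constant_curvature A \<kappa> \<longleftrightarrow>
     (\<forall>c\<in>A. \<forall>x\<in>chart_image c. \<forall>u v. u \<noteq> v \<and> independent {u, v} \<longrightarrow>
        sectional_curvature (gram c) x u v = \<kappa>)"

text \<open>Compatibility of the charts makes the speed independent of the chosen chart wherever
  \<open>\<gamma>\<close> is differentiable; at the finitely many corners of a piecewise \<open>C\<^sup>1\<close> path its value
  is irrelevant for the length.\<close>

definition speed :: "('a, 'k::finite) rchart set \<Rightarrow> (real \<Rightarrow> 'a) \<Rightarrow> real \<Rightarrow> real" where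
  "speed A \<gamma> t =
     (let c = (SOME c. c \<in> A \<and> \<gamma> t \<in> chart_dom c);
          v = vector_derivative (coord c \<circ> \<gamma>) (at t)
      in sqrt (metric_inner (gram c (coord c (\<gamma> t))) v v))"

definition curve_length :: "('a, 'k::finite) rchart set \<Rightarrow> (real \<Rightarrow> 'a) \<Rightarrow> real" where
  "curve_length A \<gamma> = integral {0..1} (speed A \<gamma>)"

definition C1_in_chart :: "('a, 'k::finite) rchart \<Rightarrow> (real \<Rightarrow> 'a) \<Rightarrow> real \<Rightarrow> real \<Rightarrow> bool" where
  "C1_in_chart c \<gamma> a b \<longleftrightarrow> \<gamma> ` {a..b} \<subseteq> chart_dom c \<and>
     (\<exists>D. continuous_on {a..b} D \<and>
        (\<forall>t\<in>{a..b}. ((coord c \<circ> \<gamma>) has_vector_derivative D t) (at t within {a..b})))"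

definition piecewise_C1 :: "('a, 'k::finite) rchart set \<Rightarrow> (real \<Rightarrow> 'a) \<Rightarrow> bool" where
  "piecewise_C1 A \<gamma> \<longleftrightarrow>
     (\<exists>(n::nat) s. s 0 = 0 \<and> s n = 1 \<and>
        (\<forall>i<n. s i < s (Suc i) \<and> (\<exists>c\<in>A. C1_in_chart c \<gamma> (s i) (s (Suc i)))))"

definition riemannian_dist :: "('a::topological_space, 'k::finite) rchart set \<Rightarrow> 'a \<Rightarrow> 'a \<Rightarrow> real" where
  "riemannian_dist A x y =
     Inf {curve_length A \<gamma> | \<gamma>. piecewise_C1 A \<gamma> \<and> pathstart \<gamma> = x \<and> pathfinish \<gamma> = y}"

definition complete_metric :: "('a::topological_space, 'k::finite) rchart set \<Rightarrow> bool" where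
  "complete_metric A \<longleftrightarrow>
     (\<forall>s :: nat \<Rightarrow> 'a.
        (\<forall>e>0. \<exists>N. \<forall>i\<ge>N. \<forall>j\<ge>N. riemannian_dist A (s i) (s j) < e) \<longrightarrow> (\<exists>l. s \<longlonglongrightarrow> l))"

definition hyperbolic_manifold ::
  "('a::{t2_space, second_countable_topology}, 'k::finite) rchart set \<Rightarrow> bool" where
  "hyperbolic_manifold A \<longleftrightarrow>
     riemannian_atlas A \<and> connected (UNIV :: 'a set) \<and> complete_metric A \<and>
     constant_curvature A (- 1)"

definition geodesic_line :: "('a::topological_space, 'k::finite) rchart set \<Rightarrow> (real \<Rightarrow> 'a) \<Rightarrow> bool" where
  "geodesic_line A \<gamma> \<longleftrightarrow> continuous_on UNIV \<gamma> \<and>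
     (\<forall>c\<in>A. \<exists>v a. \<forall>t. \<gamma> t \<in> chart_dom c \<longrightarrow>
        ((coord c \<circ> \<gamma>) has_vector_derivative v t) (at t) \<and>
        (v has_vector_derivative a t) (at t) \<and>
        (\<forall>l. a t $ l + (\<Sum>i\<in>UNIV. \<Sum>j\<in>UNIV.
           christoffel (gram c) l i j (coord c (\<gamma> t)) * v t $ i * v t $ j) = 0))"


section \<open>Fundamental group and universal cover\<close>

definition path_class :: "(real \<Rightarrow> 'a::topological_space) \<Rightarrow> (real \<Rightarrow> 'a) set" where
  "path_class c = {d. homotopic_paths UNIV c d}"

definition fundamental_group :: "'a::topological_space \<Rightarrow> (real \<Rightarrow> 'a) set monoid" where
  "fundamental_group x =
     \<lparr>carrier = {path_class c | c. path c \<and> pathstart c = x \<and> pathfinish c = x},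
      mult = \<lambda>\<alpha> \<beta>. {d. \<exists>a\<in>\<alpha>. \<exists>b\<in>\<beta>. homotopic_paths UNIV (a +++ b) d},
      one = path_class (\<lambda>_. x)\<rparr>"

definition universal_covering :: "('u::topological_space \<Rightarrow> 'a::topological_space) \<Rightarrow> bool" where
  "universal_covering p \<longleftrightarrow> covering_space UNIV p UNIV \<and> simply_connected (UNIV :: 'u set)"

text \<open>\<open>deck_action p b \<alpha> y z\<close> says that \<open>\<alpha> \<cdot> y = z\<close> for the action of the fundamental group based
  at \<open>p b\<close> on the universal cover by deck transformations: if \<open>e\<close> runs from \<open>b\<close> to \<open>y\<close>, then
  \<open>z\<close> is the endpoint of the lift, starting at \<open>b\<close>, of a loop in \<open>\<alpha>\<close> followed by \<open>p \<circ> e\<close>.\<close>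

definition deck_action ::
  "('u::topological_space \<Rightarrow> 'a::topological_space) \<Rightarrow> 'u \<Rightarrow> (real \<Rightarrow> 'a) set \<Rightarrow> 'u \<Rightarrow> 'u \<Rightarrow> bool" where
  "deck_action p b \<alpha> y z \<longleftrightarrow>
     (\<exists>c' e e'. path c' \<and> pathstart c' = b \<and> p \<circ> c' \<in> \<alpha> \<and>
        path e \<and> pathstart e = b \<and> pathfinish e = y \<and>
        path e' \<and> pathstart e' = pathfinish c' \<and> pathfinish e' = z \<and>
        (\<forall>t\<in>{0..1}. p (e' t) = p (e t)))"

definition pullback_atlas ::
  "('u::topological_space \<Rightarrow> 'a) \<Rightarrow> ('a, 'k::finite) rchart set \<Rightarrow> ('u, 'k) rchart set" where
  "pullback_atlas p A =
     {\<lparr>chart_dom = V, coord = coord c \<circ> p, gram = gram c\<rparr> | V c.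
        c \<in> A \<and> open V \<and> inj_on p V \<and> p ` V \<subseteq> chart_dom c}"


section \<open>Hyperbolic space and all right polyhedra\<close>

text \<open>The hyperboloid model of hyperbolic \<open>m\<close>-space, where \<open>m = CARD('m)\<close>; the last coordinate of
  the ambient Minkowski space is the timelike one.\<close>

definition lorentz :: "(real^'m) \<times> real \<Rightarrow> (real^'m) \<times> real \<Rightarrow> real" where
  "lorentz x y = fst x \<bullet> fst y - snd x * snd y"

definition hyperbolic_space :: "((real^'m::finite) \<times> real) set" where
  "hyperbolic_space = {x. lorentz x x = - 1 \<and> snd x > 0}"

definition hyperbolic_dist :: "(real^'m) \<times> real \<Rightarrow> (real^'m) \<times> real \<Rightarrow> real" where
  "hyperbolic_dist x y = arcosh (- lorentz x y)"

definition isometry_group :: "((real^'m::finite) \<times> real \<Rightarrow> (real^'m) \<times> real) monoid" where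
  "isometry_group = (BijGroup hyperbolic_space)
     \<lparr>carrier := {h \<in> Bij hyperbolic_space. \<forall>x\<in>hyperbolic_space. \<forall>y\<in>hyperbolic_space.
        hyperbolic_dist (h x) (h y) = hyperbolic_dist x y}\<rparr>"

definition half_space :: "(real^'m::finite) \<times> real \<Rightarrow> ((real^'m) \<times> real) set" where
  "half_space v = {x \<in> hyperbolic_space. lorentz x v \<le> 0}"

definition hyperplane :: "(real^'m::finite) \<times> real \<Rightarrow> ((real^'m) \<times> real) set" where
  "hyperplane v = {x \<in> hyperbolic_space. lorentz x v = 0}"

definition reflection :: "(real^'m::finite) \<times> real \<Rightarrow> (real^'m) \<times> real \<Rightarrow> (real^'m) \<times> real" where
  "reflection v = (\<lambda>x\<in>hyperbolic_space. x - (2 * lorentz x v) *\<^sub>R v)"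

text \<open>The totally geodesic subspaces of hyperbolic space are its nonempty intersections with linear
  subspaces, so a nonempty convex subset \<open>S\<close> of hyperbolic space has hyperbolic dimension
  \<open>dim S - 1\<close>, where \<open>dim S\<close> is the linear dimension of its span in Minkowski space.\<close>

definition convex_polyhedron :: "((real^'m::finite) \<times> real) set \<Rightarrow> bool" where
  "convex_polyhedron P \<longleftrightarrow>
     (\<exists>V. finite V \<and> (\<forall>v\<in>V. lorentz v v = 1) \<and>
        P = hyperbolic_space \<inter> (\<Inter>v\<in>V. half_space v)) \<and>
     dim P = CARD('m) + 1"

text \<open>\<open>v\<close> is the outward unit normal of the codimension-1 face \<open>P \<inter> hyperplane v\<close> of \<open>P\<close>.\<close>

definition facet_normal :: "((real^'m::finite) \<times> real) set \<Rightarrow> (real^'m) \<times> real \<Rightarrow> bool" where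
  "facet_normal P v \<longleftrightarrow>
     lorentz v v = 1 \<and> P \<subseteq> half_space v \<and> dim (P \<inter> hyperplane v) = CARD('m)"

definition adjacent_facets ::
  "((real^'m::finite) \<times> real) set \<Rightarrow> (real^'m) \<times> real \<Rightarrow> (real^'m) \<times> real \<Rightarrow> bool" where
  "adjacent_facets P v w \<longleftrightarrow>
     facet_normal P v \<and> facet_normal P w \<and> v \<noteq> w \<and>
     dim (P \<inter> hyperplane v \<inter> hyperplane w) = CARD('m) - 1"

text \<open>The interior angle along the common face of two facets: \<open>\<pi>\<close> minus the angle between their
  outward normals.\<close>

definition dihedral_angle :: "(real^'m) \<times> real \<Rightarrow> (real^'m) \<times> real \<Rightarrow> real" where
  "dihedral_angle v w = pi - arccos (lorentz v w)"

definition all_right_polyhedron :: "((real^'m::finite) \<times> real) set \<Rightarrow> bool" where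
  "all_right_polyhedron P \<longleftrightarrow>
     convex_polyhedron P \<and> (\<forall>v w. adjacent_facets P v w \<longrightarrow> dihedral_angle v w = pi / 2)"

definition reflection_group ::
  "((real^'m::finite) \<times> real) set \<Rightarrow> ((real^'m) \<times> real \<Rightarrow> (real^'m) \<times> real) monoid" where
  "reflection_group P = subgroup_generated isometry_group {reflection v | v. facet_normal P v}"

definition coxeter_orbifold :: "((real^'m::finite) \<times> real) set \<Rightarrow> ((real^'m) \<times> real) set set" where
  "coxeter_orbifold P = orbits (reflection_group P) hyperbolic_space (\<lambda>h. h)"


section \<open>Totally geodesic immersions\<close>

text \<open>Orthogonal projection onto the tangent space of the hyperboloid at \<open>y\<close>.\<close>

definition tangent_proj :: "(real^'m) \<times> real \<Rightarrow> (real^'m) \<times> real \<Rightarrow> (real^'m) \<times> real" where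
  "tangent_proj y w = w + lorentz w y *\<^sub>R y"

text \<open>The \<open>(i, j)\<close> component \<open>\<nabla>\<^sub>i (df \<partial>\<^sub>j) - df (\<nabla>\<^sub>i \<partial>\<^sub>j)\<close> of the second fundamental form of a map
  \<open>f\<close> into hyperbolic space, whose Levi-Civita connection is the tangential part of the flat
  connection of Minkowski space.\<close>

definition second_fundamental_form ::
  "(real^'k \<Rightarrow> real^'k^'k) \<Rightarrow> (real^'k \<Rightarrow> (real^'m) \<times> real) \<Rightarrow> 'k \<Rightarrow> 'k \<Rightarrow> real^'k \<Rightarrow> (real^'m) \<times> real"
  where
  "second_fundamental_form g f i j x =
     tangent_proj (f x) (coord_deriv i (coord_deriv j f) x)
     - (\<Sum>l\<in>UNIV. christoffel g l i j x *\<^sub>R coord_deriv l f x)"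

definition totally_geodesic_isometric_immersion ::
  "('a, 'k::finite) rchart set \<Rightarrow> ('a \<Rightarrow> (real^'m::finite) \<times> real) \<Rightarrow> bool" where
  "totally_geodesic_isometric_immersion A F \<longleftrightarrow>
     range F \<subseteq> hyperbolic_space \<and>
     (\<forall>c\<in>A. let f = F \<circ> param c in
        smooth_on (chart_image c) f \<and>
        (\<forall>x\<in>chart_image c. \<forall>i j.
           lorentz (coord_deriv i f x) (coord_deriv j f x) = gram c x $ i $ j \<and>
           second_fundamental_form (gram c) f i j x = 0))"

text \<open>\<open>\<phi>\<close> is the homomorphism induced by \<open>f\<close>, and \<open>F\<close> the lift of \<open>f\<close>; both belong to the
  structure of a map of orbifolds.\<close>

definition totally_geodesic_immersion ::
  "('a::topological_space, 'k::finite) rchart set \<Rightarrow> ('u::topological_space \<Rightarrow> 'a) \<Rightarrow> 'u \<Rightarrow>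
   ((real^'m::finite) \<times> real) set \<Rightarrow> ('a \<Rightarrow> ((real^'m) \<times> real) set) \<Rightarrow> bool" where
  "totally_geodesic_immersion A p b P f \<longleftrightarrow>
     range f \<subseteq> coxeter_orbifold P \<and>
     (\<exists>F \<phi>.
        totally_geodesic_isometric_immersion (pullback_atlas p A) F \<and>
        (\<forall>y. f (p y) = orbit (reflection_group P) (\<lambda>h. h) (F y)) \<and>
        \<phi> \<in> hom (fundamental_group (p b)) (reflection_group P) \<and>
        (\<forall>\<alpha>\<in>carrier (fundamental_group (p b)). \<forall>y z.
           deck_action p b \<alpha> y z \<longrightarrow> F z = \<phi> \<alpha> (F y)))"


section \<open>Geodesic residual finiteness growth\<close>

definition geodesic_representative ::
  "('a::topological_space, 'k::finite) rchart set \<Rightarrow> (real \<Rightarrow> 'a) set \<Rightarrow> (real \<Rightarrow> 'a) \<Rightarrow> bool" where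
  "geodesic_representative A \<alpha> \<gamma> \<longleftrightarrow>
     geodesic_line A \<gamma> \<and> (\<forall>t. \<gamma> (t + 1) = \<gamma> t) \<and> (\<exists>c\<in>\<alpha>. homotopic_loops UNIV c \<gamma>)"

text \<open>In the situation of interest the geodesic representative of a nontrivial \<open>\<alpha>\<close> exists and is
  unique up to parametrization, so the infimum is over a singleton.\<close>

definition geodesic_length ::
  "('a::topological_space, 'k::finite) rchart set \<Rightarrow> (real \<Rightarrow> 'a) set \<Rightarrow> ereal" where
  "geodesic_length A \<alpha> = (INF \<gamma>\<in>{\<gamma>. geodesic_representative A \<alpha> \<gamma>}. ereal (curve_length A \<gamma>))"

text \<open>Subgroups of infinite index do not affect the minimum, and the infimum of the empty set
  is \<open>\<infinity>\<close>.\<close>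

definition divisibility :: "('g, 'r) monoid_scheme \<Rightarrow> 'g \<Rightarrow> enat" where
  "divisibility G g =
     (INF H\<in>{H. subgroup H G \<and> g \<notin> H \<and> finite (rcosets\<^bsub>G\<^esub> H)}. enat (card (rcosets\<^bsub>G\<^esub> H)))"

definition geodesic_rf ::
  "('a::topological_space, 'k::finite) rchart set \<Rightarrow> 'a \<Rightarrow> real \<Rightarrow> enat" where
  "geodesic_rf A x r =
     (let G = fundamental_group x;
          S = {\<alpha> \<in> carrier G. \<alpha> \<noteq> \<one>\<^bsub>G\<^esub> \<and> geodesic_length A \<alpha> \<le> ereal r}
      in if S = {} then 1 else (SUP \<alpha>\<in>S. divisibility G \<alpha>))"

definition growth_le :: "(real \<Rightarrow> enat) \<Rightarrow> (real \<Rightarrow> real) \<Rightarrow> bool" where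
  "growth_le f g \<longleftrightarrow>
     (\<exists>C>0. \<forall>n::nat. n \<ge> 1 \<longrightarrow> ereal_of_enat (f (real n)) \<le> ereal (C * g (C * real n)))"

end

theory Submission
  imports Defs
begin

text \<open>Let \<open>\<gamma>\<close> be an element of the Coxeter group \<open>\<Gamma>\<close> of \<open>P\<close> that moves a point \<open>x\<close>. Choose the centre \<open>x0\<close>
  of a chamber near \<open>x\<close>, and let \<open>Q\<close> be the intersection of all half-spaces bounded by walls that
  contain both \<open>x0\<close> and \<open>x1 = \<gamma> x0\<close>. Walls that cross do so at right angles, so \<open>Q\<close> is again a
  right-angled polyhedron, possibly with dihedral angle zero at infinity, and the reflections in its
  facets generate a subgroup \<open>K\<close> of \<open>\<Gamma>\<close> with strict fundamental domain \<open>Q\<close>. Since \<open>x0\<close> and \<open>x1\<close> are both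
  interior to \<open>Q\<close>, \<open>\<gamma>\<close> is not in \<open>K\<close>; the index of \<open>K\<close> is the number of chambers in \<open>Q\<close>. By cocompactness
  a chamber far from the geodesic through \<open>x0\<close> and \<open>x1\<close> is separated from its segment by a wall, so
  \<open>Q\<close> lies in a bounded neighbourhood of that segment and contains at most linearly many chambers in
  terms of \<open>d(x, \<gamma> x)\<close>.

  A geodesic loop representing \<open>\<alpha>\<close> lifts to a curve whose image \<open>X\<close> in the hyperboloid satisfies
  \<open>X'' = \<kappa>\<^sup>2 X\<close> with \<open>\<kappa>\<close> the length of the loop, so \<open>\<phi> \<alpha>\<close> moves the initial point of \<open>X\<close> by exactly \<open>\<kappa>\<close>, and
  the preimage of \<open>K\<close> under \<open>\<phi>\<close> excludes \<open>\<alpha>\<close>.\<close>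

section \<open>Coverings\<close>

text \<open>\<open>all_right_polyhedron\<close> prescribes the angle only for facets with a common
  face of codimension 2, whereas the group theory needs every Gram entry of the facet normals: 0 for
  facets that meet, at most -1 for facets that do not. For facets that meet in a deeper face this is
  a statement about Euclidean cones, applied in the tangent space at a common point; for disjoint
  facets compactness gives a point of one facet closest to the other wall, and stationarity there
  determines the entry. From the Gram entries the geometry of chambers follows by Tits' dichotomy: a
  word maps each normal into the cone of the normals or into its negative. The same argument thus
  serves the facets of \<open>P\<close> and those of the hull \<open>Q\<close>, whose number is not
  known beforehand. Words act linearly on all of Minkowski space, since normals have to be moved as
  well as points. The index count rests on freeness: only the identity fixes the centre
  \<open>o'\<close>, so a group element is determined by the chamber centre it produces, and each
  coset of \<open>K\<close> has a representative carrying \<open>o'\<close> into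
  \<open>Q\<close>.\<close>

lemma covering_sheets:
  assumes cov: "covering_space UNIV p UNIV"
  obtains T \<V> where "x \<in> T" "open T" "\<Union>\<V> = p -` T" "\<forall>V\<in>\<V>. open V"
    "pairwise disjnt \<V>" "\<forall>V\<in>\<V>. \<exists>q. homeomorphism V T p q"
proof -
  have "\<exists>T. x \<in> T \<and> openin (top_of_set UNIV) T \<and>
      (\<exists>\<V>. \<Union>\<V> = UNIV \<inter> p -` T \<and> (\<forall>V\<in>\<V>. openin (top_of_set UNIV) V) \<and>
        pairwise disjnt \<V> \<and> (\<forall>V\<in>\<V>. \<exists>q. homeomorphism V T p q))"
    using cov unfolding covering_space_def by blast
  then obtain T \<V> where "x \<in> T" "open T" "\<Union>\<V> = p -` T" "\<forall>V\<in>\<V>. open V"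
    "pairwise disjnt \<V>" "\<forall>V\<in>\<V>. \<exists>q. homeomorphism V T p q"
    by (elim exE conjE) simp
  then show ?thesis by (rule that)
qed

text \<open>The set where the lifts agree is clopen in \<open>S\<close>: near any point each lift
  stays in one sheet, and the two sheets are either equal, so that injectivity of \<open>p\<close>
  forces agreement, or disjoint.\<close>

lemma covering_lift_unique:
  fixes p :: "'u::topological_space \<Rightarrow> 'a::topological_space"
    and g1 g2 :: "'c::topological_space \<Rightarrow> 'u"
  assumes cov: "covering_space UNIV p UNIV" and S: "connected S"
    and g1: "continuous_on S g1" and g2: "continuous_on S g2"
    and eq: "\<And>x. x \<in> S \<Longrightarrow> p (g1 x) = p (g2 x)"
    and a: "a \<in> S" "g1 a = g2 a" and x: "x \<in> S"
  shows "g1 x = g2 x"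
proof -
  let ?E = "{x \<in> S. g1 x = g2 x}"
  have sheets: "\<exists>W. openin (top_of_set S) W \<and> x \<in> W \<and>
      (\<forall>y\<in>W. (g1 y = g2 y) = (g1 x = g2 x))" if "x \<in> S" for x
  proof -
    obtain T \<V> where T: "p (g1 x) \<in> T" "open T" "\<Union>\<V> = p -` T" "\<forall>V\<in>\<V>. open V"
      "pairwise disjnt \<V>" "\<forall>V\<in>\<V>. \<exists>q. homeomorphism V T p q"
      by (rule covering_sheets[OF cov, of "p (g1 x)"])
    have "g1 x \<in> \<Union>\<V>" using T(1) unfolding T(3) by simp
    then obtain V1 where V1: "V1 \<in> \<V>" "g1 x \<in> V1" by blast
    have "g2 x \<in> \<Union>\<V>" using T(1) eq[OF that] unfolding T(3) by simp
    then obtain V2 where V2: "V2 \<in> \<V>" "g2 x \<in> V2" by blast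
    let ?W = "(S \<inter> g1 -` V1) \<inter> (S \<inter> g2 -` V2)"
    have inj: "inj_on p V1"
    proof -
      obtain q where "homeomorphism V1 T p q" using T(6) V1(1) by blast
      then show ?thesis by (intro inj_on_inverseI[of _ q]) (simp add: homeomorphism_def)
    qed
    have "openin (top_of_set S) ?W"
      using T(4) V1(1) V2(1) by (intro openin_Int continuous_openin_preimage_gen g1 g2) blast+
    moreover have "\<forall>y\<in>?W. (g1 y = g2 y) = (g1 x = g2 x)"
    proof (cases "V1 = V2")
      case True
      have "g1 y = g2 y" if "y \<in> S" "g1 y \<in> V1" "g2 y \<in> V1" for y
        using inj_onD[OF inj eq[OF that(1)]] that by blast
      then show ?thesis using V1 V2 that True by blast
    next
      case False
      then have "V1 \<inter> V2 = {}" using T(5) V1(1) V2(1) by (simp add: pairwise_def disjnt_def)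
      then show ?thesis using V1(2) V2(2) by auto
    qed
    ultimately show ?thesis using V1 V2 that by blast
  qed
  have "openin (top_of_set S) ?E"
  proof (subst openin_subopen, intro ballI)
    fix x assume x: "x \<in> ?E"
    then obtain W where W: "openin (top_of_set S) W" "x \<in> W"
      "\<forall>y\<in>W. (g1 y = g2 y) = (g1 x = g2 x)" using sheets by blast
    then have "W \<subseteq> ?E" using x openin_imp_subset by fastforce
    with W show "\<exists>T. openin (top_of_set S) T \<and> x \<in> T \<and> T \<subseteq> ?E" by blast
  qed
  moreover have "openin (top_of_set S) (S - ?E)"
  proof (subst openin_subopen, intro ballI)
    fix x assume x: "x \<in> S - ?E"
    then obtain W where W: "openin (top_of_set S) W" "x \<in> W"
      "\<forall>y\<in>W. (g1 y = g2 y) = (g1 x = g2 x)" using sheets by blast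
    then have "W \<subseteq> S - ?E" using x openin_imp_subset by fastforce
    with W show "\<exists>T. openin (top_of_set S) T \<and> x \<in> T \<and> T \<subseteq> S - ?E" by blast
  qed
  moreover have "?E \<subseteq> S" by blast
  ultimately have "?E = {} \<or> ?E = S"
    using S connected_clopen[of S] closedin_def[of "top_of_set S" ?E] by auto
  then show ?thesis using a x by blast
qed

text \<open>The lift may be prescribed over an arbitrary point of \<open>S\<close>; this is what
  allows lifts over two overlapping pieces to be glued starting from either piece.\<close>

definition lifts_on ::
  "('u::topological_space \<Rightarrow> 'a::topological_space) \<Rightarrow> ('c::topological_space \<Rightarrow> 'a) \<Rightarrow> 'c set \<Rightarrow> bool"
  where "lifts_on p h S \<longleftrightarrow> (\<forall>x\<in>S. \<forall>e. p e = h x \<longrightarrow>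
     (\<exists>H. continuous_on S H \<and> (\<forall>y\<in>S. p (H y) = h y) \<and> H x = e))"

text \<open>The second lift is chosen to agree with the first at \<open>z\<close>; uniqueness of
  lifts on the connected overlap spreads this agreement, and closedness makes the glued map
  continuous.\<close>

lemma lifts_on_Un_aux:
  assumes cov: "covering_space UNIV p UNIV"
    and "closed S" "closed T" "connected (S \<inter> T)" "z \<in> S \<inter> T"
    and S: "lifts_on p h S" and T: "lifts_on p h T" and x: "x \<in> S" "p e = h x"
  shows "\<exists>H. continuous_on (S \<union> T) H \<and> (\<forall>y\<in>S \<union> T. p (H y) = h y) \<and> H x = e"
proof -
  obtain H1 where H1: "continuous_on S H1" "\<forall>y\<in>S. p (H1 y) = h y" "H1 x = e"
    using S x unfolding lifts_on_def by meson
  obtain H2 where H2: "continuous_on T H2" "\<forall>y\<in>T. p (H2 y) = h y" "H2 z = H1 z"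
    using T H1(2) \<open>z \<in> S \<inter> T\<close> unfolding lifts_on_def by (meson IntE)
  have agree: "H1 y = H2 y" if y: "y \<in> S \<inter> T" for y
  proof (rule covering_lift_unique[OF cov \<open>connected (S \<inter> T)\<close>, where a = z])
    show "continuous_on (S \<inter> T) H1" "continuous_on (S \<inter> T) H2"
      using H1(1) H2(1) by (blast intro: continuous_on_subset)+
    show "p (H1 x) = p (H2 x)" if "x \<in> S \<inter> T" for x
      using H1(2) H2(2) that by simp
    show "z \<in> S \<inter> T" "H1 z = H2 z" "y \<in> S \<inter> T"
      using assms(5) H2(3) y by simp_all
  qed
  let ?H = "\<lambda>y. if y \<in> S then H1 y else H2 y"
  have "continuous_on (S \<union> T) ?H"
    using agree H1(1) H2(1) assms(2,3) by (intro continuous_on_cases) auto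
  then show ?thesis using H1(2,3) H2(2) x(1) by (intro exI[of _ ?H]) auto
qed

lemma lifts_on_Un:
  assumes "covering_space UNIV p UNIV"
    and "closed S" "closed T" "connected (S \<inter> T)" "S \<inter> T \<noteq> {}"
    and "lifts_on p h S" "lifts_on p h T"
  shows "lifts_on p h (S \<union> T)"
  unfolding lifts_on_def
proof (intro ballI allI impI)
  fix x e assume "x \<in> S \<union> T" and e: "p e = h x"
  obtain z where z: "z \<in> S \<inter> T" using assms(5) by blast
  consider "x \<in> S" | "x \<in> T" using \<open>x \<in> S \<union> T\<close> by blast
  then show "\<exists>H. continuous_on (S \<union> T) H \<and> (\<forall>y\<in>S \<union> T. p (H y) = h y) \<and> H x = e"
  proof cases
    case 1
    show ?thesis by (rule lifts_on_Un_aux[OF assms(1-4) z assms(6,7) 1 e])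
  next
    case 2
    have "connected (T \<inter> S)" "z \<in> T \<inter> S"
      using assms(4) z by (simp_all add: Int_commute)
    from lifts_on_Un_aux[OF assms(1) assms(3,2) this assms(7,6) 2 e]
    show ?thesis by (simp add: Un_commute)
  qed
qed

lemma lifts_on_locally:
  fixes h :: "'c::topological_space \<Rightarrow> 'a::topological_space"
  assumes cov: "covering_space UNIV p UNIV" and h: "continuous_on UNIV h"
  shows "\<exists>W. open W \<and> x \<in> W \<and> (\<forall>S\<subseteq>W. lifts_on p h S)"
proof -
  obtain T \<V> where T: "h x \<in> T" "open T" "\<Union>\<V> = p -` T"
      "\<forall>V\<in>\<V>. \<exists>q. homeomorphism V T p q"
    by (rule covering_sheets[OF cov, of "h x"])
  have "lifts_on p h S" if S: "S \<subseteq> h -` T" for S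
    unfolding lifts_on_def
  proof (intro ballI allI impI)
    fix x e assume x: "x \<in> S" "p e = h x"
    then have "p e \<in> T" using S by auto
    then have "e \<in> \<Union>\<V>" unfolding T(3) by simp
    then obtain V q where V: "V \<in> \<V>" "e \<in> V" "homeomorphism V T p q" using T(4) by blast
    have "continuous_on T q" "h ` S \<subseteq> T" using V(3) S by (auto simp: homeomorphism_def)
    then have "continuous_on S (q \<circ> h)"
      using h by (meson continuous_on_compose continuous_on_subset subset_UNIV)
    moreover have "\<forall>y\<in>S. p ((q \<circ> h) y) = h y"
      using V(3) S by (auto simp: homeomorphism_def)
    moreover have "(q \<circ> h) x = e" using V x by (metis comp_apply homeomorphism_apply1)
    ultimately show "\<exists>H. continuous_on S H \<and> (\<forall>y\<in>S. p (H y) = h y) \<and> H x = e" by blast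
  qed
  then show ?thesis using T(1,2) h by (intro exI[of _ "h -` T"]) (auto simp: open_vimage)
qed

text \<open>Two bisection arguments take the place of a Lebesgue number: the inner one stacks small
  boxes into a thin strip around each \<open>x\<close>, the outer one joins strips along vertical
  edges.\<close>

lemma lifts_on_rectangle:
  fixes h :: "real \<times> real \<Rightarrow> 'a::topological_space"
  assumes cov: "covering_space UNIV p UNIV" and h: "continuous_on UNIV h"
    and "a \<le> b" "c \<le> d"
  shows "lifts_on p h ({a..b} \<times> {c..d})"
proof -
  have closed: "closed ({u..v} \<times> {w..z})" for u v w z :: real
    by (intro closed_Times) auto
  have conn: "connected ({u..v} \<times> {w..z})" for u v w z :: real
    by (intro connected_Times) auto
  have strip: "\<exists>\<delta>>0. \<forall>a b. a \<le> x \<and> x \<le> b \<and> b - a < \<delta> \<longrightarrow> lifts_on p h ({a..b} \<times> {c..d})"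
    if "c \<le> d" for x c d
  proof (rule Bolzano[OF that])
    fix c e d
    assume 1: "\<exists>\<delta>>0. \<forall>a b. a \<le> x \<and> x \<le> b \<and> b - a < \<delta> \<longrightarrow> lifts_on p h ({a..b} \<times> {c..e})"
      and 2: "\<exists>\<delta>>0. \<forall>a b. a \<le> x \<and> x \<le> b \<and> b - a < \<delta> \<longrightarrow> lifts_on p h ({a..b} \<times> {e..d})"
      and le: "c \<le> e" "e \<le> d"
    obtain \<delta>1 \<delta>2 where \<delta>: "\<delta>1 > 0" "\<delta>2 > 0"
      "\<forall>a b. a \<le> x \<and> x \<le> b \<and> b - a < \<delta>1 \<longrightarrow> lifts_on p h ({a..b} \<times> {c..e})"
      "\<forall>a b. a \<le> x \<and> x \<le> b \<and> b - a < \<delta>2 \<longrightarrow> lifts_on p h ({a..b} \<times> {e..d})"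
      using 1 2 by blast
    have "lifts_on p h ({a..b} \<times> {c..d})" if "a \<le> x \<and> x \<le> b \<and> b - a < min \<delta>1 \<delta>2" for a b
    proof -
      have eq: "({a..b} \<times> {c..e}) \<inter> ({a..b} \<times> {e..d}) = {a..b} \<times> {e..e}"
        "({a..b} \<times> {c..e}) \<union> ({a..b} \<times> {e..d}) = {a..b} \<times> {c..d}" using le by auto
      have "{a..b} \<times> {e..e} \<noteq> {}" using that by simp
      then show ?thesis
        using lifts_on_Un[OF cov closed closed, of a b c e a b e d h] \<delta> that conn[of a b e e]
        unfolding eq by simp
    qed
    then show "\<exists>\<delta>>0. \<forall>a b. a \<le> x \<and> x \<le> b \<and> b - a < \<delta> \<longrightarrow> lifts_on p h ({a..b} \<times> {c..d})"
      using \<delta>(1,2) by (intro exI[of _ "min \<delta>1 \<delta>2"]) simp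
  next
    fix y
    obtain W where W: "open W" "(x, y) \<in> W" "\<forall>S\<subseteq>W. lifts_on p h S"
      using lifts_on_locally[OF cov h] by blast
    obtain A B where AB: "open A" "open B" "x \<in> A" "y \<in> B" "A \<times> B \<subseteq> W"
      using open_prod_elim[OF W(1,2)] by (metis mem_Sigma_iff)
    obtain e1 where e1: "e1 > 0" "cball x e1 \<subseteq> A" using AB open_contains_cball by meson
    obtain e2 where e2: "e2 > 0" "cball y e2 \<subseteq> B" using AB open_contains_cball by meson
    have "{a..b} \<times> {c..d} \<subseteq> W" if "a \<le> x \<and> x \<le> b \<and> b - a < e1" "c \<le> y \<and> y \<le> d \<and> d - c < e2"
      for a b c d
    proof -
      have "{a..b} \<subseteq> cball x e1" "{c..d} \<subseteq> cball y e2" using that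
        by (auto simp: dist_real_def)
      then show ?thesis using AB e1 e2 by blast
    qed
    then have sm: "\<exists>\<delta>>0. \<forall>a b. a \<le> x \<and> x \<le> b \<and> b - a < \<delta> \<longrightarrow> lifts_on p h ({a..b} \<times> {c..d})"
      if "c \<le> y \<and> y \<le> d \<and> d - c < e2" for c d
      using W(3) that e1(1) by (intro exI[of _ e1]) simp
    show "\<exists>d>0. \<forall>a b. a \<le> y \<and> y \<le> b \<and> b - a < d \<longrightarrow>
        (\<exists>\<delta>>0. \<forall>aa ba. aa \<le> x \<and> x \<le> ba \<and> ba - aa < \<delta> \<longrightarrow> lifts_on p h ({aa..ba} \<times> {a..b}))"
      using sm e2(1) by (intro exI[of _ e2]) simp
  qed
  show ?thesis
  proof (rule Bolzano[OF \<open>a \<le> b\<close>])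
    fix a e b
    assume 1: "lifts_on p h ({a..e} \<times> {c..d})" and 2: "lifts_on p h ({e..b} \<times> {c..d})"
      and le: "a \<le> e" "e \<le> b"
    have eq: "({a..e} \<times> {c..d}) \<inter> ({e..b} \<times> {c..d}) = {e..e} \<times> {c..d}"
      "({a..e} \<times> {c..d}) \<union> ({e..b} \<times> {c..d}) = {a..b} \<times> {c..d}" using le by auto
    have "{e..e} \<times> {c..d} \<noteq> {}" using \<open>c \<le> d\<close> by simp
    then show "lifts_on p h ({a..b} \<times> {c..d})"
      using lifts_on_Un[OF cov closed closed, of a e c d e b c d h] 1 2 conn[of e e c d]
      unfolding eq by simp
  qed (use strip[OF \<open>c \<le> d\<close>] in blast)
qed

lemma covering_lift_square:
  fixes h :: "real \<times> real \<Rightarrow> 'a::topological_space"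
  assumes cov: "covering_space UNIV p UNIV" and h: "continuous_on ({0..1} \<times> {0..1}) h"
    and "p b = h (0, 0)"
  obtains H where "continuous_on ({0..1} \<times> {0..1}) H" "H (0, 0) = b"
    "\<And>z. z \<in> {0..1} \<times> {0..1} \<Longrightarrow> p (H z) = h z"
proof -
  \<comment> \<open>The retraction of the plane onto the unit square extends \<open>h\<close> to a
    map that is continuous everywhere, as the local lifting lemma expects.\<close>
  define cl where "cl = (\<lambda>z::real \<times> real. (max 0 (min 1 (fst z)), max 0 (min 1 (snd z))))"
  have cl: "continuous_on UNIV cl" "cl z \<in> {0..1} \<times> {0..1}" for z
    unfolding cl_def by (intro continuous_intros) auto
  have cl_id: "cl z = z" if "z \<in> {0..1} \<times> {0..1}" for z
    using that by (auto simp: cl_def)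
  have "continuous_on UNIV (h \<circ> cl)"
    using cl(1) by (rule continuous_on_compose)
      (rule continuous_on_subset[OF h], use cl(2) in blast)
  then have lifts: "lifts_on p (h \<circ> cl) ({0..1} \<times> {0..1})"
    using lifts_on_rectangle[OF cov, of "h \<circ> cl" 0 1 0 1] by simp
  have "p b = (h \<circ> cl) (0, 0)" using assms(3) cl_id[of "(0, 0)"] by simp
  then obtain H where H: "continuous_on ({0..1} \<times> {0..1}) H"
    "\<forall>y\<in>{0..1} \<times> {0..1}. p (H y) = (h \<circ> cl) y" "H (0, 0) = b"
    using lifts[unfolded lifts_on_def, rule_format, of "(0, 0)" b] by auto
  show ?thesis
    by (rule that[of H]) (use H cl_id in auto)
qed

text \<open>The lifted square \<open>H\<close> itself contains the witnesses for
  \<open>deck_action\<close>: the edge at parameter 0 lifts \<open>c\<close> from \<open>b\<close>,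
  and the two edges traced by the base point of the loops lift the same path, from \<open>b\<close>
  to \<open>G 0\<close> and from the end of the lifted loop to \<open>G 1\<close>.\<close>

lemma homotopic_loops_lift:
  fixes p :: "'u::topological_space \<Rightarrow> 'a::topological_space"
  assumes cov: "covering_space UNIV p UNIV"
    and c: "c \<in> \<alpha>" and \<alpha>: "\<alpha> \<in> carrier (fundamental_group (p b))"
    and hom: "homotopic_loops UNIV c \<gamma>"
  obtains G where "continuous_on {0..1} G" "\<And>t. t \<in> {0..1} \<Longrightarrow> p (G t) = \<gamma> t"
    "deck_action p b \<alpha> (G 0) (G 1)"
proof -
  obtain c0 where c0: "\<alpha> = path_class c0" "path c0" "pathstart c0 = p b" "pathfinish c0 = p b"
    using \<alpha> unfolding fundamental_group_def by auto
  have cc0: "homotopic_paths UNIV c0 c" using c c0 unfolding path_class_def by auto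
  have pc: "path c" "c 0 = p b"
    using cc0 c0 homotopic_paths_imp_path homotopic_paths_imp_pathstart
    unfolding pathstart_def by (blast, metis)
  obtain h :: "real \<times> real \<Rightarrow> 'a" where h: "continuous_on ({0..1} \<times> {0..1}) h"
    "\<forall>x\<in>{0..1}. h (0, x) = c x" "\<forall>x\<in>{0..1}. h (1, x) = \<gamma> x"
    "\<forall>t\<in>{0..1}. h (t, 1) = h (t, 0)"
    using hom unfolding homotopic_loops pathstart_def pathfinish_def by auto
  obtain H where H: "continuous_on ({0..1} \<times> {0..1}) H" "H (0, 0) = b"
    "\<And>z. z \<in> {0..1} \<times> {0..1} \<Longrightarrow> p (H z) = h z"
    by (rule covering_lift_square[OF cov h(1), of b]) (use h(2) pc(2) in auto)
  have row: "continuous_on {0..1} (\<lambda>t. H (s, t))" if "s \<in> {0..1}" for s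
    by (rule continuous_on_compose2[OF H(1)]) (use that in \<open>auto intro!: continuous_intros\<close>)
  have col: "continuous_on {0..1} (\<lambda>s. H (s, t))" if "t \<in> {0..1}" for t
    by (rule continuous_on_compose2[OF H(1)]) (use that in \<open>auto intro!: continuous_intros\<close>)
  have "homotopic_paths UNIV c (p \<circ> (\<lambda>t. H (0, t)))"
    using pc h H by (intro homotopic_paths_eq) auto
  then have "p \<circ> (\<lambda>t. H (0, t)) \<in> \<alpha>"
    using cc0 homotopic_paths_trans unfolding c0 path_class_def by blast
  then have "deck_action p b \<alpha> (H (1, 0)) (H (1, 1))"
    unfolding deck_action_def
    using row[of 0] col[of 0] col[of 1] H h
    by (intro exI[of _ "\<lambda>t. H (0, t)"] exI[of _ "\<lambda>s. H (s, 0)"] exI[of _ "\<lambda>s. H (s, 1)"])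
      (auto simp: path_def pathstart_def pathfinish_def)
  then show ?thesis
    using that[of "\<lambda>t. H (1, t)"] row[of 1] H h by auto
qed

section \<open>The fundamental group\<close>

lemma homotopic_paths_const_left:
  fixes c :: "real \<Rightarrow> 'a::topological_space"
  assumes "path c" "pathstart c = x"
  shows "homotopic_paths UNIV ((\<lambda>_. x) +++ c) c"
proof -
  have "homotopic_paths UNIV c ((\<lambda>_. x) +++ c)"
  proof (rule homotopic_paths_reparametrize[where f = "\<lambda>t. max 0 (2 * t - 1)"])
    show "continuous_on {0..1} (\<lambda>t::real. max 0 (2 * t - 1))" by (intro continuous_intros)
    show "((\<lambda>_. x) +++ c) t = c (max 0 (2 * t - 1))" for t
    proof (cases "t \<le> 1/2")
      case True
      then have "max 0 (2 * t - 1) = 0" by simp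
      then show ?thesis using assms True by (simp add: joinpaths_def pathstart_def)
    qed (simp add: joinpaths_def max_def)
  qed (use assms in auto)
  then show ?thesis by (simp add: homotopic_paths_sym)
qed

text \<open>At time \<open>s\<close> the homotopy runs \<open>c\<close> backwards from its end to
  \<open>c s\<close> and returns, which is \<open>c\<close> applied to the maximum of
  \<open>s\<close> and \<open>\<bar>2 * t - 1\<bar>\<close>.\<close>

lemma homotopic_paths_reversepath_left:
  fixes c :: "real \<Rightarrow> 'a::topological_space"
  assumes "path c" "pathfinish c = x"
  shows "homotopic_paths UNIV (reversepath c +++ c) (\<lambda>_. x)"
proof -
  define k where "k = (\<lambda>z::real \<times> real. c (max (fst z) (if snd z \<le> 1/2 then 1 - 2 * snd z else 2 * snd z - 1)))"
  have k: "k = (\<lambda>z. c (max (fst z) \<bar>2 * snd z - 1\<bar>))"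
    unfolding k_def by (intro ext arg_cong[where f = c]) (auto simp: abs_if)
  have "continuous_on ({0..1} \<times> {0..1}) k"
    unfolding k
    by (rule continuous_on_compose2[OF assms(1)[unfolded path_def]])
      (auto intro!: continuous_intros)
  then show ?thesis
    unfolding homotopic_paths
    using assms by (intro exI[of _ k])
      (auto simp: k_def joinpaths_def reversepath_def pathstart_def pathfinish_def abs_if max_def intro!: arg_cong[where f = c])
qed

lemma path_class_eq_iff:
  assumes "path c"
  shows "path_class c = path_class d \<longleftrightarrow> homotopic_paths UNIV c d"
proof
  assume "path_class c = path_class d"
  moreover have "c \<in> path_class c" using assms by (simp add: path_class_def)
  ultimately show "homotopic_paths UNIV c d"
    by (simp add: path_class_def homotopic_paths_sym_eq)
next
  assume "homotopic_paths UNIV c d"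
  then show "path_class c = path_class d"
    unfolding path_class_def by (auto intro: homotopic_paths_trans homotopic_paths_sym)
qed

lemma fundamental_group_mult:
  assumes "path a" "path b" "pathfinish a = pathstart b"
  shows "path_class a \<otimes>\<^bsub>fundamental_group x\<^esub> path_class b = path_class (a +++ b)"
proof -
  have "homotopic_paths UNIV (a +++ b) d"
    if "homotopic_paths UNIV a a'" "homotopic_paths UNIV b b'" "homotopic_paths UNIV (a' +++ b') d"
    for a' b' d
    using that assms by (meson homotopic_paths_join homotopic_paths_trans)
  moreover have "homotopic_paths UNIV a a" "homotopic_paths UNIV b b" using assms by auto
  ultimately have "{d. \<exists>a'\<in>path_class a. \<exists>b'\<in>path_class b. homotopic_paths UNIV (a' +++ b') d} =
      path_class (a +++ b)"
    unfolding path_class_def by blast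
  then show ?thesis by (simp add: fundamental_group_def)
qed

lemma group_fundamental_group: "group (fundamental_group x)"
proof (rule groupI)
  let ?G = "fundamental_group x"
  have carr: "\<alpha> \<in> carrier ?G \<longleftrightarrow>
      (\<exists>c. \<alpha> = path_class c \<and> path c \<and> pathstart c = x \<and> pathfinish c = x)" for \<alpha>
    by (auto simp: fundamental_group_def)
  have const: "path (\<lambda>_. x)" "pathstart (\<lambda>_. x) = x" "pathfinish (\<lambda>_. x) = x"
    by (auto simp: path_def pathstart_def pathfinish_def)
  have one: "\<one>\<^bsub>?G\<^esub> = path_class (\<lambda>_. x)" by (simp add: fundamental_group_def)
  show "\<alpha> \<otimes>\<^bsub>?G\<^esub> \<beta> \<in> carrier ?G" if "\<alpha> \<in> carrier ?G" "\<beta> \<in> carrier ?G" for \<alpha> \<beta>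
    using that unfolding carr by (auto simp: fundamental_group_mult)
  show "\<one>\<^bsub>?G\<^esub> \<in> carrier ?G" unfolding carr one using const by blast
  show "\<alpha> \<otimes>\<^bsub>?G\<^esub> \<beta> \<otimes>\<^bsub>?G\<^esub> \<gamma> = \<alpha> \<otimes>\<^bsub>?G\<^esub> (\<beta> \<otimes>\<^bsub>?G\<^esub> \<gamma>)"
    if "\<alpha> \<in> carrier ?G" "\<beta> \<in> carrier ?G" "\<gamma> \<in> carrier ?G" for \<alpha> \<beta> \<gamma>
  proof -
    obtain a b c where abc: "\<alpha> = path_class a" "path a" "pathstart a = x" "pathfinish a = x"
      "\<beta> = path_class b" "path b" "pathstart b = x" "pathfinish b = x"
      "\<gamma> = path_class c" "path c" "pathstart c = x" "pathfinish c = x"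
      using \<open>\<alpha> \<in> carrier ?G\<close> \<open>\<beta> \<in> carrier ?G\<close> \<open>\<gamma> \<in> carrier ?G\<close> unfolding carr by metis
    have "homotopic_paths UNIV ((a +++ b) +++ c) (a +++ (b +++ c))"
      using abc by (intro homotopic_paths_sym[OF homotopic_paths_assoc]) auto
    then show ?thesis using abc by (simp add: fundamental_group_mult path_class_eq_iff)
  qed
  show "\<one>\<^bsub>?G\<^esub> \<otimes>\<^bsub>?G\<^esub> \<alpha> = \<alpha>" if \<alpha>: "\<alpha> \<in> carrier ?G" for \<alpha>
  proof -
    obtain c where c: "\<alpha> = path_class c" "path c" "pathstart c = x" "pathfinish c = x"
      using \<alpha> unfolding carr by blast
    have "homotopic_paths UNIV ((\<lambda>_. x) +++ c) c"
      using c by (intro homotopic_paths_const_left)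
    then show ?thesis
      using c const by (simp add: one fundamental_group_mult path_class_eq_iff)
  qed
  show "\<exists>\<beta>\<in>carrier ?G. \<beta> \<otimes>\<^bsub>?G\<^esub> \<alpha> = \<one>\<^bsub>?G\<^esub>" if \<alpha>: "\<alpha> \<in> carrier ?G" for \<alpha>
  proof -
    obtain c where c: "\<alpha> = path_class c" "path c" "pathstart c = x" "pathfinish c = x"
      using \<alpha> unfolding carr by blast
    then have "path_class (reversepath c) \<otimes>\<^bsub>?G\<^esub> \<alpha> = \<one>\<^bsub>?G\<^esub>"
      by (simp add: fundamental_group_mult one path_class_eq_iff homotopic_paths_reversepath_left)
    moreover have "path_class (reversepath c) \<in> carrier ?G" unfolding carr using c
      by (intro exI[of _ "reversepath c"]) auto
    ultimately show ?thesis by blast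
  qed
qed

text \<open>A free homotopy moves the base point along \<open>e\<close>. Conjugating by initial
  segments of \<open>e\<close> makes it based: \<open>k\<close> runs out along \<open>e\<close>,
  around the loop of the homotopy, and back. It ends with \<open>e\<close> followed by its reverse,
  which \<open>k'\<close> contracts.\<close>

lemma homotopic_loops_const_imp_one:
  fixes c \<gamma> :: "real \<Rightarrow> 'a::topological_space"
  assumes \<alpha>: "\<alpha> \<in> carrier (fundamental_group x)" and c: "c \<in> \<alpha>"
    and hom: "homotopic_loops UNIV c \<gamma>" and const: "\<And>t. t \<in> {0..1} \<Longrightarrow> \<gamma> t = \<gamma> 0"
  shows "\<alpha> = \<one>\<^bsub>fundamental_group x\<^esub>"
proof -
  obtain c0 where c0: "\<alpha> = path_class c0" "path c0" "pathstart c0 = x" "pathfinish c0 = x"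
    using \<alpha> unfolding fundamental_group_def by auto
  have cc0: "homotopic_paths UNIV c0 c" using c c0 unfolding path_class_def by auto
  obtain h :: "real \<times> real \<Rightarrow> 'a" where h: "continuous_on ({0..1} \<times> {0..1}) h"
    "\<forall>x\<in>{0..1}. h (0, x) = c x" "\<forall>x\<in>{0..1}. h (1, x) = \<gamma> x"
    "\<forall>t\<in>{0..1}. h (t, 1) = h (t, 0)"
    using hom unfolding homotopic_loops pathstart_def pathfinish_def by auto
  define e where "e = (\<lambda>s. h (s, 0::real))"
  have c: "path c" "c 0 = x" "c 1 = x"
    using cc0 c0 homotopic_paths_imp_path homotopic_paths_imp_pathstart homotopic_paths_imp_pathfinish
    unfolding pathstart_def pathfinish_def by (blast, metis, metis)
  have e: "path e" "e 0 = x"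
    unfolding path_def e_def
    using h(2) c(2) by (auto intro!: continuous_on_compose2[OF h(1)] continuous_intros)
  define m where "m = (\<lambda>t::real. 3 * min t (1 - t))"
  define r where "r = (\<lambda>t::real. min 1 (max 0 (3 * t - 1)))"
  define k where "k = (\<lambda>z. h (min (fst z) (m (snd z)), r (snd z)))"
  define k' where "k' = (\<lambda>z. e (min (fst z) (m (snd z))))"
  have m: "continuous_on S m" "m 0 = 0" "m 1 = 0" "t \<in> {0..1} \<Longrightarrow> m t \<ge> 0" for S t
    unfolding m_def by (auto intro!: continuous_intros)
  have r: "continuous_on S r" "r 0 = 0" "r 1 = 1" "r t \<in> {0..1}" for S t
    unfolding r_def by (auto intro!: continuous_intros)
  \<comment> \<open>On the middle third the excursion along \<open>e\<close> has reached full depth;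
    on the outer thirds the loop parameter rests at 0 or 1, where the homotopy equals
    \<open>e\<close>. Hence the final stage depends only on \<open>m\<close>.\<close>
  have mr: "m t \<ge> 1 \<or> r t = 0 \<or> r t = 1" for t
  proof -
    consider "t \<le> 1/3" | "t \<ge> 2/3" | "1/3 \<le> t" "t \<le> 2/3" by linarith
    then show ?thesis
    proof cases
      case 3
      then have "1 \<le> m t" by (simp add: m_def min_def)
      then show ?thesis by blast
    qed (simp_all add: r_def)
  qed
  have k1: "k (1, t) = e (min 1 (m t))" if "t \<in> {0..1}" for t
  proof -
    consider "m t \<ge> 1" | "r t = 0" | "r t = 1" using mr by blast
    then show ?thesis
    proof cases
      case 1
      then show ?thesis using h(3) const[OF r(4)] r(4) by (simp add: k_def e_def)
    qed (use h(4) m(4)[OF that] in \<open>auto simp: k_def e_def min_def\<close>)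
  qed
  have cont: "continuous_on ({0..1} \<times> {0..1}) k"
    unfolding k_def
    by (rule continuous_on_compose2[OF h(1)])
      (use m(4) r(4) in \<open>auto intro!: continuous_intros continuous_on_compose2[OF m(1)]
        continuous_on_compose2[OF r(1)] simp: min_le_iff_disj\<close>)
  have cont': "continuous_on ({0..1} \<times> {0..1}) k'"
    unfolding k'_def
    by (rule continuous_on_compose2[OF e(1)[unfolded path_def]])
      (use m(4) in \<open>auto intro!: continuous_intros continuous_on_compose2[OF m(1)]
        simp: min_le_iff_disj\<close>)
  have k0: "k (0, t) = c (r t)" if "t \<in> {0..1}" for t
    using m(4)[OF that] h(2) r(4) by (simp add: k_def min_def)
  have "homotopic_paths UNIV c (\<lambda>t. k (0, t))"
    by (rule homotopic_paths_reparametrize[where f = r]) (use c r k0 in auto)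
  moreover have "homotopic_paths UNIV (\<lambda>t. k (0, t)) (\<lambda>t. k (1, t))"
    unfolding homotopic_paths
    by (rule exI[of _ k]) (use cont m r h(4) in
        \<open>auto simp: k_def pathstart_def pathfinish_def min_def\<close>)
  moreover have "homotopic_paths UNIV (\<lambda>_. x) (\<lambda>t. k (1, t))"
    unfolding homotopic_paths
    by (rule exI[of _ k']) (use cont' m k1 e(2) in
        \<open>auto simp: k'_def pathstart_def pathfinish_def min_def\<close>)
  ultimately have "homotopic_paths UNIV c (\<lambda>_. x)"
    by (meson homotopic_paths_sym homotopic_paths_trans)
  then have "homotopic_paths UNIV c0 (\<lambda>_. x)" using cc0 homotopic_paths_trans by blast
  then show ?thesis using c0 by (simp add: fundamental_group_def path_class_eq_iff)
qed

section \<open>Minkowski space\<close>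

lemma bounded_bilinear_lorentz: "bounded_bilinear (lorentz :: (real^'m::finite) \<times> real \<Rightarrow> _)"
proof -
  have "bounded_linear (\<lambda>y::(real^'m) \<times> real. (fst y, - snd y))"
    by (intro bounded_linear_Pair bounded_linear_fst bounded_linear_minus bounded_linear_snd)
  from bounded_bilinear.comp[OF bounded_bilinear_inner bounded_linear_ident this]
  show ?thesis by (simp add: lorentz_def[abs_def] inner_prod_def)
qed

interpretation lorentz: bounded_bilinear "lorentz :: (real^'m::finite) \<times> real \<Rightarrow> _"
  by (rule bounded_bilinear_lorentz)

lemmas lorentz_simps = lorentz.add_left lorentz.add_right lorentz.diff_left lorentz.diff_right
  lorentz.minus_left lorentz.minus_right lorentz.scaleR_left lorentz.scaleR_right
  lorentz.zero_left lorentz.zero_right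

lemma lorentz_commute: "lorentz x y = lorentz y x"
  by (simp add: lorentz_def inner_commute mult.commute)

lemma hyperbolic_spaceD:
  assumes "x \<in> hyperbolic_space"
  shows "lorentz x x = -1" "snd x > 0" "fst x \<bullet> fst x = (snd x)\<^sup>2 - 1" "norm (fst x) < snd x"
    "snd x \<ge> 1"
proof -
  show *: "lorentz x x = -1" "snd x > 0" "fst x \<bullet> fst x = (snd x)\<^sup>2 - 1"
    using assms by (auto simp: hyperbolic_space_def lorentz_def power2_eq_square)
  then have "(norm (fst x))\<^sup>2 < (snd x)\<^sup>2" by (simp add: power2_norm_eq_inner)
  then show "norm (fst x) < snd x" by (rule power2_less_imp_less) (use * in simp)
  have "1\<^sup>2 \<le> (snd x)\<^sup>2" using *(3) inner_ge_zero[of "fst x"] by simp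
  then show "snd x \<ge> 1" by (rule power2_le_imp_le) (use * in simp)
qed

text \<open>The spatial part of the Lorentz boost that carries \<open>x\<close> to
  \<open>(0, 1)\<close>, simplified for vectors orthogonal to \<open>x\<close>. It is an isometry of
  the tangent space at \<open>x\<close> onto Euclidean space, with inverse
  \<open>tangent_vec\<close>, and so imports Cauchy-Schwarz and the Euclidean cone theorem.\<close>

definition tangent_coord :: "(real^'m::finite) \<times> real \<Rightarrow> (real^'m) \<times> real \<Rightarrow> real^'m" where
  "tangent_coord x t = fst t - (snd t / (1 + snd x)) *\<^sub>R fst x"

definition tangent_vec :: "(real^'m::finite) \<times> real \<Rightarrow> real^'m \<Rightarrow> (real^'m) \<times> real" where
  "tangent_vec x y = (y + ((fst x \<bullet> y) / (1 + snd x)) *\<^sub>R fst x, fst x \<bullet> y)"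

lemma tangent_coord_inner:
  assumes x: "x \<in> hyperbolic_space" and s: "lorentz s x = 0" and t: "lorentz t x = 0"
  shows "tangent_coord x s \<bullet> tangent_coord x t = lorentz s t"
proof -
  define a b where "a = fst x" and "b = snd x"
  have b: "b > 0" and aa: "a \<bullet> a = (1 + b) * (b - 1)"
    using hyperbolic_spaceD[OF x] by (auto simp: a_def b_def power2_eq_square algebra_simps)
  have sa: "fst s \<bullet> a = snd s * b" and ta: "a \<bullet> fst t = snd t * b"
    using s t by (auto simp: lorentz_def a_def b_def inner_commute)
  define k where "k = 1 / (1 + b)"
  have k: "k * (1 + b) = 1" using b by (simp add: k_def)
  have "tangent_coord x s \<bullet> tangent_coord x t =
      (fst s - (snd s * k) *\<^sub>R a) \<bullet> (fst t - (snd t * k) *\<^sub>R a)"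
    by (simp add: tangent_coord_def a_def b_def k_def)
  also have "\<dots> = fst s \<bullet> fst t - snd t * k * (fst s \<bullet> a) - snd s * k * (a \<bullet> fst t)
      + snd s * k * (snd t * k) * (a \<bullet> a)"
    by (simp add: inner_diff_left inner_diff_right algebra_simps)
  also have "\<dots> = fst s \<bullet> fst t - 2 * snd s * snd t * b * k
      + snd s * snd t * (k * (1 + b)) * (k * (b - 1))"
    unfolding sa ta aa by (simp add: algebra_simps)
  also have "\<dots> = fst s \<bullet> fst t - 2 * snd s * snd t * b * k + snd s * snd t * (k * (b - 1))"
    by (simp only: k mult_1_right)
  also have "\<dots> = fst s \<bullet> fst t - snd s * snd t * (k * (1 + b))"
    by (simp add: algebra_simps)
  finally show ?thesis by (simp only: k) (simp add: lorentz_def)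
qed

lemma tangent_vec:
  assumes x: "x \<in> hyperbolic_space"
  shows "lorentz (tangent_vec x y) x = 0" "tangent_coord x (tangent_vec x y) = y"
proof -
  have x': "snd x > 0" "fst x \<bullet> fst x = (1 + snd x) * (snd x - 1)"
    using hyperbolic_spaceD[OF x] by (auto simp: power2_eq_square algebra_simps)
  have "(fst x \<bullet> y) / (1 + snd x) * (fst x \<bullet> fst x) = (fst x \<bullet> y) * (snd x - 1)"
    unfolding x'(2) using x'(1) by simp
  then show "lorentz (tangent_vec x y) x = 0"
    by (simp add: lorentz_def tangent_vec_def inner_add_left inner_commute[of y] algebra_simps)
  show "tangent_coord x (tangent_vec x y) = y"
    by (simp add: tangent_coord_def tangent_vec_def)
qed

lemma tangent_nonneg:
  assumes x: "x \<in> hyperbolic_space" and t: "lorentz t x = 0"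
  shows "lorentz t t \<ge> 0" "lorentz t t = 0 \<longleftrightarrow> t = 0"
proof -
  show "lorentz t t \<ge> 0" using tangent_coord_inner[OF x t t] by (metis inner_ge_zero)
  have "t = 0" if "lorentz t t = 0"
  proof -
    have x': "snd x > 0" "fst x \<bullet> fst x = (1 + snd x) * (snd x - 1)"
      using hyperbolic_spaceD[OF x] by (auto simp: power2_eq_square algebra_simps)
    have "tangent_coord x t = 0" using tangent_coord_inner[OF x t t] that by simp
    then have u: "fst t = (snd t / (1 + snd x)) *\<^sub>R fst x" by (simp add: tangent_coord_def)
    have "snd t * snd x = fst t \<bullet> fst x" using t by (simp add: lorentz_def)
    also have "\<dots> = snd t * (snd x - 1)" unfolding u using x' by simp
    finally have "snd t = 0" by (simp add: algebra_simps)
    with u show ?thesis by (simp add: prod_eq_iff)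
  qed
  then show "lorentz t t = 0 \<longleftrightarrow> t = 0" by (auto simp: lorentz_simps)
qed

lemma tangent_Cauchy_Schwarz:
  assumes x: "x \<in> hyperbolic_space" and s: "lorentz s x = 0" and t: "lorentz t x = 0"
  shows "\<bar>lorentz s t\<bar> \<le> sqrt (lorentz s s) * sqrt (lorentz t t)"
  unfolding tangent_coord_inner[OF x s t, symmetric] tangent_coord_inner[OF x t t, symmetric]
    tangent_coord_inner[OF x s s, symmetric]
  by (metis Cauchy_Schwarz_ineq2 norm_eq_sqrt_inner)

lemma tangent_proj_orth:
  assumes x: "x \<in> hyperbolic_space"
  shows "lorentz (tangent_proj x w) x = 0"
  using hyperbolic_spaceD(1)[OF x] by (simp add: tangent_proj_def lorentz_simps)

lemma lorentz_tangent_proj: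
  assumes x: "x \<in> hyperbolic_space"
  shows "lorentz (tangent_proj x v) (tangent_proj x w) = lorentz v w + lorentz v x * lorentz w x"
  using hyperbolic_spaceD(1)[OF x]
  by (simp add: tangent_proj_def lorentz_simps lorentz_commute[of x w] lorentz_commute[of x v]
      algebra_simps)

section \<open>Distances, the triangle inequality and causal vectors\<close>

lemma hyperbolic_lorentz_neg:
  assumes "x \<in> hyperbolic_space" "y \<in> hyperbolic_space"
  shows "lorentz x y < 0"
proof -
  have "fst x \<bullet> fst y \<le> norm (fst x) * norm (fst y)" by (rule norm_cauchy_schwarz)
  also have "\<dots> < snd x * snd y"
    using hyperbolic_spaceD[OF assms(1)] hyperbolic_spaceD[OF assms(2)]
    by (intro mult_strict_mono) auto
  finally show ?thesis by (simp add: lorentz_def)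
qed

text \<open>The tangential part of \<open>y\<close> at \<open>x\<close> has square
  \<open>(lorentz y x)\<^sup>2 - 1\<close>, the squared hyperbolic sine of the distance, and the
  form is positive definite on the tangent space.\<close>

lemma hyperbolic_lorentz_le:
  assumes x: "x \<in> hyperbolic_space" and y: "y \<in> hyperbolic_space"
  shows "lorentz x y \<le> -1" "lorentz x y = -1 \<Longrightarrow> x = y"
proof -
  have *: "lorentz (tangent_proj x y) (tangent_proj x y) = (lorentz y x)\<^sup>2 - 1"
    using lorentz_tangent_proj[OF x, of y y] hyperbolic_spaceD(1)[OF y] by (simp add: power2_eq_square)
  then have "1\<^sup>2 \<le> (- lorentz y x)\<^sup>2" using tangent_nonneg(1)[OF x tangent_proj_orth[OF x], of y] by simp
  then have "1 \<le> - lorentz y x"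
    by (rule power2_le_imp_le) (use hyperbolic_lorentz_neg[OF y x] in simp)
  then show "lorentz x y \<le> -1" by (simp add: lorentz_commute[of x y])
  assume "lorentz x y = -1"
  then have yx: "lorentz y x = -1" by (simp add: lorentz_commute[of y x])
  then have "tangent_proj x y = 0"
    using * tangent_nonneg(2)[OF x tangent_proj_orth[OF x], of y] by simp
  then have "y - x = 0" by (simp add: tangent_proj_def yx)
  then show "x = y" by simp
qed

text \<open>Splitting \<open>x\<close> and \<open>z\<close> at \<open>y\<close> gives the hyperbolic
  law of cosines; Cauchy-Schwarz bounds its angle term, and the addition formula for
  \<open>cosh\<close> appears. Upper bounds \<open>a\<close> and \<open>b\<close> instead of
  distances keep \<open>arcosh\<close> out of the applications.\<close>

lemma hyperbolic_cosh_triangle: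
  assumes x: "x \<in> hyperbolic_space" and y: "y \<in> hyperbolic_space" and z: "z \<in> hyperbolic_space"
    and xy: "- lorentz x y \<le> cosh a" and yz: "- lorentz y z \<le> cosh b" and "a \<ge> 0" "b \<ge> 0"
  shows "- lorentz x z \<le> cosh (a + b)"
proof -
  define A B where "A = - lorentz x y" and "B = - lorentz y z"
  have AB: "A \<ge> 1" "B \<ge> 1"
    using hyperbolic_lorentz_le(1)[OF x y] hyperbolic_lorentz_le(1)[OF y z] by (auto simp: A_def B_def)
  have sinh: "sqrt (C\<^sup>2 - 1) \<le> sinh c" if "1 \<le> C" "C \<le> cosh c" "c \<ge> 0" for C c :: real
  proof (rule real_le_lsqrt)
    show "C\<^sup>2 - 1 \<le> (sinh c)\<^sup>2"
      using that by (simp add: sinh_square_eq power_mono)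
  qed (use that in auto)
  have xx: "lorentz (tangent_proj y x) (tangent_proj y x) = A\<^sup>2 - 1"
    using lorentz_tangent_proj[OF y, of x x] hyperbolic_spaceD(1)[OF x] by (simp add: A_def power2_eq_square)
  have zz: "lorentz (tangent_proj y z) (tangent_proj y z) = B\<^sup>2 - 1"
    using lorentz_tangent_proj[OF y, of z z] hyperbolic_spaceD(1)[OF z]
    by (simp add: B_def power2_eq_square lorentz_commute[of z y])
  have "- lorentz x z = A * B - lorentz (tangent_proj y x) (tangent_proj y z)"
    using lorentz_tangent_proj[OF y, of x z] by (simp add: A_def B_def lorentz_commute[of z y])
  also have "\<dots> \<le> A * B + sqrt (A\<^sup>2 - 1) * sqrt (B\<^sup>2 - 1)"
    using tangent_Cauchy_Schwarz[OF y tangent_proj_orth[OF y] tangent_proj_orth[OF y], of x z]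
    unfolding xx zz by linarith
  also have "\<dots> \<le> cosh a * cosh b + sinh a * sinh b"
  proof (intro add_mono mult_mono)
    show "sqrt (A\<^sup>2 - 1) \<le> sinh a" "sqrt (B\<^sup>2 - 1) \<le> sinh b"
      using AB xy yz assms(6,7) by (intro sinh; simp add: A_def B_def)+
    show "A \<le> cosh a" "B \<le> cosh b" using xy yz by (simp_all add: A_def B_def)
  qed (use AB assms(6,7) in auto)
  also have "\<dots> = cosh (a + b)" by (simp add: cosh_add)
  finally show ?thesis .
qed

lemma timelike_future:
  assumes o: "o' \<in> hyperbolic_space" and z: "lorentz z z < 0" "lorentz z o' < 0"
  shows "snd z > 0"
proof (rule ccontr)
  assume "\<not> snd z > 0"
  then have sz: "snd z \<le> 0" by simp
  have "(norm (fst z))\<^sup>2 < (- snd z)\<^sup>2"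
    using z(1) by (simp add: lorentz_def power2_norm_eq_inner) (simp add: power2_eq_square)
  then have "norm (fst z) < - snd z" by (rule power2_less_imp_less) (use sz in simp)
  have "- (fst z \<bullet> fst o') \<le> norm (fst z) * norm (fst o')"
    using norm_cauchy_schwarz[of "- fst z" "fst o'"] by simp
  also have "\<dots> \<le> (- snd z) * snd o'"
    using \<open>norm (fst z) < - snd z\<close> hyperbolic_spaceD[OF o] sz by (intro mult_mono) auto
  finally show False using z(2) by (simp add: lorentz_def)
qed

lemma normalize_hyperbolic:
  assumes o: "o' \<in> hyperbolic_space" and z: "lorentz z z < 0" "lorentz z o' < 0"
  obtains c where "c > 0" "c *\<^sub>R z \<in> hyperbolic_space"
proof
  let ?c = "1 / sqrt (- lorentz z z)"
  show c: "?c > 0" using z by simp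
  have "lorentz (?c *\<^sub>R z) (?c *\<^sub>R z) = - ((?c * ?c) * (- lorentz z z))"
    by (simp only: lorentz_simps) simp
  also have "?c * ?c = 1 / (- lorentz z z)" using z(1) by (simp add: real_sqrt_mult_self)
  finally have "lorentz (?c *\<^sub>R z) (?c *\<^sub>R z) = -1" using z(1) by simp
  then show "?c *\<^sub>R z \<in> hyperbolic_space"
    using timelike_future[OF o z] c by (simp add: hyperbolic_space_def)
qed

text \<open>The time component of a nonzero causal vector dominates its spatial part, strictly so
  against a point of hyperbolic space, so the sign of that component decides.\<close>

lemma causal_sign:
  fixes n :: "(real^'m::finite) \<times> real"
  assumes n: "lorentz n n \<le> 0" "n \<noteq> 0"
  shows "(\<forall>z\<in>hyperbolic_space. lorentz z n < 0) \<or> (\<forall>z\<in>hyperbolic_space. lorentz z n > 0)"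
proof -
  have "(norm (fst n))\<^sup>2 \<le> \<bar>snd n\<bar>\<^sup>2"
    using n(1) by (simp add: lorentz_def power2_norm_eq_inner) (simp add: power2_eq_square)
  then have le: "norm (fst n) \<le> \<bar>snd n\<bar>" by (rule power2_le_imp_le) simp
  then have c: "snd n \<noteq> 0" using n(2) by (auto simp: prod_eq_iff)
  have *: "\<bar>fst z \<bullet> fst n\<bar> < snd z * \<bar>snd n\<bar>" if z: "z \<in> hyperbolic_space" for z :: "(real^'m) \<times> real"
  proof -
    have "\<bar>fst z \<bullet> fst n\<bar> \<le> norm (fst z) * norm (fst n)" by (rule Cauchy_Schwarz_ineq2)
    also have "\<dots> \<le> norm (fst z) * \<bar>snd n\<bar>" using le by (intro mult_left_mono) auto
    also have "\<dots> < snd z * \<bar>snd n\<bar>"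
      using hyperbolic_spaceD[OF z] c by (intro mult_strict_right_mono) auto
    finally show ?thesis .
  qed
  show ?thesis
  proof (cases "snd n > 0")
    case True
    then have "lorentz z n < 0" if "z \<in> hyperbolic_space" for z
      using *[OF that] by (simp add: lorentz_def)
    then show ?thesis by blast
  next
    case False
    then have "lorentz z n > 0" if "z \<in> hyperbolic_space" for z
      using *[OF that] c by (simp add: lorentz_def)
    then show ?thesis by blast
  qed
qed

lemma lorentz_nondegenerate:
  fixes v :: "(real^'m::finite) \<times> real"
  assumes "\<And>z. lorentz z v = 0" shows "v = 0"
proof -
  have "lorentz (fst v, - snd v) v = 0" using assms .
  then have "v \<bullet> v = 0" by (simp add: lorentz_def inner_prod_def)
  then show ?thesis by simp
qed

section \<open>Reflections\<close>

text \<open>The linear extension of \<open>reflection\<close> to Minkowski space; it applies to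
  normals, which are spacelike, as well as to points.\<close>

definition mrefl :: "(real^'m::finite) \<times> real \<Rightarrow> (real^'m) \<times> real \<Rightarrow> (real^'m) \<times> real" where
  "mrefl v x = x - (2 * lorentz x v) *\<^sub>R v"

lemma mrefl_simps:
  "mrefl v (x + y) = mrefl v x + mrefl v y" "mrefl v (x - y) = mrefl v x - mrefl v y"
  "mrefl v (r *\<^sub>R x) = r *\<^sub>R mrefl v x" "mrefl v (- x) = - mrefl v x" "mrefl v 0 = 0"
  by (simp_all add: mrefl_def lorentz_simps algebra_simps)

lemma linear_mrefl: "linear (mrefl v)"
  by (rule linearI) (simp_all add: mrefl_simps)

lemma lorentz_mrefl:
  assumes "lorentz v v = 1"
  shows "lorentz (mrefl v x) (mrefl v y) = lorentz x y"
  using assms by (simp add: mrefl_def lorentz_simps lorentz_commute[of v y] algebra_simps)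

lemma mrefl_mrefl:
  assumes "lorentz v v = 1"
  shows "mrefl v (mrefl v x) = x"
  using assms by (simp add: mrefl_def lorentz_simps algebra_simps)

lemma mrefl_hyperbolic:
  assumes v: "lorentz v v = 1" and x: "x \<in> hyperbolic_space"
  shows "mrefl v x \<in> hyperbolic_space"
proof -
  have *: "lorentz (mrefl v x) (mrefl v x) = -1"
    using v hyperbolic_spaceD[OF x] by (simp add: lorentz_mrefl)
  have "lorentz (mrefl v x) x = -1 - 2 * (lorentz x v)\<^sup>2"
    using hyperbolic_spaceD[OF x] by (simp add: mrefl_def lorentz_simps lorentz_commute[of v x] power2_eq_square)
  then have "lorentz (mrefl v x) x < 0"
    using zero_le_power2[of "lorentz x v"] by linarith
  then show ?thesis using * timelike_future[OF x, of "mrefl v x"] by (simp add: hyperbolic_space_def)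
qed

text \<open>A list is read as a product of reflections, so its last letter acts first. Words rather
  than group elements are used because the arguments go by word length.\<close>

definition act :: "((real^'m::finite) \<times> real) list \<Rightarrow> (real^'m) \<times> real \<Rightarrow> (real^'m) \<times> real" where
  "act ws = foldr (\<lambda>v f. mrefl v \<circ> f) ws id"

lemma act_simps [simp]:
  "act [] x = x" "act (v # ws) x = mrefl v (act ws x)" "act (us @ ws) x = act us (act ws x)"
proof -
  show "act [] x = x" "act (v # ws) x = mrefl v (act ws x)" by (simp_all add: act_def)
  show "act (us @ ws) x = act us (act ws x)" by (induction us) (simp_all add: act_def)
qed

lemma linear_act: "linear (act ws)"
proof (induction ws)
  case Nil
  then show ?case using linear_id by (simp add: act_def id_def)
next
  case (Cons v ws)
  have "act (v # ws) = mrefl v \<circ> act ws" by (simp add: act_def)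
  then show ?case using Cons linear_mrefl linear_compose by metis
qed

lemmas act_linear_simps = linear_add[OF linear_act] linear_diff[OF linear_act]
  linear_scale[OF linear_act] linear_neg[OF linear_act] linear_0[OF linear_act]

lemma lorentz_act:
  assumes "\<forall>v\<in>set ws. lorentz v v = 1"
  shows "lorentz (act ws x) (act ws y) = lorentz x y"
  using assms by (induction ws) (simp_all add: lorentz_mrefl)

lemma act_hyperbolic:
  assumes "\<forall>v\<in>set ws. lorentz v v = 1" "x \<in> hyperbolic_space"
  shows "act ws x \<in> hyperbolic_space"
  using assms by (induction ws) (simp_all add: mrefl_hyperbolic)

lemma act_rev:
  fixes ws :: "((real^'m::finite) \<times> real) list"
  assumes "\<forall>v\<in>set ws. lorentz v v = 1"
  shows "act (rev ws) (act ws x) = x" "act ws (act (rev ws) x) = x"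
proof -
  have *: "act (rev ws) (act ws x) = x" if "\<forall>v\<in>set ws. lorentz v v = 1"
    for ws :: "((real^'m) \<times> real) list" and x
    using that by (induction ws arbitrary: x) (simp_all add: mrefl_mrefl)
  show "act (rev ws) (act ws x) = x" using *[OF assms] .
  show "act ws (act (rev ws) x) = x" using *[of "rev ws"] assms by simp
qed

lemma lorentz_act_rev:
  assumes "\<forall>v\<in>set ws. lorentz v v = 1"
  shows "lorentz (act ws x) y = lorentz x (act (rev ws) y)"
  using lorentz_act[OF assms, of x "act (rev ws) y"] act_rev(2)[OF assms] by simp

lemma mrefl_conj:
  assumes "\<forall>v\<in>set ws. lorentz v v = 1"
  shows "mrefl (act ws v) x = act ws (mrefl v (act (rev ws) x))"
  using act_rev(2)[OF assms, of x] lorentz_act_rev[OF assms, of v x]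
  by (simp add: mrefl_def act_linear_simps lorentz_commute[of x] lorentz_commute[of v])

section \<open>Positive and negative roots\<close>

text \<open>The convex cone generated by \<open>N\<close>, which contains the positive roots. The
  inductive form serves infinite \<open>N\<close> without finite linear combinations.\<close>

inductive_set pos :: "((real^'m::finite) \<times> real) set \<Rightarrow> ((real^'m) \<times> real) set" for N where
  zero: "0 \<in> pos N"
| add: "r \<in> pos N \<Longrightarrow> v \<in> N \<Longrightarrow> a \<ge> 0 \<Longrightarrow> r + a *\<^sub>R v \<in> pos N"

lemma pos_scale: "r \<in> pos N \<Longrightarrow> c \<ge> 0 \<Longrightarrow> c *\<^sub>R r \<in> pos N"
  by (induction rule: pos.induct) (auto intro: pos.intros simp: scaleR_add_right)

lemma pos_add: "s \<in> pos N \<Longrightarrow> r \<in> pos N \<Longrightarrow> r + s \<in> pos N"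
  by (induction rule: pos.induct) (auto intro: pos.intros simp: add.assoc[symmetric])

lemma pos_base: "v \<in> N \<Longrightarrow> v \<in> pos N"
  using pos.add[OF pos.zero, of v N 1] by simp

lemma lorentz_pos_le:
  assumes "r \<in> pos N" "\<And>v. v \<in> N \<Longrightarrow> lorentz y v \<le> 0"
  shows "lorentz y r \<le> 0"
  using assms by (induction rule: pos.induct)
    (simp_all add: lorentz_simps add_nonpos_nonpos mult_nonneg_nonpos)

lemma lorentz_pos_ge:
  assumes "r \<in> pos N" "\<And>v. v \<in> N \<Longrightarrow> lorentz y v \<ge> 0"
  shows "lorentz y r \<ge> 0"
  using assms by (induction rule: pos.induct) (simp_all add: lorentz_simps)

lemma lorentz_pos_eq:
  assumes "r \<in> pos N" "\<And>v. v \<in> N \<Longrightarrow> lorentz y v = 0"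
  shows "lorentz y r = 0"
  using assms by (induction rule: pos.induct) (simp_all add: lorentz_simps)

text \<open>All summands of \<open>lorentz y r\<close> have the same sign, so each of them vanishes,
  and a generator with positive coefficient is orthogonal to \<open>y\<close>.\<close>

lemma pos_face:
  assumes "r \<in> pos N" "\<And>v. v \<in> N \<Longrightarrow> lorentz y v \<le> 0" "lorentz y r = 0"
  shows "r \<in> pos {v \<in> N. lorentz y v = 0}"
  using assms
proof (induction rule: pos.induct)
  case (add r v a)
  have "lorentz y r \<le> 0" "a * lorentz y v \<le> 0"
    using lorentz_pos_le[OF add.hyps(1)] add by (auto simp: mult_nonneg_nonpos)
  moreover have "lorentz y r + a * lorentz y v = 0" using add.prems by (simp add: lorentz_simps)
  ultimately have *: "lorentz y r = 0" "a * lorentz y v = 0" by linarith+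
  then have r: "r \<in> pos {v \<in> N. lorentz y v = 0}" using add by blast
  show ?case
  proof (cases "a = 0")
    case False
    then show ?thesis using * add.hyps by (intro pos.add r) auto
  qed (use r in simp)
qed (rule pos.zero)

lemma not_distinct_adj_split:
  "\<not> distinct_adj d \<Longrightarrow> \<exists>xs y zs. d = xs @ y # y # zs"
proof (induction d)
  case (Cons x d)
  show ?case
  proof (cases "distinct_adj d")
    case True
    with Cons.prems obtain d' where "d = x # d'" by (cases d) (auto simp: distinct_adj_Cons)
    then show ?thesis by (intro exI[of _ "[]"]) simp
  next
    case False
    then obtain xs y zs where "d = xs @ y # y # zs" using Cons.IH by blast
    then show ?thesis by (intro exI[of _ "x # xs"]) simp
  qed
qed simp

text \<open>The invariant is that the coefficient of the vector reflected in most recently is the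
  larger one; since \<open>lorentz u v\<close> is at most -1, the next reflection makes the other
  coefficient overtake it. Ending in \<open>u\<close> ensures that \<open>v\<close> is not first
  sent to \<open>- v\<close>.\<close>

lemma act_dihedral:
  assumes "lorentz u u = 1" "lorentz v v = 1" "lorentz u v \<le> -1"
    and "set d \<subseteq> {u, v}" "distinct_adj d" "d \<noteq> [] \<Longrightarrow> last d = u"
  shows "\<exists>a b. act d v = a *\<^sub>R u + b *\<^sub>R v \<and> a \<ge> 0 \<and> b \<ge> 0 \<and>
    (d \<noteq> [] \<longrightarrow> hd d = u \<longrightarrow> a \<ge> b) \<and> (d \<noteq> [] \<longrightarrow> hd d = v \<longrightarrow> b \<ge> a)"
  using assms(4-6)
proof (induction d)
  case Nil
  then show ?case by (intro exI[of _ 0] exI[of _ 1]) simp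
next
  case (Cons x d)
  define c where "c = - lorentz u v"
  have c: "c \<ge> 1" using assms by (simp add: c_def)
  have uv: "u \<noteq> v" using assms by auto
  have refl_u: "mrefl u (a *\<^sub>R u + b *\<^sub>R v) = (2 * c * b - a) *\<^sub>R u + b *\<^sub>R v" for a b
  proof -
    have "mrefl u (a *\<^sub>R u + b *\<^sub>R v) = (a *\<^sub>R u - (2 * (a - c * b)) *\<^sub>R u) + b *\<^sub>R v"
      using assms(1) by (simp add: mrefl_def lorentz_simps c_def lorentz_commute[of v u] mult.commute)
    also have "a *\<^sub>R u - (2 * (a - c * b)) *\<^sub>R u = (2 * c * b - a) *\<^sub>R u"
      unfolding scaleR_left_diff_distrib[symmetric] by (rule arg_cong[where f = "\<lambda>r. r *\<^sub>R u"]) simp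
    finally show ?thesis .
  qed
  have refl_v: "mrefl v (a *\<^sub>R u + b *\<^sub>R v) = a *\<^sub>R u + (2 * c * a - b) *\<^sub>R v" for a b
  proof -
    have "mrefl v (a *\<^sub>R u + b *\<^sub>R v) = a *\<^sub>R u + (b *\<^sub>R v - (2 * (b - c * a)) *\<^sub>R v)"
      using assms(2) by (simp add: mrefl_def lorentz_simps c_def mult.commute)
    also have "b *\<^sub>R v - (2 * (b - c * a)) *\<^sub>R v = (2 * c * a - b) *\<^sub>R v"
      unfolding scaleR_left_diff_distrib[symmetric] by (rule arg_cong[where f = "\<lambda>r. r *\<^sub>R v"]) simp
    finally show ?thesis .
  qed
  have grow: "2 * c * b - a \<ge> b" if "b \<ge> a" "a \<ge> 0" for a b
    using mult_right_mono[OF c, of b] that by simp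
  show ?case
  proof (cases "d = []")
    case True
    then have "x = u" using Cons.prems by simp
    then show ?thesis using True refl_u[of 0 1] c uv
      by (intro exI[of _ "2 * c"] exI[of _ 1]) simp
  next
    case False
    then obtain a b where ab: "act d v = a *\<^sub>R u + b *\<^sub>R v" "a \<ge> 0" "b \<ge> 0"
      "hd d = u \<longrightarrow> a \<ge> b" "hd d = v \<longrightarrow> b \<ge> a"
      using Cons by (auto simp: distinct_adj_Cons)
    have x: "x \<noteq> hd d" using Cons.prems(2) False by (simp add: distinct_adj_Cons)
    have "hd d \<in> set (x # d)" "x \<in> set (x # d)" using hd_in_set[OF False] by simp_all
    then have "x \<in> {u, v}" "hd d \<in> {u, v}" using Cons.prems(1) by (blast dest: subsetD)+
    then consider "x = u" "hd d = v" | "x = v" "hd d = u" using x by blast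
    then show ?thesis
    proof cases
      case 1
      then show ?thesis using ab refl_u[of a b] grow[of a b] uv
        by (intro exI[of _ "2 * c * b - a"] exI[of _ b]) auto
    next
      case 2
      then show ?thesis using ab refl_v[of a b] grow[of b a] uv
        by (intro exI[of _ a] exI[of _ "2 * c * a - b"]) auto
    qed
  qed
qed

lemma mrefl_self: "lorentz v v = 1 \<Longrightarrow> mrefl v v = - v"
  by (simp add: mrefl_def scaleR_2)

text \<open>Gram entry 0 means perpendicular walls, -1 walls that meet at infinity, and less than -1
  walls with a common perpendicular. Besides the facet normals of \<open>P\<close> the set
  \<open>N\<close> will also be \<open>hull_normals\<close>.\<close>

locale right_angled =
  fixes N :: "((real^'m::finite) \<times> real) set"
  assumes unit: "v \<in> N \<Longrightarrow> lorentz v v = 1"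
    and gram: "v \<in> N \<Longrightarrow> w \<in> N \<Longrightarrow> v \<noteq> w \<Longrightarrow> lorentz v w = 0 \<or> lorentz v w \<le> -1"
begin

text \<open>Following Tits, a minimal word \<open>ws\<close> is split as \<open>f\<close> followed by a word \<open>d\<close> in the last letter
  \<open>u\<close> of \<open>ws\<close> and in \<open>v\<close>, with \<open>f\<close> as short as possible: then \<open>f\<close> maps both \<open>u\<close> and \<open>v\<close> to positive
  roots, and \<open>d\<close> maps \<open>v\<close> into the cone spanned by \<open>u\<close> and \<open>v\<close>.\<close>

lemma minimal_word_pos:
  assumes "set ws \<subseteq> N" "v \<in> N"
    and "\<And>ws'. set ws' \<subseteq> N \<Longrightarrow> act ws' = act ws \<Longrightarrow> length ws \<le> length ws'"
    and "\<And>ws'. set ws' \<subseteq> N \<Longrightarrow> act ws' = act (ws @ [v]) \<Longrightarrow> length ws \<le> length ws'"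
  shows "act ws v \<in> pos N"
  using assms
proof (induction "length ws" arbitrary: ws v rule: less_induct)
  case less
  note ws = less.prems(1) and v = less.prems(2) and min1 = less.prems(3) and min2 = less.prems(4)
  show ?case
  proof (cases "ws = []")
    case True
    then show ?thesis using v by (simp add: pos_base)
  next
    case False
    define u where "u = last ws"
    have u: "u \<in> N" using False ws by (auto simp: u_def)
    have ws_eq: "ws = butlast ws @ [u]" using False by (simp add: u_def)
    have inv: "mrefl x (mrefl x y) = y" if "x \<in> N" for x y using unit[OF that] by (rule mrefl_mrefl)
    have bl: "set (butlast ws) \<subseteq> N" using ws in_set_butlastD by fastforce
    have lb: "length (butlast ws) < length ws" using False by simp
    have uv: "u \<noteq> v"
    proof
      assume "u = v"
      then have "act (butlast ws) = act (ws @ [v])"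
        using inv[OF v] by (subst ws_eq, intro ext) simp
      from min2[OF bl this] show False using lb by linarith
    qed
    define Q where "Q = (\<lambda>(f, d). set f \<subseteq> N \<and> set d \<subseteq> {u, v} \<and> act (f @ d) = act ws \<and>
        length f + length d \<le> length ws)"
    have Q0: "Q (butlast ws, [u])"
      using bl lb ws_eq[symmetric] by (simp add: Q_def Suc_le_eq)
    then obtain x where x: "Q x" "\<forall>y. Q y \<longrightarrow> length (fst x) \<le> length (fst y)"
      using ex_has_least_nat[of Q "(butlast ws, [u])" "length \<circ> fst"] by auto
    define f d where "f = fst x" and "d = snd x"
    have Q: "Q (f, d)" using x by (simp add: f_def d_def)
    have least: "length f \<le> length f'" if "Q (f', d')" for f' d'
      using x(2)[rule_format, OF that] by (simp add: f_def)
    have "length f \<le> length (butlast ws)" using least[OF Q0] .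
    then have shorter: "length f < length ws" using lb by simp
    from Q have f: "set f \<subseteq> N" and d: "set d \<subseteq> {u, v}" and fd: "act (f @ d) = act ws"
      and len: "length f + length d \<le> length ws" by (auto simp: Q_def)
    have dN: "set d \<subseteq> N" using d u v by auto
    have act_fd: "act ws y = act f (act d y)" for y unfolding fd[symmetric] by simp
    \<comment> \<open>A shorter word for \<open>f\<close>, continued by \<open>d\<close>, would be a
      word for \<open>ws\<close> shorter than the minimal one.\<close>
    have f_min: "length f \<le> length ws'" if "set ws' \<subseteq> N" "act ws' = act f" for ws'
    proof -
      have "act (ws' @ d) = act ws" using that act_fd by (intro ext) simp
      then show ?thesis using min1[of "ws' @ d"] that dN len by auto
    qed
    \<comment> \<open>A shorter word for \<open>f\<close> times \<open>x\<close> gives a competing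
      splitting: prefixing \<open>x\<close> to the dihedral part restores the product, keeps the
      total length within bounds and shortens the first part.\<close>
    have f_min': "length f \<le> length ws'"
      if "x \<in> {u, v}" "set ws' \<subseteq> N" "act ws' = act (f @ [x])" for ws' x
    proof (rule ccontr)
      assume less: "\<not> ?thesis"
      have "x \<in> N" using that u v by auto
      then have "act (ws' @ x # d) = act ws" using that inv act_fd by (intro ext) simp
      then have "Q (ws', x # d)" using that d len less by (auto simp: Q_def)
      then show False using least less by blast
    qed
    have f_pos: "act f x \<in> pos N" if x: "x \<in> {u, v}" for x
    proof (rule less.hyps[OF shorter f])
      show "x \<in> N" using x u v by blast
    qed (fact f_min, fact f_min'[OF x])
    then have fu: "act f u \<in> pos N" and fv: "act f v \<in> pos N" by blast+
    have adj: "distinct_adj d"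
    proof (rule ccontr)
      assume "\<not> ?thesis"
      then obtain xs y zs where d_eq: "d = xs @ y # y # zs" using not_distinct_adj_split by blast
      have y: "y \<in> N" "set (f @ xs @ zs) \<subseteq> N" using dN f unfolding d_eq by auto
      have "act (f @ xs @ zs) = act ws"
        unfolding fd[symmetric] d_eq by (intro ext) (simp add: inv[OF y(1)])
      from min1[OF y(2) this] show False using len unfolding d_eq by simp
    qed
    \<comment> \<open>If \<open>d\<close> ended in \<open>v\<close>, deleting that letter would give
      a word for \<open>ws @ [v]\<close> shorter than \<open>ws\<close>.\<close>
    have last: "last d = u" if "d \<noteq> []"
    proof (rule ccontr)
      assume "last d \<noteq> u"
      then have "last d = v" using d last_in_set[OF that] by blast
      then have d_eq: "butlast d @ [v] = d" using append_butlast_last_id[OF that] by simp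
      have "act d y = act (butlast d) (mrefl v y)" for y
        using arg_cong[OF d_eq, of "\<lambda>d. act d y"] by simp
      then have *: "act (f @ butlast d) = act (ws @ [v])"
        by (intro ext) (simp add: act_fd inv[OF v])
      have "set (f @ butlast d) \<subseteq> N" using f dN in_set_butlastD[of _ d] by auto
      from min2[OF this *] have "length ws \<le> length f + (length d - 1)" by simp
      moreover have "length d > 0" using that by simp
      ultimately show False using len by linarith
    qed
    consider "lorentz u v \<le> -1" | "lorentz u v = 0" using gram[OF u v uv] by blast
    then show ?thesis
    proof cases
      case 1
      obtain a b where "act d v = a *\<^sub>R u + b *\<^sub>R v" "a \<ge> 0" "b \<ge> 0"
        using act_dihedral[OF unit[OF u] unit[OF v] 1 d adj last] by blast
      then have "act ws v = a *\<^sub>R act f u + b *\<^sub>R act f v"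
        using act_fd by (simp add: act_linear_simps)
      then show ?thesis using fu fv \<open>a \<ge> 0\<close> \<open>b \<ge> 0\<close> by (simp add: pos_add pos_scale)
    next
      case 2
      have suv: "mrefl u v = v" using 2 by (simp add: mrefl_def lorentz_commute[of v u])
      have "d = [] \<or> d = [u] \<or> (\<exists>d' y. d = d' @ [y, u])"
      proof (cases d rule: rev_cases)
        case (snoc d1 x)
        then have "x = u" using last by simp
        then show ?thesis using snoc by (cases d1 rule: rev_cases) auto
      qed simp
      then consider "d = []" | "d = [u]" | d' y where "d = d' @ [y, u]" by blast
      then show ?thesis
      proof cases
        case 3
        then have "y = v" using adj d by (simp add: distinct_adj_append_iff)
        \<comment> \<open>Commuting reflections: multiplying a word that ends in \<open>v\<close>,
          \<open>u\<close> by \<open>v\<close> cancels the letter \<open>v\<close>, against the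
          minimality of \<open>ws\<close> among words for \<open>ws @ [v]\<close>.\<close>
        have "mrefl v (mrefl u (mrefl v x)) = mrefl u x" for x
          using 2 unit[OF v] by (simp add: mrefl_def lorentz_simps lorentz_commute[of v u] algebra_simps)
        then have *: "act (f @ d' @ [u]) = act (ws @ [v])"
          by (intro ext) (simp add: act_fd 3 \<open>y = v\<close>)
        have "set (f @ d' @ [u]) \<subseteq> N" using f dN unfolding 3 by auto
        from min2[OF this *] show ?thesis using len unfolding 3 by simp
      qed (use act_fd suv fv in simp_all)
    qed
  qed
qed

section \<open>The root dichotomy and its consequences for chambers\<close>

lemma minimal_word:
  assumes "set ws \<subseteq> N"
  obtains ws0 where "set ws0 \<subseteq> N" "act ws0 = act ws"
    "\<And>ws'. set ws' \<subseteq> N \<Longrightarrow> act ws' = act ws \<Longrightarrow> length ws0 \<le> length ws'"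
  using ex_has_least_nat[of "\<lambda>ws'. set ws' \<subseteq> N \<and> act ws' = act ws" ws length] assms by auto

text \<open>Of the elements \<open>ws\<close> and \<open>ws @ [v]\<close>, the one with the shorter
  minimal word maps \<open>v\<close> to a positive root, and the two images of \<open>v\<close> are
  opposite.\<close>

lemma root_pos_or_neg:
  assumes ws: "set ws \<subseteq> N" and v: "v \<in> N"
  shows "act ws v \<in> pos N \<or> - act ws v \<in> pos N"
proof -
  obtain ws0 where ws0: "set ws0 \<subseteq> N" "act ws0 = act ws"
    "\<And>ws'. set ws' \<subseteq> N \<Longrightarrow> act ws' = act ws \<Longrightarrow> length ws0 \<le> length ws'"
    using minimal_word[OF ws] by blast
  have "set (ws @ [v]) \<subseteq> N" using ws v by simp
  then obtain ws1 where ws1: "set ws1 \<subseteq> N" "act ws1 = act (ws @ [v])"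
    "\<And>ws'. set ws' \<subseteq> N \<Longrightarrow> act ws' = act (ws @ [v]) \<Longrightarrow> length ws1 \<le> length ws'"
    using minimal_word by blast
  have inv: "mrefl v (mrefl v y) = y" for y using unit[OF v] by (rule mrefl_mrefl)
  show ?thesis
  proof (cases "length ws0 \<le> length ws1")
    case True
    have "act (ws0 @ [v]) = act (ws @ [v])" using ws0(2) by (intro ext) simp
    then have "act ws0 v \<in> pos N"
      using ws0(2,3) ws1(3) True by (intro minimal_word_pos[OF ws0(1) v]) (simp, metis order_trans)
    then show ?thesis using ws0 by simp
  next
    case False
    have "act (ws1 @ [v]) = act ws" using ws1(2) inv by (intro ext) simp
    then have "act ws1 v \<in> pos N"
      using ws0(3) ws1(2,3) False by (intro minimal_word_pos[OF ws1(1) v]) (simp, fastforce)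
    moreover have "act ws1 v = - act ws v"
      using ws1(2) unit[OF v] by (simp add: mrefl_self act_linear_simps)
    ultimately show ?thesis by simp
  qed
qed

text \<open>If the last letter of a nonempty minimal word is \<open>v\<close>, then \<open>v\<close>
  is mapped to a negative root. The image of \<open>o'\<close> lies in the chamber and so has
  nonnegative product with that root, whereas the product is preserved and equals
  \<open>lorentz o' v < 0\<close>.\<close>

lemma act_strict_interior:
  assumes ws: "set ws \<subseteq> N" and o: "\<And>v. v \<in> N \<Longrightarrow> lorentz o' v < 0"
    and D: "\<And>v. v \<in> N \<Longrightarrow> lorentz (act ws o') v \<le> 0"
  shows "act ws = id"
proof -
  obtain ws0 where ws0: "set ws0 \<subseteq> N" "act ws0 = act ws"
    "\<And>ws'. set ws' \<subseteq> N \<Longrightarrow> act ws' = act ws \<Longrightarrow> length ws0 \<le> length ws'"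
    using minimal_word[OF ws] by blast
  show ?thesis
  proof (cases "ws0 = []")
    case True
    then show ?thesis unfolding ws0(2)[symmetric] by (intro ext) simp
  next
    case False
    define v ws1 where "v = last ws0" and "ws1 = butlast ws0"
    have eq: "ws0 = ws1 @ [v]" using False by (simp add: v_def ws1_def)
    have v: "v \<in> N" and ws1: "set ws1 \<subseteq> N" using ws0(1) unfolding eq by auto
    have *: "act ws1 v \<in> pos N"
    proof (rule minimal_word_pos[OF ws1 v])
      show "length ws1 \<le> length ws'" if "set ws' \<subseteq> N" "act ws' = act ws1" for ws'
      proof -
        have "act (ws' @ [v]) = act ws" using that(2) unfolding ws0(2)[symmetric] eq by (intro ext) simp
        then show ?thesis using ws0(3)[of "ws' @ [v]"] that v unfolding eq by auto
      qed
      show "length ws1 \<le> length ws'" if "set ws' \<subseteq> N" "act ws' = act (ws1 @ [v])" for ws'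
      proof -
        have "act ws' = act ws" using that(2) ws0(2) unfolding eq by simp
        then show ?thesis using ws0(3)[OF that(1)] unfolding eq by simp
      qed
    qed
    have "act ws1 v = - act ws v"
      unfolding ws0(2)[symmetric] eq using unit[OF v] by (simp add: mrefl_self act_linear_simps)
    then have "lorentz (act ws o') (act ws v) \<ge> 0"
      using lorentz_pos_le[OF * D] by (simp add: lorentz_simps)
    moreover have "\<forall>v\<in>set ws. lorentz v v = 1" using ws unit by auto
    ultimately show ?thesis using o[OF v] lorentz_act[of ws o' v] by simp
  qed
qed

text \<open>Otherwise \<open>v + w\<close> would be causal and orthogonal to \<open>z\<close>, hence
  zero, although both normals are negative at \<open>o'\<close>.\<close>

lemma orthogonal_at_point:
  assumes o: "\<And>v. v \<in> N \<Longrightarrow> lorentz o' v < 0" and z: "z \<in> hyperbolic_space"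
    and v: "v \<in> N" "lorentz z v = 0" and w: "w \<in> N" "lorentz z w = 0" and "v \<noteq> w"
  shows "lorentz v w = 0"
proof (rule ccontr)
  assume "\<not> ?thesis"
  then have "lorentz v w \<le> -1" using gram[OF v(1) w(1) \<open>v \<noteq> w\<close>] by blast
  then have "lorentz (v + w) (v + w) \<le> 0"
    using unit[OF v(1)] unit[OF w(1)] by (simp add: lorentz_simps lorentz_commute[of w v])
  moreover have "lorentz (v + w) z = 0"
    using v w by (simp add: lorentz_simps lorentz_commute[of _ z])
  ultimately have "v + w = 0" using tangent_nonneg[OF z, of "v + w"] by simp
  then have "lorentz o' (v + w) = 0" by (simp add: lorentz_simps)
  then show False using o[OF v(1)] o[OF w(1)] by (simp add: lorentz_simps)
qed

text \<open>No wall cuts through a closed chamber: a positive root vanishing at \<open>z\<close>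
  lies in the cone of the normals at \<open>z\<close>, which are pairwise orthogonal, and the
  dichotomy leaves it only one of them.\<close>

lemma root_through_chamber:
  assumes o: "\<And>v. v \<in> N \<Longrightarrow> lorentz o' v < 0"
    and z: "z \<in> hyperbolic_space" "\<And>v. v \<in> N \<Longrightarrow> lorentz z v \<le> 0"
    and ws: "set ws \<subseteq> N" and v0: "v0 \<in> N" and r: "r = act ws v0" "lorentz z r = 0"
  shows "r \<in> N \<or> - r \<in> N"
proof -
  let ?V = "{v \<in> N. lorentz z v = 0}"
  have facets: "r \<in> ?V" if r: "r \<in> pos N" "r = act ws v0" "lorentz z r = 0" and ws: "set ws \<subseteq> N"
    and v0: "v0 \<in> N" "\<bar>lorentz r r\<bar> = 1" for r ws v0
  proof -
    have rV: "r \<in> pos ?V" using pos_face r z by blast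
    have ge: "lorentz w s \<ge> 0" if "s \<in> pos ?V" "w \<in> ?V" for s w
    proof (rule lorentz_pos_ge[OF that(1)])
      show "0 \<le> lorentz w x" if "x \<in> ?V" for x
        using orthogonal_at_point[OF o z(1), of w x] unit[of w] \<open>w \<in> ?V\<close> that
        by (cases "w = x") auto
    qed
    have "\<exists>v\<in>?V. lorentz r v \<noteq> 0"
      using lorentz_pos_eq[OF rV, of r] v0 by force
    then obtain v where v: "v \<in> ?V" "lorentz r v \<noteq> 0" by blast
    then have rv: "lorentz r v > 0" using ge[OF rV v(1)] by (simp add: lorentz_commute[of v r])
    have vv: "lorentz v v = 1" using unit v by auto
    \<comment> \<open>Reflecting in \<open>v\<close> makes the \<open>v\<close>-component negative,
      so the reflected root is a negative one. This forces all other components of \<open>r\<close>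
      to be nonpositive, hence zero.\<close>
    define r' where "r' = mrefl v r"
    have zr': "lorentz z r' = 0" using r v by (simp add: r'_def mrefl_def lorentz_simps)
    have "r' = act (v # ws) v0" using r by (simp add: r'_def)
    moreover have "set (v # ws) \<subseteq> N" using v ws by simp
    ultimately have "r' \<in> pos N \<or> - r' \<in> pos N" using root_pos_or_neg v0 by metis
    moreover have "r' \<notin> pos N"
    proof
      assume "r' \<in> pos N"
      then have "r' \<in> pos ?V" using pos_face z zr' by blast
      from ge[OF this v(1)] show False
        using rv vv by (simp add: r'_def mrefl_def lorentz_simps lorentz_commute[of v r])
    qed
    ultimately have "- r' \<in> pos ?V" using pos_face[of "- r'"] z zr' by (simp add: lorentz_simps)
    then have *: "lorentz w r \<le> 0" if "w \<in> ?V" "w \<noteq> v" for w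
      using ge[of "- r'" w] that orthogonal_at_point[OF o z(1), of w v] v
      by (simp add: r'_def mrefl_def lorentz_simps)
    define s where "s = r - lorentz r v *\<^sub>R v"
    have "lorentz s w = 0" if "w \<in> ?V" for w
    proof (cases "w = v")
      case True
      then show ?thesis using vv by (simp add: s_def lorentz_simps)
    next
      case False
      then have "lorentz w r = 0" using *[OF that] ge[OF rV that] by simp
      then show ?thesis using False that v orthogonal_at_point[OF o z(1), of v w]
        by (simp add: s_def lorentz_simps lorentz_commute[of r w])
    qed
    then have "lorentz s r = 0" "lorentz s v = 0" using lorentz_pos_eq[OF rV] v by blast+
    then have "lorentz s s = 0" unfolding s_def by (simp add: lorentz_simps)
    moreover have "lorentz s z = 0"
      using r v by (simp add: s_def lorentz_simps lorentz_commute[of _ z])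
    ultimately have "s = 0" using tangent_nonneg(2)[OF z(1)] by blast
    then have r_eq: "r = lorentz r v *\<^sub>R v" by (simp add: s_def)
    then have "lorentz r r = (lorentz r v)\<^sup>2"
      using vv by (metis lorentz.scaleR_right mult.commute power2_eq_square real_scaleR_def)
    then have "lorentz r v = 1" using v0(2) rv by (simp add: power2_eq_1_iff)
    then show ?thesis using r_eq v by simp
  qed
  have "\<forall>v\<in>set ws. lorentz v v = 1" using ws unit by auto
  then have norm: "lorentz r r = 1" using r unit[OF v0] by (simp add: lorentz_act)
  have neg: "act (ws @ [v0]) v0 = - r"
    using r unit[OF v0] by (simp add: mrefl_self act_linear_simps)
  consider "r \<in> pos N" | "- r \<in> pos N" using root_pos_or_neg[OF ws v0] r by blast
  then show ?thesis
  proof cases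
    case 1
    then show ?thesis using facets[of r ws v0] r ws v0 norm by auto
  next
    case 2
    then show ?thesis using facets[of "- r" "ws @ [v0]" v0] neg r ws v0 norm
      by (auto simp: lorentz_simps)
  qed
qed

end

section \<open>Right-angled cones\<close>

lemma small_perturbation:
  fixes f g :: "'b \<Rightarrow> real"
  assumes "finite V" "\<And>u. u \<in> V \<Longrightarrow> f u < 0"
  shows "\<exists>e>0. \<forall>d. 0 < d \<and> d \<le> e \<longrightarrow> (\<forall>u\<in>V. f u + d * g u < 0)"
  using assms
proof (induction V rule: finite_induct)
  case empty
  then show ?case by (intro exI[of _ 1]) simp
next
  case (insert x V)
  then obtain e where e: "e > 0" "\<forall>d. 0 < d \<and> d \<le> e \<longrightarrow> (\<forall>u\<in>V. f u + d * g u < 0)" by auto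
  define e' where "e' = (- f x / 2) / (\<bar>g x\<bar> + 1)"
  have fx: "f x < 0" using insert by simp
  then have e': "e' > 0" unfolding e'_def by (intro divide_pos_pos) auto
  have "f x + d * g x < 0" if "0 < d" "d \<le> e'" for d
  proof -
    have "d * g x \<le> d * (\<bar>g x\<bar> + 1)" using that by (intro mult_left_mono) auto
    also have "\<dots> \<le> e' * (\<bar>g x\<bar> + 1)" using that by (intro mult_right_mono) auto
    also have "\<dots> = - f x / 2"
      using e'_def nonzero_eq_divide_eq[of "\<bar>g x\<bar> + 1" e' "- f x / 2"] by linarith
    finally show ?thesis using fx by linarith
  qed
  then show ?case using e e' by (intro exI[of _ "min e e'"]) auto
qed

text \<open>Induction on the number of facets. If two facets have no common point outside the lineality
  space of the cone, the point of one of them closest to the other one spans an extreme ray; the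
  edges emanating from it are perpendicular to all but one of the facets at that ray, by the
  induction hypothesis.\<close>

lemma right_angled_cone_orthogonal:
  fixes V :: "'e::euclidean_space set"
  assumes "finite V" and "\<And>v. v \<in> V \<Longrightarrow> v \<bullet> v = 1" and "\<And>v. v \<in> V \<Longrightarrow> o' \<bullet> v < 0"
    and "\<And>v. v \<in> V \<Longrightarrow> \<exists>y. y \<bullet> v = 0 \<and> (\<forall>w\<in>V - {v}. y \<bullet> w < 0)"
    and "\<And>v w. v \<in> V \<Longrightarrow> w \<in> V \<Longrightarrow> v \<noteq> w \<Longrightarrow>
      (\<exists>y. y \<bullet> v = 0 \<and> y \<bullet> w = 0 \<and> (\<forall>u\<in>V - {v, w}. y \<bullet> u < 0)) \<Longrightarrow> v \<bullet> w = 0"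
    and "v \<in> V" "w \<in> V" "v \<noteq> w"
  shows "v \<bullet> w = 0"
  using assms
proof (induction V arbitrary: v w rule: finite_psubset_induct)
  case (psubset V)
  note fin = psubset.hyps and unit = psubset.prems(1) and o = psubset.prems(2)
    and facet = psubset.prems(3) and adjacent = psubset.prems(4)
  define T where "T = {t. \<forall>v\<in>V. t \<bullet> v \<le> 0}"
  define Z where "Z = (\<lambda>t. {v \<in> V. t \<bullet> v = 0})"
  have Tle: "t \<bullet> u \<le> 0" if "t \<in> T" "u \<in> V" for t u using that by (auto simp: T_def)
  have Tless: "t \<bullet> u < 0" if "t \<in> T" "u \<in> V" "u \<notin> Z t" for t u
    using that by (force simp: T_def Z_def)
  have perturb: "\<exists>e>0. \<forall>d. 0 < d \<and> d \<le> e \<longrightarrow> (\<forall>u\<in>V - Z t. (t + d *\<^sub>R s) \<bullet> u < 0)"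
    if "t \<in> T" for t s
    using small_perturbation[of "V - Z t" "\<lambda>u. t \<bullet> u" "\<lambda>u. s \<bullet> u"] fin Tless[OF that]
    by (simp add: inner_add_left)
  \<comment> \<open>The facets through \<open>t\<close> bound the tangent cone at \<open>t\<close>,
    which has fewer facets than the given cone. Moving from \<open>t\<close> a little towards a
    point of that cone yields a point of the original cone with the same vanishing pattern, so the
    hypotheses descend.\<close>
  have orth: "v \<bullet> w = 0" if t: "t \<in> T" "Z t \<noteq> V" and vw: "v \<in> Z t" "w \<in> Z t" "v \<noteq> w" for t v w
  proof (rule psubset.IH[of "Z t"])
    have "Z t \<subseteq> V" by (auto simp: Z_def)
    then show "Z t \<subset> V" using t by blast
    show "v \<bullet> v = 1" "o' \<bullet> v < 0" if "v \<in> Z t" for v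
      using that unit o by (auto simp: Z_def)
    show "\<exists>y. y \<bullet> v = 0 \<and> (\<forall>w\<in>Z t - {v}. y \<bullet> w < 0)" if "v \<in> Z t" for v
      using that facet[of v] by (auto simp: Z_def)
    show "v \<bullet> w = 0" if vw: "v \<in> Z t" "w \<in> Z t" "v \<noteq> w"
      and ex: "\<exists>y. y \<bullet> v = 0 \<and> y \<bullet> w = 0 \<and> (\<forall>u\<in>Z t - {v, w}. y \<bullet> u < 0)" for v w
    proof -
      obtain y where y: "y \<bullet> v = 0" "y \<bullet> w = 0" "\<forall>u\<in>Z t - {v, w}. y \<bullet> u < 0" using ex by blast
      obtain e where e: "e > 0" "\<forall>u\<in>V - Z t. (t + e *\<^sub>R y) \<bullet> u < 0"
        using perturb[OF t(1), of y] by (meson order_refl)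
      have "(t + e *\<^sub>R y) \<bullet> u < 0" if "u \<in> V - {v, w}" for u
      proof (cases "u \<in> Z t")
        case True
        then have "t \<bullet> u = 0" "y \<bullet> u < 0" using y that by (auto simp: Z_def)
        then show ?thesis using e by (simp add: inner_add_left mult_pos_neg)
      qed (use e that in blast)
      moreover have "(t + e *\<^sub>R y) \<bullet> v = 0" "(t + e *\<^sub>R y) \<bullet> w = 0"
        using vw y by (auto simp: Z_def inner_add_left)
      ultimately show ?thesis using adjacent[of v w] vw by (auto simp: Z_def)
    qed
  qed (use vw in auto)
  \<comment> \<open>A unit vector on an extreme ray: staying in \<open>span V\<close> removes the
    lineality space, and within \<open>span V\<close> the facets at \<open>t\<close> determine
    \<open>t\<close> up to a factor.\<close>
  define ray where "ray = (\<lambda>t. t \<in> T \<and> Z t \<noteq> V \<and> t \<bullet> t = 1 \<and> t \<in> span V \<and>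
    (\<forall>r\<in>span V. (\<forall>u\<in>Z t. r \<bullet> u = 0) \<longrightarrow> r \<bullet> t = 0 \<longrightarrow> r = 0))"
  \<comment> \<open>Since the facets at \<open>t\<close> are pairwise orthogonal, the edge that
    leaves only the facet \<open>u\<close> has direction \<open>- u\<close>. The maximal quotient
    gives the least \<open>\<alpha>\<close> for which \<open>\<alpha> *\<^sub>R t - u\<close> is
    still in the cone, and \<open>v'\<close> is the facet met there.\<close>
  have edge: "\<exists>\<alpha> v'. v' \<in> V \<and> v' \<notin> Z t \<and> \<alpha> *\<^sub>R t - u \<in> T \<and> (\<alpha> *\<^sub>R t - u) \<bullet> v' = 0 \<and>
      v' = (v' \<bullet> u) *\<^sub>R u + (v' \<bullet> t) *\<^sub>R t \<and> (\<forall>u2\<in>Z t - {u}. v' \<bullet> u2 = 0)"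
    if t: "ray t" and u: "u \<in> Z t" for t u
  proof -
    have tT: "t \<in> T" "Z t \<noteq> V" "t \<bullet> t = 1" "t \<in> span V" using t by (auto simp: ray_def)
    have uu: "u \<bullet> u = 1" "u \<in> V" "t \<bullet> u = 0" using u unit by (auto simp: Z_def)
    have "Z t \<subseteq> V" by (auto simp: Z_def)
    then have "V - Z t \<noteq> {}" "finite (V - Z t)" using tT(2) fin by auto
    then have "Max ((\<lambda>x. (u \<bullet> x) / (t \<bullet> x)) ` (V - Z t)) \<in> (\<lambda>x. (u \<bullet> x) / (t \<bullet> x)) ` (V - Z t)"
      by (intro Max_in) auto
    then obtain v' where v': "v' \<in> V - Z t"
      and Max: "Max ((\<lambda>x. (u \<bullet> x) / (t \<bullet> x)) ` (V - Z t)) = (u \<bullet> v') / (t \<bullet> v')" by (elim imageE)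
    have max: "(u \<bullet> x) / (t \<bullet> x) \<le> (u \<bullet> v') / (t \<bullet> v')" if "x \<in> V - Z t" for x
      unfolding Max[symmetric] using \<open>finite (V - Z t)\<close> that by (intro Max_ge) auto
    define \<alpha> where "\<alpha> = (u \<bullet> v') / (t \<bullet> v')"
    have tv': "t \<bullet> v' < 0" using Tless[OF tT(1)] v' by blast
    have Z_in: "(\<alpha> *\<^sub>R t - u) \<bullet> u2 = 0" if "u2 \<in> Z t - {u}" for u2
    proof -
      have "u2 \<bullet> u = 0" "t \<bullet> u2 = 0" using orth[OF tT(1,2) _ u, of u2] that by (auto simp: Z_def)
      then show ?thesis by (simp add: inner_diff_left inner_commute[of u u2])
    qed
    have in_u: "(\<alpha> *\<^sub>R t - u) \<bullet> u = -1" using uu by (simp add: inner_diff_left)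
    have in_v': "(\<alpha> *\<^sub>R t - u) \<bullet> v' = 0" using tv' by (simp add: inner_diff_left \<alpha>_def)
    have "(\<alpha> *\<^sub>R t - u) \<bullet> x \<le> 0" if x: "x \<in> V" for x
    proof (cases "x \<in> Z t")
      case True
      then show ?thesis using Z_in in_u by (cases "x = u") (auto intro: eq_refl)
    next
      case False
      then have "(u \<bullet> x) / (t \<bullet> x) \<le> \<alpha>" "t \<bullet> x < 0" using max Tless[OF tT(1)] x by (auto simp: \<alpha>_def)
      then show ?thesis by (simp add: inner_diff_left neg_divide_le_eq)
    qed
    then have t': "\<alpha> *\<^sub>R t - u \<in> T" by (simp add: T_def)
    have "u \<notin> Z (\<alpha> *\<^sub>R t - u)" using in_u by (simp add: Z_def)
    then have ne: "Z (\<alpha> *\<^sub>R t - u) \<noteq> V" using uu by blast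
    have perp: "v' \<bullet> u2 = 0" if "u2 \<in> Z t - {u}" for u2
    proof (rule orth[OF t' ne])
      show "v' \<in> Z (\<alpha> *\<^sub>R t - u)" using v' in_v' by (simp add: Z_def)
      show "u2 \<in> Z (\<alpha> *\<^sub>R t - u)" using that Z_in[OF that] by (simp add: Z_def)
      show "v' \<noteq> u2" using v' that by blast
    qed
    define r where "r = v' - (v' \<bullet> u) *\<^sub>R u - (v' \<bullet> t) *\<^sub>R t"
    have "r \<bullet> u2 = 0" if "u2 \<in> Z t" for u2
      using perp[of u2] orth[OF tT(1,2) that u] that uu
      by (cases "u2 = u") (auto simp: r_def inner_diff_left Z_def inner_commute[of u u2])
    moreover have "r \<bullet> t = 0"
      using uu tT by (simp add: r_def inner_diff_left inner_commute[of u t])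
    moreover have "r \<in> span V"
      using v' uu tT unfolding r_def by (intro span_diff span_scale) (auto intro: span_base)
    ultimately have "r = 0" using t by (auto simp: ray_def)
    then have "v' = (v' \<bullet> u) *\<^sub>R u + (v' \<bullet> t) *\<^sub>R t" by (simp add: r_def algebra_simps)
    then show ?thesis using v' t' in_v' perp by blast
  qed
  \<comment> \<open>With a second facet at \<open>t\<close>, the edge parameters
    \<open>\<alpha>\<close> cannot be negative: the facet met by the edge leaving \<open>u\<close>
    is orthogonal to \<open>u2\<close>. Evaluating \<open>v'\<close> at \<open>y\<close> then bounds
    \<open>y \<bullet> t\<close> below by \<open>- \<alpha> * (y \<bullet> u)\<close>.\<close>
  have ray_nonneg: "y \<bullet> t \<ge> 0"
    if t: "ray t" and u: "u \<in> Z t" "u2 \<in> Z t" "u \<noteq> u2" and y: "y \<in> T" for t u u2 y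
  proof -
    have tT: "t \<in> T" using t by (simp add: ray_def)
    have main: "\<alpha>2 \<ge> 0" if "u \<in> Z t" "u2 \<in> Z t" "u \<noteq> u2" "\<alpha>2 *\<^sub>R t - u2 \<in> T" for u u2 \<alpha>2
    proof -
      obtain \<alpha> v' where v': "v' \<in> V" "v' \<notin> Z t" "\<forall>u2\<in>Z t - {u}. v' \<bullet> u2 = 0"
        using edge[OF t \<open>u \<in> Z t\<close>] by blast
      have "(\<alpha>2 *\<^sub>R t - u2) \<bullet> v' \<le> 0" using Tle that v' by blast
      moreover have "u2 \<bullet> v' = 0" using v' that by (auto simp: inner_commute)
      moreover have "t \<bullet> v' < 0" using Tless[OF tT] v' by blast
      ultimately show ?thesis by (simp add: inner_diff_left mult_le_0_iff)
    qed
    obtain \<alpha> v' where v': "v' \<in> V" "v' \<notin> Z t" "\<alpha> *\<^sub>R t - u \<in> T" "(\<alpha> *\<^sub>R t - u) \<bullet> v' = 0"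
      "v' = (v' \<bullet> u) *\<^sub>R u + (v' \<bullet> t) *\<^sub>R t"
      using edge[OF t u(1)] by blast
    have \<alpha>: "\<alpha> \<ge> 0" using main u v' by metis
    have tv': "t \<bullet> v' < 0" using Tless[OF tT] v' by blast
    have "u \<bullet> v' = \<alpha> * (t \<bullet> v')" using v'(4) by (simp add: inner_diff_left)
    then have "y \<bullet> v' = (t \<bullet> v') * (\<alpha> * (y \<bullet> u) + y \<bullet> t)"
      by (subst v'(5)) (simp add: inner_add_right inner_commute[of v'] algebra_simps)
    moreover have "y \<bullet> v' \<le> 0" using Tle y v' by blast
    ultimately have "\<alpha> * (y \<bullet> u) + y \<bullet> t \<ge> 0"
      using tv' by (simp add: mult_le_0_iff)
    moreover have "\<alpha> * (y \<bullet> u) \<le> 0"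
      using \<alpha> Tle[OF y, of u] u by (simp add: Z_def mult_nonneg_nonpos)
    ultimately show ?thesis by linarith
  qed
  \<comment> \<open>The optimal \<open>t\<close> maximizes the product with \<open>v\<close> over
    unit vectors of the facet \<open>w\<close>. The third facet \<open>x0\<close> excludes a planar
    cone, in which \<open>w\<close> would be the only facet at \<open>t\<close>.\<close>
  have closest: "\<exists>t u2. ray t \<and> w \<in> Z t \<and> t \<bullet> v < 0 \<and> u2 \<in> Z t \<and> u2 \<noteq> w \<and>
      (\<forall>u\<in>Z t - {w}. v \<bullet> u \<ge> 0) \<and> v = (\<Sum>u\<in>Z t. (v \<bullet> u) *\<^sub>R u) + (t \<bullet> v) *\<^sub>R t"
    if vw: "v \<in> V" "w \<in> V" "v \<noteq> w" and disj: "\<And>t. t \<in> T \<Longrightarrow> t \<bullet> v = 0 \<Longrightarrow> t \<bullet> w = 0 \<Longrightarrow> Z t = V"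
      and x0: "x0 \<in> V" "x0 \<noteq> v" "x0 \<noteq> w" for v w x0
  proof -
    define K where "K = {t \<in> span V. norm t = 1 \<and> t \<in> T \<and> t \<bullet> w = 0}"
    have K_eq: "K = span V \<inter> sphere 0 1 \<inter> (\<Inter>v\<in>V. {t. t \<bullet> v \<le> 0}) \<inter> {t. t \<bullet> w = 0}"
      by (auto simp: K_def T_def)
    have "closed (\<Inter>v\<in>V. {t. t \<bullet> v \<le> 0})" "closed {t. t \<bullet> w = 0}"
      by (intro closed_INT ballI closed_Collect_le closed_Collect_eq continuous_intros)+
    then have "compact K"
      unfolding K_eq by (intro compact_Int_closed closed_Int_compact closed_span compact_sphere)
    obtain y where y: "y \<bullet> w = 0" "\<forall>u\<in>V - {w}. y \<bullet> u < 0" using facet vw by blast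
    obtain p q where pq: "p \<in> span V" "\<And>u. u \<in> span V \<Longrightarrow> orthogonal q u" "y = p + q"
      using orthogonal_subspace_decomp_exists[of V y] by blast
    have p: "p \<bullet> u = y \<bullet> u" if "u \<in> V" for u
      using pq(2)[of u] that by (simp add: pq(3) inner_add_left orthogonal_def span_base)
    have pv: "p \<bullet> v < 0" using p[OF vw(1)] y vw by simp
    then have p0: "p \<noteq> 0" by auto
    have "p \<bullet> u \<le> 0" if "u \<in> V" for u
      using p[OF that] y that by (cases "u = w") (auto intro: less_imp_le)
    then have "(1 / norm p) *\<^sub>R p \<in> K"
      using pq(1) p[OF vw(2)] y(1) p0 by (simp add: K_def T_def span_scale divide_nonpos_nonneg)
    then have "K \<noteq> {}" by blast
    then obtain t where t: "t \<in> K" and tmax: "\<forall>s\<in>K. s \<bullet> v \<le> t \<bullet> v"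
      using continuous_attains_sup[OF \<open>compact K\<close> _ continuous_on_inner[OF continuous_on_id continuous_on_const]]
      by blast
    have tT: "t \<in> T" "t \<in> span V" "norm t = 1" "t \<bullet> w = 0" using t by (auto simp: K_def)
    have tt: "t \<bullet> t = 1" using tT by (simp add: norm_eq_sqrt_inner)
    have tv: "t \<bullet> v < 0"
    proof (rule ccontr)
      assume "\<not> t \<bullet> v < 0"
      then have "t \<bullet> v = 0" using Tle[OF tT(1) vw(1)] by simp
      then have "Z t = V" using disj tT by blast
      then have "u \<in> Z t" if "u \<in> V" for u using that by simp
      then have "orthogonal t u" if "u \<in> V" for u using that by (simp add: Z_def orthogonal_def)
      then have "orthogonal t t" using orthogonal_to_span tT(2) by blast
      then show False using tt by (simp add: orthogonal_def)
    qed
    have "v \<notin> Z t" using tv by (simp add: Z_def)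
    then have ZtV: "Z t \<noteq> V" using vw by blast
    have wZ: "w \<in> Z t" using tT vw by (simp add: Z_def)
    \<comment> \<open>Variation of \<open>t\<close> along \<open>s\<close>: the perturbed vector has
      norm \<open>n\<close> at least 1, and since \<open>t \<bullet> v\<close> is negative,
      normalizing it can only increase the product with \<open>v\<close>. So equality already forces
      \<open>s = 0\<close>.\<close>
    have var: "s \<bullet> v \<le> 0 \<and> (s \<bullet> v = 0 \<longrightarrow> s = 0)"
      if s: "s \<in> span V" "\<And>u. u \<in> Z t \<Longrightarrow> s \<bullet> u \<le> 0" "s \<bullet> w = 0" "s \<bullet> t = 0" for s
    proof -
      obtain e where e: "e > 0" "\<forall>u\<in>V - Z t. (t + e *\<^sub>R s) \<bullet> u < 0"
        using perturb[OF tT(1), of s] by (meson order_refl)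
      have "(t + e *\<^sub>R s) \<bullet> u \<le> 0" if "u \<in> V" for u
      proof (cases "u \<in> Z t")
        case True
        then show ?thesis using s(2)[OF True] e by (simp add: Z_def inner_add_left mult_nonneg_nonpos)
      qed (use e that in force)
      then have inT: "t + e *\<^sub>R s \<in> T" by (simp add: T_def)
      define n where "n = norm (t + e *\<^sub>R s)"
      have n2: "n\<^sup>2 = 1 + e\<^sup>2 * (s \<bullet> s)"
        using tt s(4) by (simp add: n_def power2_norm_eq_inner inner_add_left inner_add_right
            inner_commute[of t s]) (simp add: power2_eq_square)
      then have "1\<^sup>2 \<le> n\<^sup>2" by simp
      then have n1: "n \<ge> 1" by (rule power2_le_imp_le) (simp add: n_def)
      have "(1 / n) *\<^sub>R (t + e *\<^sub>R s) \<in> K"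
        using inT n1 tT s Tle[OF inT]
        by (auto simp: K_def T_def n_def[symmetric] span_add span_scale inner_add_left divide_nonpos_nonneg)
      from bspec[OF tmax this] have "(t \<bullet> v + e * (s \<bullet> v)) / n \<le> t \<bullet> v" by (simp add: inner_add_left)
      then have le: "t \<bullet> v + e * (s \<bullet> v) \<le> (t \<bullet> v) * n" using n1 by (simp add: divide_le_eq)
      also have "(t \<bullet> v) * n \<le> t \<bullet> v" using n1 tv mult_left_mono_neg[of 1 n "t \<bullet> v"] by simp
      finally have "e * (s \<bullet> v) \<le> 0" by simp
      then have "s \<bullet> v \<le> 0" using e(1) by (simp add: mult_le_0_iff)
      moreover have "s = 0" if "s \<bullet> v = 0"
      proof -
        have "(t \<bullet> v) * 1 \<le> (t \<bullet> v) * n" using le that by simp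
        then have "n \<le> 1" using tv by (simp only: mult_le_cancel_left_neg)
        then have "e\<^sup>2 * (s \<bullet> s) = 0" using n1 n2 by simp
        then show ?thesis using e(1) by simp
      qed
      ultimately show ?thesis by blast
    qed
    have ray: "ray t"
      unfolding ray_def
    proof (intro conjI ballI impI)
      fix r assume r: "r \<in> span V" "\<forall>u\<in>Z t. r \<bullet> u = 0" "r \<bullet> t = 0"
      then have "r \<bullet> v \<le> 0" "(- r) \<bullet> v \<le> 0"
        using var[of r] var[of "- r"] wZ by (auto simp: span_neg)
      then have "r \<bullet> v = 0" by simp
      then show "r = 0" using var[of r] r wZ by auto
    qed (use tT tt ZtV in auto)
    have a: "v \<bullet> u \<ge> 0" if u: "u \<in> Z t - {w}" for u
    proof -
      have "(- u) \<bullet> v \<le> 0"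
      proof (rule conjunct1[OF var])
        show "- u \<in> span V" using u by (auto simp: Z_def intro: span_neg span_base)
        show "- u \<bullet> u' \<le> 0" if "u' \<in> Z t" for u'
          using orth[OF tT(1) ZtV, of u u'] u that by (cases "u = u'") auto
        show "- u \<bullet> w = 0" using orth[OF tT(1) ZtV, of u w] u wZ by auto
        show "- u \<bullet> t = 0" using u by (simp add: Z_def inner_commute)
      qed
      then show ?thesis by (simp add: inner_commute)
    qed
    have finZ: "finite (Z t)" using fin by (simp add: Z_def)
    define r where "r = v - (\<Sum>u\<in>Z t. (v \<bullet> u) *\<^sub>R u) - (t \<bullet> v) *\<^sub>R t"
    have "r \<bullet> u' = 0" if u': "u' \<in> Z t" for u'
    proof -
      have "(\<Sum>u\<in>Z t. (v \<bullet> u) *\<^sub>R u) \<bullet> u' = (\<Sum>u\<in>Z t. (v \<bullet> u) * (u \<bullet> u'))"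
        by (simp add: inner_sum_left)
      also have "\<dots> = (\<Sum>u\<in>Z t. if u = u' then v \<bullet> u' else 0)"
        using orth[OF tT(1) ZtV _ u'] unit u' by (intro sum.cong) (auto simp: Z_def)
      also have "\<dots> = v \<bullet> u'" using finZ u' by simp
      finally show ?thesis using u' by (simp add: r_def inner_diff_left Z_def)
    qed
    moreover have "r \<bullet> t = 0"
    proof -
      have "(\<Sum>u\<in>Z t. (v \<bullet> u) *\<^sub>R u) \<bullet> t = (\<Sum>u\<in>Z t. (v \<bullet> u) * (u \<bullet> t))"
        by (simp add: inner_sum_left)
      also have "\<dots> = 0" by (intro sum.neutral) (auto simp: Z_def inner_commute[of _ t])
      finally show ?thesis using tt by (simp add: r_def inner_diff_left inner_commute[of v t])
    qed
    moreover have "r \<in> span V"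
      using vw tT unfolding r_def
      by (intro span_diff span_sum span_scale) (auto intro: span_base simp: Z_def)
    ultimately have "r = 0" using ray by (auto simp: ray_def)
    then have v_eq: "v = (\<Sum>u\<in>Z t. (v \<bullet> u) *\<^sub>R u) + (t \<bullet> v) *\<^sub>R t" by (simp add: r_def algebra_simps)
    \<comment> \<open>If \<open>w\<close> were the only facet at \<open>t\<close>, then
      \<open>w\<close> and \<open>t\<close> would span \<open>span V\<close>, and a planar cone has
      no room for a third facet besides \<open>w\<close> and \<open>v1\<close>.\<close>
    have "\<exists>u2. u2 \<in> Z t \<and> u2 \<noteq> w"
    proof (rule ccontr)
      assume "\<not> ?thesis"
      then have Zw: "Z t = {w}" using wZ by blast
      obtain \<alpha> v1 where v1: "v1 \<in> V" "v1 \<notin> Z t" "\<alpha> *\<^sub>R t - w \<in> T" "(\<alpha> *\<^sub>R t - w) \<bullet> v1 = 0"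
        "v1 = (v1 \<bullet> w) *\<^sub>R w + (v1 \<bullet> t) *\<^sub>R t" by (rule edge[OF ray wZ, THEN exE], elim exE conjE, rule that)
      obtain x where x: "x \<in> V" "x \<noteq> w" "x \<noteq> v1" using vw x0 by metis
      obtain y where y: "y \<bullet> x = 0" "\<forall>u\<in>V - {x}. y \<bullet> u < 0" using facet[OF x(1)] by blast
      have tx: "t \<bullet> x < 0" "t \<bullet> v1 < 0" using Tless[OF tT(1)] x v1(1,2) Zw by auto
      define r where "r = x - (x \<bullet> w) *\<^sub>R w - (x \<bullet> t) *\<^sub>R t"
      have "r \<bullet> w = 0" "r \<bullet> t = 0" "r \<in> span V"
        using unit vw tT tt x unfolding r_def
        by (auto simp: inner_diff_left inner_commute[of w t] intro!: span_diff span_scale intro: span_base)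
      then have "r = 0" using ray Zw by (auto simp: ray_def)
      then have x_eq: "x = (x \<bullet> w) *\<^sub>R w + (x \<bullet> t) *\<^sub>R t" by (simp add: r_def algebra_simps)
      have yw: "y \<bullet> w < 0" "y \<bullet> v1 < 0" using y x vw v1(1) by auto
      have "w \<bullet> v1 = \<alpha> * (t \<bullet> v1)" using v1(4) by (simp add: inner_diff_left)
      then have "y \<bullet> v1 = (t \<bullet> v1) * (\<alpha> * (y \<bullet> w) + y \<bullet> t)"
        by (subst v1(5)) (simp add: inner_add_right inner_commute[of v1] algebra_simps)
      then have pos: "\<alpha> * (y \<bullet> w) + y \<bullet> t > 0" using yw tx by (simp add: mult_less_0_iff)
      have "(\<alpha> *\<^sub>R t - w) \<bullet> x \<le> 0" using Tle v1(3) x(1) by blast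
      then have "\<alpha> * (t \<bullet> x) \<le> w \<bullet> x" by (simp add: inner_diff_left)
      then have "(w \<bullet> x) * (y \<bullet> w) \<le> (\<alpha> * (t \<bullet> x)) * (y \<bullet> w)"
        using yw by (intro mult_right_mono_neg) auto
      moreover have "y \<bullet> x = (w \<bullet> x) * (y \<bullet> w) + (t \<bullet> x) * (y \<bullet> t)"
        by (subst x_eq) (simp add: inner_add_right inner_commute[of x])
      ultimately have "0 \<le> (t \<bullet> x) * (\<alpha> * (y \<bullet> w) + y \<bullet> t)"
        using y by (simp add: algebra_simps)
      then show False using mult_neg_pos[OF tx(1) pos] by simp
    qed
    then obtain u2 where u2: "u2 \<in> Z t" "u2 \<noteq> w" by blast
    show ?thesis
      by (rule exI[of _ t], rule exI[of _ u2], intro conjI ballI) (fact ray wZ tv u2 a v_eq)+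
  qed
  \<comment> \<open>With only two facets the origin lies on both, so they are adjacent.\<close>
  have two: "v \<bullet> w = 0" if "V = {v, w}" "v \<noteq> w" for v w
  proof -
    have "\<exists>y. y \<bullet> v = 0 \<and> y \<bullet> w = 0 \<and> (\<forall>u\<in>V - {v, w}. y \<bullet> u < 0)"
      by (rule exI[of _ 0]) (use that in auto)
    then show ?thesis using adjacent that by blast
  qed
  have meet: "v \<bullet> w = 0" if "v \<in> V" "w \<in> V" "v \<noteq> w" "t \<in> T" "t \<bullet> v = 0" "t \<bullet> w = 0" "Z t \<noteq> V" for v w t
    using orth[of t v w] that by (auto simp: Z_def)
  \<comment> \<open>Evaluating the expansion of \<open>v\<close> at a point \<open>y\<close> of its
    own facet would give a negative number instead of 0 if \<open>v \<bullet> w\<close> were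
    positive.\<close>
  have nonpos: "v \<bullet> w \<le> 0" if vw: "v \<in> V" "w \<in> V" "v \<noteq> w" for v w
  proof (rule ccontr)
    assume pos: "\<not> v \<bullet> w \<le> 0"
    then have "V \<noteq> {v, w}" using two[of v w] vw(3) by auto
    then obtain x0 where x0: "x0 \<in> V" "x0 \<noteq> v" "x0 \<noteq> w" using vw by blast
    have disj: "Z t = V" if "t \<in> T" "t \<bullet> v = 0" "t \<bullet> w = 0" for t using meet[OF vw that] pos by auto
    from closest[OF vw disj x0] obtain t u2 where t: "ray t" "w \<in> Z t" "t \<bullet> v < 0" "u2 \<in> Z t" "u2 \<noteq> w"
      "\<forall>u\<in>Z t - {w}. v \<bullet> u \<ge> 0" "v = (\<Sum>u\<in>Z t. (v \<bullet> u) *\<^sub>R u) + (t \<bullet> v) *\<^sub>R t" by blast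
    obtain y where y: "y \<bullet> v = 0" "\<forall>u\<in>V - {v}. y \<bullet> u < 0" using facet vw by blast
    have "y \<in> T" using y by (force simp: T_def)
    then have yt: "y \<bullet> t \<ge> 0" using ray_nonneg[OF t(1,4,2,5)] by blast
    have finZ: "finite (Z t)" using fin by (simp add: Z_def)
    have "y \<bullet> v = (\<Sum>u\<in>Z t. (v \<bullet> u) * (y \<bullet> u)) + (t \<bullet> v) * (y \<bullet> t)"
      by (subst t(7)) (simp add: inner_add_right inner_sum_right)
    also have "\<dots> = (v \<bullet> w) * (y \<bullet> w) + (\<Sum>u\<in>Z t - {w}. (v \<bullet> u) * (y \<bullet> u)) + (t \<bullet> v) * (y \<bullet> t)"
      using finZ t(2) by (simp add: sum.remove)
    also have "(v \<bullet> w) * (y \<bullet> w) < 0" using pos y vw by (auto intro: mult_pos_neg)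
    also have "(\<Sum>u\<in>Z t - {w}. (v \<bullet> u) * (y \<bullet> u)) \<le> 0"
      using t(6) Tle[OF \<open>y \<in> T\<close>] by (intro sum_nonpos) (auto simp: Z_def mult_nonneg_nonpos)
    also have "(t \<bullet> v) * (y \<bullet> t) \<le> 0" using t(3) yt by (simp add: mult_nonpos_nonneg)
    finally show False using y by simp
  qed
  show ?case
  proof (rule ccontr)
    assume ne: "v \<bullet> w \<noteq> 0"
    note vw = \<open>v \<in> V\<close> \<open>w \<in> V\<close> \<open>v \<noteq> w\<close>
    have "V \<noteq> {v, w}" using two vw ne by blast
    then obtain x0 where x0: "x0 \<in> V" "x0 \<noteq> v" "x0 \<noteq> w" using vw by blast
    have disj: "Z t = V" if "t \<in> T" "t \<bullet> v = 0" "t \<bullet> w = 0" for t using meet[OF vw that] ne by auto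
    from closest[OF vw disj x0] obtain t u2 where t: "ray t" "w \<in> Z t" "t \<bullet> v < 0" "u2 \<in> Z t" "u2 \<noteq> w"
      "\<forall>u\<in>Z t - {w}. v \<bullet> u \<ge> 0" by blast
    have u2: "u2 \<in> V" "u2 \<noteq> v" "u2 \<bullet> u2 = 1" "t \<bullet> u2 = 0" using t unit by (auto simp: Z_def)
    have vu2: "v \<bullet> u2 = 0" using t(4,5,6) nonpos[OF vw(1) u2(1)] u2 by force
    \<comment> \<open>Leave \<open>t\<close> along the edge away from \<open>u2\<close>, which stays
      in the facet \<open>w\<close>. If it meets \<open>v\<close>, the facets \<open>v\<close> and
      \<open>w\<close> have a common point after all; if it meets another facet, that facet has
      positive product with \<open>v\<close>.\<close>
    obtain \<alpha> v' where v': "v' \<in> V" "v' \<notin> Z t" "\<alpha> *\<^sub>R t - u2 \<in> T" "(\<alpha> *\<^sub>R t - u2) \<bullet> v' = 0"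
      "v' = (v' \<bullet> u2) *\<^sub>R u2 + (v' \<bullet> t) *\<^sub>R t" using edge[OF t(1,4)] by blast
    have tT: "t \<in> T" "Z t \<noteq> V" using t(1) by (auto simp: ray_def)
    have tv': "t \<bullet> v' < 0" using Tless[OF tT(1)] v' by blast
    show False
    proof (cases "v' = v")
      case True
      let ?t = "\<alpha> *\<^sub>R t - u2"
      have "?t \<bullet> w = 0"
        using orth[OF tT t(4,2,5)] t(2) by (simp add: inner_diff_left Z_def)
      then have "Z ?t = V" using disj v' True by blast
      then have "u2 \<in> Z ?t" using u2(1) by simp
      then show False using u2 by (simp add: Z_def inner_diff_left)
    next
      case False
      have "v \<bullet> v' = (v' \<bullet> t) * (t \<bullet> v)"
        using vu2 by (subst v'(5)) (simp add: inner_add_right inner_commute[of v t])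
      also have "\<dots> > 0" using tv' t(3) by (simp add: inner_commute[of v' t] mult_neg_neg)
      finally show False using nonpos[OF vw(1) v'(1)] False by auto
    qed
  qed
qed

section \<open>Right-angled polyhedra\<close>

text \<open>Signs of products with normals survive positive rescaling, so it suffices that
  \<open>z + d *\<^sub>R t\<close> remains timelike and future-directed; \<open>e2\<close> controls
  the terms of its norm that involve \<open>t\<close>.\<close>

lemma hyperbolic_perturbation:
  fixes z t :: "(real^'m::finite) \<times> real"
  assumes z: "z \<in> hyperbolic_space" and U: "finite U" "\<And>u. u \<in> U \<Longrightarrow> lorentz z u < 0"
  shows "\<exists>e>0. \<forall>d. 0 < d \<and> d \<le> e \<longrightarrow>
    (\<forall>u\<in>U. lorentz (z + d *\<^sub>R t) u < 0) \<and>
    (\<exists>c>0. c *\<^sub>R (z + d *\<^sub>R t) \<in> hyperbolic_space)"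
proof -
  obtain e1 where e1: "e1 > 0" "\<forall>d. 0 < d \<and> d \<le> e1 \<longrightarrow> (\<forall>u\<in>U. lorentz z u + d * lorentz t u < 0)"
    using small_perturbation[of U "lorentz z" "lorentz t"] U by blast
  let ?q = "2 * \<bar>lorentz z t\<bar> + \<bar>lorentz t t\<bar>"
  obtain e2 where e2: "e2 > 0" "\<forall>d. 0 < d \<and> d \<le> e2 \<longrightarrow> (\<forall>u\<in>{()}. -1 + d * ?q < 0)"
    using small_perturbation[of "{()}" "\<lambda>_. -1" "\<lambda>_. ?q"] by auto
  have "\<exists>c>0. c *\<^sub>R (z + d *\<^sub>R t) \<in> hyperbolic_space" if d: "0 < d" "d \<le> min 1 e2" for d
  proof -
    have q: "d * ?q < 1" using e2(2) d by simp
    have zt: "d * lorentz z t \<le> d * \<bar>lorentz z t\<bar>" "0 \<le> d * \<bar>lorentz z t\<bar>"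
      using d by (auto intro: mult_left_mono)
    have "d * lorentz t t \<le> 1 * \<bar>lorentz t t\<bar>"
      using d mult_right_mono[of d 1 "\<bar>lorentz t t\<bar>"] mult_left_mono[of "lorentz t t" "\<bar>lorentz t t\<bar>" d]
      by linarith
    then have "d * (d * lorentz t t) \<le> d * \<bar>lorentz t t\<bar>"
      using d(1) by (intro mult_left_mono) auto
    then have "lorentz (z + d *\<^sub>R t) (z + d *\<^sub>R t) < 0"
      using q zt hyperbolic_spaceD(1)[OF z]
      by (simp add: lorentz_simps lorentz_commute[of t z] algebra_simps)
    moreover have "0 \<le> d * \<bar>lorentz t t\<bar>" using d by simp
    then have "lorentz (z + d *\<^sub>R t) z < 0"
      using q zt hyperbolic_spaceD(1)[OF z]
      by (simp add: lorentz_simps lorentz_commute[of t z] algebra_simps)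
    ultimately show ?thesis using normalize_hyperbolic[OF z] by metis
  qed
  then show ?thesis using e1 e2(1)
    by (intro exI[of _ "min e1 (min 1 e2)"]) (simp add: lorentz_simps)
qed

text \<open>Orthogonality is assumed only at points lying on exactly two facets. The point in
  \<open>facet\<close> lies on one facet only, which makes \<open>N\<close> an irredundant system of
  inequalities.\<close>

locale compact_polyhedron =
  fixes P :: "((real^'m::finite) \<times> real) set" and N o'
  assumes fin: "finite N" and unit: "v \<in> N \<Longrightarrow> lorentz v v = 1"
    and P_eq: "P = {x \<in> hyperbolic_space. \<forall>v\<in>N. lorentz x v \<le> 0}"
    and o: "o' \<in> hyperbolic_space" and o_neg: "v \<in> N \<Longrightarrow> lorentz o' v < 0"
    and facet: "v \<in> N \<Longrightarrow> \<exists>y\<in>P. lorentz y v = 0 \<and> (\<forall>w\<in>N - {v}. lorentz y w < 0)"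
    and adjacent: "v \<in> N \<Longrightarrow> w \<in> N \<Longrightarrow> v \<noteq> w \<Longrightarrow> z \<in> P \<Longrightarrow> {u \<in> N. lorentz z u = 0} = {v, w} \<Longrightarrow>
      lorentz v w = 0"
    and compact: "compact P"
begin

lemma polyhedronD: "x \<in> P \<Longrightarrow> x \<in> hyperbolic_space" "x \<in> P \<Longrightarrow> v \<in> N \<Longrightarrow> lorentz x v \<le> 0"
  by (auto simp: P_eq)

text \<open>In the tangent space at \<open>x\<close> the facets through \<open>x\<close> bound a
  Euclidean right-angled cone. A vector in this cone on exactly two facets is turned into a point of
  \<open>P\<close> near \<open>x\<close> on exactly these facets, where \<open>adjacent\<close>
  applies.\<close>

lemma orthogonal_if_meet:
  assumes x: "x \<in> P" and v: "v \<in> N" "lorentz x v = 0" and w: "w \<in> N" "lorentz x w = 0" and "v \<noteq> w"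
  shows "lorentz v w = 0"
proof -
  define Z where "Z = {v \<in> N. lorentz x v = 0}"
  define \<psi> where "\<psi> = tangent_coord x"
  have xH: "x \<in> hyperbolic_space" using x polyhedronD by blast
  have Z: "u \<in> N" "lorentz x u = 0" "lorentz u x = 0" if "u \<in> Z" for u
    using that by (auto simp: Z_def lorentz_commute[of u x])
  have \<psi>: "\<psi> s \<bullet> \<psi> t = lorentz s t" if "lorentz s x = 0" "lorentz t x = 0" for s t
    unfolding \<psi>_def by (rule tangent_coord_inner[OF xH that])
  have proj: "\<psi> (tangent_proj x y) \<bullet> \<psi> u = lorentz y u" if "u \<in> Z" for y u
    using \<psi>[OF tangent_proj_orth[OF xH] Z(3)[OF that], of y] Z[OF that]
    by (simp add: tangent_proj_def lorentz_simps)
  have inj: "s = t" if "s \<in> Z" "t \<in> Z" "\<psi> s = \<psi> t" for s t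
  proof -
    have "lorentz (s - t) (s - t) = (\<psi> s - \<psi> t) \<bullet> (\<psi> s - \<psi> t)"
      using \<psi>[OF Z(3)[OF that(1)] Z(3)[OF that(2)]] \<psi>[OF Z(3)[OF that(1)] Z(3)[OF that(1)]]
        \<psi>[OF Z(3)[OF that(2)] Z(3)[OF that(2)]] \<psi>[OF Z(3)[OF that(2)] Z(3)[OF that(1)]]
      by (simp add: lorentz_simps inner_diff_left inner_diff_right)
    then have "lorentz (s - t) (s - t) = 0" using that by simp
    moreover have "lorentz (s - t) x = 0" using Z that by (simp add: lorentz_simps)
    ultimately show ?thesis using tangent_nonneg(2)[OF xH, of "s - t"] by simp
  qed
  have "\<psi> v \<bullet> \<psi> w = 0"
  proof (rule right_angled_cone_orthogonal[of "\<psi> ` Z" "\<psi> (tangent_proj x o')"])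
    show "finite (\<psi> ` Z)" using fin by (simp add: Z_def)
    show "u \<bullet> u = 1" if "u \<in> \<psi> ` Z" for u using that \<psi> Z unit by force
    show "\<psi> (tangent_proj x o') \<bullet> u < 0" if "u \<in> \<psi> ` Z" for u
    proof -
      obtain u' where "u' \<in> Z" "u = \<psi> u'" using \<open>u \<in> \<psi> ` Z\<close> by (elim imageE)
      then show ?thesis using proj[of u' o'] o_neg[OF Z(1)] by simp
    qed
    show "\<exists>y. y \<bullet> u = 0 \<and> (\<forall>w\<in>\<psi> ` Z - {u}. y \<bullet> w < 0)" if u: "u \<in> \<psi> ` Z" for u
    proof -
      obtain u' where u': "u' \<in> Z" "u = \<psi> u'" using u by (elim imageE)
      obtain y where y: "lorentz y u' = 0" "\<forall>w\<in>N - {u'}. lorentz y w < 0"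
        using facet[OF Z(1)[OF u'(1)]] by blast
      have "\<psi> (tangent_proj x y) \<bullet> w < 0" if w: "w \<in> \<psi> ` Z - {u}" for w
      proof -
        obtain w' where w': "w' \<in> Z" "w = \<psi> w'" using w by blast
        then have "w' \<in> N - {u'}" using w u'(2) Z(1) by blast
        then show ?thesis using proj[OF w'(1), of y] y(2) w'(2) by simp
      qed
      moreover have "\<psi> (tangent_proj x y) \<bullet> u = 0" using proj[OF u'(1), of y] y(1) u'(2) by simp
      ultimately show ?thesis by blast
    qed
    show "\<psi> v \<in> \<psi> ` Z" "\<psi> w \<in> \<psi> ` Z" using v w by (auto simp: Z_def)
    show "\<psi> v \<noteq> \<psi> w" using inj[of v w] v w \<open>v \<noteq> w\<close> by (simp add: Z_def) blast
    show "p \<bullet> q = 0" if pq: "p \<in> \<psi> ` Z" "q \<in> \<psi> ` Z" "p \<noteq> q"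
      and ex: "\<exists>y. y \<bullet> p = 0 \<and> y \<bullet> q = 0 \<and> (\<forall>u\<in>\<psi> ` Z - {p, q}. y \<bullet> u < 0)" for p q
    proof -
      obtain v w where vw: "v \<in> Z" "w \<in> Z" "p = \<psi> v" "q = \<psi> w" using pq by blast
      obtain y where y: "y \<bullet> p = 0" "y \<bullet> q = 0" "\<forall>u\<in>\<psi> ` Z - {p, q}. y \<bullet> u < 0" using ex by blast
      define Y where "Y = tangent_vec x y"
      have Y: "lorentz Y u = y \<bullet> \<psi> u" if "u \<in> Z" for u
        using \<psi>[of Y u] tangent_vec[OF xH, of y] Z[OF that] by (simp add: Y_def \<psi>_def)
      have Yneg: "lorentz Y u < 0" if "u \<in> Z" "u \<noteq> v" "u \<noteq> w" for u
        
      proof -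
        have "\<psi> u \<in> \<psi> ` Z - {p, q}"
          using inj[OF that(1) vw(1)] inj[OF that(1) vw(2)] that vw(3,4) by blast
        then show ?thesis using Y[OF that(1)] y(3) by simp
      qed
      have "finite (N - Z)" "\<And>u. u \<in> N - Z \<Longrightarrow> lorentz x u < 0"
        using fin polyhedronD(2)[OF x] by (auto simp: Z_def less_le)
      from hyperbolic_perturbation[OF xH this, of Y] obtain e where
        e0: "e > 0" "\<forall>d. 0 < d \<and> d \<le> e \<longrightarrow> (\<forall>u\<in>N - Z. lorentz (x + d *\<^sub>R Y) u < 0) \<and>
          (\<exists>c>0. c *\<^sub>R (x + d *\<^sub>R Y) \<in> hyperbolic_space)" by blast
      have *: "\<forall>u\<in>N - Z. lorentz (x + e *\<^sub>R Y) u < 0"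
        "\<exists>c>0. c *\<^sub>R (x + e *\<^sub>R Y) \<in> hyperbolic_space" using e0(1) e0(2)[rule_format, of e] by simp_all
      obtain c where e: "e > 0" "\<forall>u\<in>N - Z. lorentz (x + e *\<^sub>R Y) u < 0" "c > 0"
        "c *\<^sub>R (x + e *\<^sub>R Y) \<in> hyperbolic_space" using e0(1) * by blast
      let ?z = "c *\<^sub>R (x + e *\<^sub>R Y)"
      have zero: "lorentz ?z v = 0" "lorentz ?z w = 0"
        using Y[OF vw(1)] Y[OF vw(2)] Z(2)[OF vw(1)] Z(2)[OF vw(2)] y(1,2) vw(3,4)
        by (simp_all add: lorentz_simps)
      have neg: "lorentz ?z u < 0" if "u \<in> N" "u \<noteq> v" "u \<noteq> w" for u
      proof (cases "u \<in> Z")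
        case True
        then show ?thesis using Yneg[OF True that(2,3)] Z[OF True] e
          by (simp add: lorentz_simps mult_pos_neg)
      next
        case False
        then show ?thesis using e that by (simp add: lorentz_simps(7) mult_pos_neg)
      qed
      have "lorentz ?z u \<le> 0" if "u \<in> N" for u
        using zero neg[OF that] by (cases "u = v \<or> u = w") (auto intro: less_imp_le)
      then have "?z \<in> P" using e(4) unfolding P_eq by blast
      moreover have "u = v \<or> u = w" if "u \<in> N" "lorentz ?z u = 0" for u
        using neg[OF that(1)] that(2) by (metis less_irrefl)
      then have "{u \<in> N. lorentz ?z u = 0} = {v, w}" using zero Z(1)[OF vw(1)] Z(1)[OF vw(2)] by blast
      moreover have "v \<noteq> w" using pq(3) vw(3,4) by auto
      ultimately have "lorentz v w = 0" using adjacent vw Z by blast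
      then show ?thesis using \<psi> Z vw by simp
    qed
  qed
  then show ?thesis using \<psi>[of v w] v w by (simp add: lorentz_commute[of _ x])
qed

text \<open>Let \<open>x\<close> be the point of the facet of \<open>w\<close> which is closest to the facet of \<open>v\<close>; the gradient
  condition writes \<open>v\<close> in terms of \<open>x\<close> and the facet normals at \<open>x\<close>.\<close>

lemma closest_point:
  assumes v: "v \<in> N" and w: "w \<in> N" and disj: "\<And>z. z \<in> P \<Longrightarrow> lorentz z v = 0 \<Longrightarrow> lorentz z w \<noteq> 0"
  obtains x where "x \<in> P" "lorentz x w = 0" "lorentz x v < 0"
    "\<And>u. u \<in> N \<Longrightarrow> lorentz x u = 0 \<Longrightarrow> u \<noteq> w \<Longrightarrow> lorentz v u \<ge> 0"
    "v = (\<Sum>u\<in>{u\<in>N. lorentz x u = 0}. lorentz v u *\<^sub>R u) - lorentz x v *\<^sub>R x"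
proof -
  let ?K = "P \<inter> {x. lorentz x w = 0}"
  have cont: "continuous_on A (\<lambda>x. lorentz x u)" for A u
    by (intro lorentz.continuous_on continuous_intros)
  have "closed {x. lorentz x w = 0}" by (intro closed_Collect_eq cont continuous_on_const)
  then have "compact ?K" using compact by (rule compact_Int_closed[rotated])
  moreover have "?K \<noteq> {}" using facet[OF w] by blast
  ultimately obtain x where x: "x \<in> ?K" and xmax: "\<forall>y\<in>?K. lorentz y v \<le> lorentz x v"
    using continuous_attains_sup[OF _ _ cont] by blast
  define Z where "Z = {u\<in>N. lorentz x u = 0}"
  define h where "h = lorentz x v"
  have xP: "x \<in> P" and xw: "lorentz x w = 0" and xH: "x \<in> hyperbolic_space" using x polyhedronD by auto
  have h: "h < 0" using disj[OF xP] xw polyhedronD(2)[OF xP v] by (auto simp: h_def less_le)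
  have finZ: "finite Z" using fin by (simp add: Z_def)
  have Z: "u \<in> N" "lorentz x u = 0" "lorentz u x = 0" if "u \<in> Z" for u
    using that by (auto simp: Z_def lorentz_commute[of u x])
  have wZ: "w \<in> Z" using w xw by (simp add: Z_def)
  have orth: "lorentz u u' = (if u = u' then 1 else 0)" if "u \<in> Z" "u' \<in> Z" for u u'
    using orthogonal_if_meet[OF xP] Z[OF that(1)] Z[OF that(2)] unit by auto
  \<comment> \<open>First-order optimality of \<open>x\<close>: an admissible tangent direction
    increasing the product with \<open>v\<close> would win, because returning to the hyperboloid
    costs only second order.\<close>
  have var: "lorentz r v \<le> 0"
    if r: "lorentz r x = 0" "\<And>u. u \<in> Z \<Longrightarrow> lorentz r u \<le> 0" "lorentz r w = 0" for r
  proof (rule ccontr)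
    define \<rho> q where "\<rho> = lorentz r v" and "q = lorentz r r"
    assume "\<not> lorentz r v \<le> 0"
    then have \<rho>: "\<rho> > 0" by (simp add: \<rho>_def)
    have q: "q \<ge> 0" using tangent_nonneg(1)[OF xH r(1)] by (simp add: q_def)
    have "finite (N - Z)" "\<And>u. u \<in> N - Z \<Longrightarrow> lorentz x u < 0"
      using fin polyhedronD(2)[OF xP] by (auto simp: Z_def less_le)
    from hyperbolic_perturbation[OF xH this, of r] obtain e where e: "e > 0"
      "\<forall>d. 0 < d \<and> d \<le> e \<longrightarrow> (\<forall>u\<in>N - Z. lorentz (x + d *\<^sub>R r) u < 0) \<and>
        (\<exists>c>0. c *\<^sub>R (x + d *\<^sub>R r) \<in> hyperbolic_space)" by blast
    \<comment> \<open>The gain is \<open>d * \<rho>\<close> and the loss by renormalization at most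
      \<open>- h * d\<^sup>2 * q\<close>; this bound on \<open>d\<close>, with 1 added in the
      denominator, makes the gain strictly larger.\<close>
    define d where "d = min e (\<rho> / (- h * q + 1))"
    have pos: "- h * q + 1 > 0" using mult_nonpos_nonneg[of h q] h q by simp
    then have d: "d > 0" "d \<le> e" "d \<le> \<rho> / (- h * q + 1)" using e \<rho> by (auto simp: d_def)
    obtain c where c: "c > 0" "c *\<^sub>R (x + d *\<^sub>R r) \<in> hyperbolic_space"
      and neg: "\<forall>u\<in>N - Z. lorentz (x + d *\<^sub>R r) u < 0" using e(2) d by blast
    let ?z = "c *\<^sub>R (x + d *\<^sub>R r)"
    have "lorentz ?z u \<le> 0" if "u \<in> N" for u
    proof (cases "u \<in> Z")
      case True
      then show ?thesis using r(2)[OF True] Z[OF True] c d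
        by (simp add: lorentz_simps mult_nonneg_nonpos)
    next
      case False
      then have "lorentz (x + d *\<^sub>R r) u < 0" using neg that by blast
      then show ?thesis using c by (simp add: lorentz_simps(7) mult_nonneg_nonpos)
    qed
    then have "?z \<in> ?K" using c(2) xw r(3) unfolding P_eq by (simp add: lorentz_simps)
    then have "lorentz ?z v \<le> h" using xmax by (simp add: h_def)
    then have le: "c * (h + d * \<rho>) \<le> h" by (simp add: lorentz_simps h_def \<rho>_def)
    have "lorentz ?z ?z = c\<^sup>2 * (d\<^sup>2 * q - 1)"
      using r(1) hyperbolic_spaceD(1)[OF xH]
      by (simp add: lorentz_simps q_def lorentz_commute[of x r]) (simp add: power2_eq_square algebra_simps)
    then have cc: "c\<^sup>2 * (1 - d\<^sup>2 * q) = 1"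
      using hyperbolic_spaceD(1)[OF c(2)] by (simp add: algebra_simps)
    define k where "k = 1 / c"
    have ck: "c * k = 1" "k > 0" using c by (auto simp: k_def)
    have "c\<^sup>2 * k\<^sup>2 = 1" using ck by (simp add: power_mult_distrib[symmetric])
    then have "c\<^sup>2 * k\<^sup>2 = c\<^sup>2 * (1 - d\<^sup>2 * q)" using cc by simp
    then have kk: "k\<^sup>2 = 1 - d\<^sup>2 * q" using c(1) by simp
    then have "k\<^sup>2 \<le> 1\<^sup>2" using q by simp
    then have k1: "k \<le> 1" by (rule power2_le_imp_le) simp
    have "k\<^sup>2 \<le> k" using k1 ck(2) by (simp add: power2_eq_square)
    then have "1 - k \<le> d\<^sup>2 * q" using kk by simp
    have "k * (c * (h + d * \<rho>)) \<le> k * h" using le ck(2) by (intro mult_left_mono) auto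
    moreover have "k * (c * (h + d * \<rho>)) = h + d * \<rho>" using ck(1) by (metis mult.assoc mult.commute mult_1)
    ultimately have "d * \<rho> \<le> (- h) * (1 - k)" by (simp add: algebra_simps)
    also have "\<dots> \<le> (- h) * (d\<^sup>2 * q)" using h \<open>1 - k \<le> d\<^sup>2 * q\<close> by (intro mult_left_mono) auto
    finally have "d * \<rho> \<le> d * (d * (- h * q))" by (simp add: power2_eq_square algebra_simps)
    then have "\<rho> \<le> d * (- h * q)" using d(1) by (simp only: mult_le_cancel_left_pos)
    moreover have "d * (- h * q + 1) \<le> \<rho>" using d(3) pos by (simp add: pos_le_divide_eq)
    ultimately show False using d(1) by (simp add: algebra_simps)
  qed
  \<comment> \<open>The part of \<open>v\<close> orthogonal to \<open>x\<close> and to the normals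
    at \<open>x\<close>. It is an admissible direction, so \<open>lorentz r r = lorentz r v\<close>
    is nonpositive, and \<open>r\<close> vanishes.\<close>
  define r where "r = v + h *\<^sub>R x - (\<Sum>u\<in>Z. lorentz v u *\<^sub>R u)"
  have sum: "lorentz (\<Sum>u\<in>Z. lorentz v u *\<^sub>R u) y = (\<Sum>u\<in>Z. lorentz v u * lorentz u y)" for y
    by (simp add: lorentz.sum_left lorentz_simps)
  have rx: "lorentz r x = 0"
    using Z hyperbolic_spaceD(1)[OF xH]
    by (simp add: r_def lorentz_simps sum h_def lorentz_commute[of v x])
  have ru: "lorentz r u' = 0" if u': "u' \<in> Z" for u'
  proof -
    have "(\<Sum>u\<in>Z. lorentz v u * lorentz u u') = (\<Sum>u\<in>Z. if u = u' then lorentz v u' else 0)"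
      using orth u' by (intro sum.cong) auto
    also have "\<dots> = lorentz v u'" using finZ u' by simp
    finally show ?thesis using Z u' by (simp add: r_def lorentz_simps sum)
  qed
  have "lorentz r v \<le> 0" using var[of r] rx ru wZ by simp
  moreover have "lorentz r r = lorentz r v + h * lorentz r x - lorentz r (\<Sum>u\<in>Z. lorentz v u *\<^sub>R u)"
    by (subst (2) r_def) (simp add: lorentz_simps)
  moreover have "lorentz r (\<Sum>u\<in>Z. lorentz v u *\<^sub>R u) = 0"
    using ru by (simp add: lorentz.sum_right lorentz_simps)
  ultimately have "lorentz r r \<le> 0" using rx by simp
  then have "r = 0" using tangent_nonneg[OF xH rx] by simp
  then have v_eq: "v = (\<Sum>u\<in>Z. lorentz v u *\<^sub>R u) - h *\<^sub>R x" by (simp add: r_def algebra_simps)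
  have nonneg: "lorentz v u \<ge> 0" if u: "u \<in> N" "lorentz x u = 0" "u \<noteq> w" for u
  proof -
    have uZ: "u \<in> Z" using u by (simp add: Z_def)
    have "lorentz (- u) v \<le> 0"
      by (rule var) (use orth[OF uZ] Z[OF uZ] wZ u in \<open>auto simp: lorentz_simps\<close>)
    then show ?thesis by (simp add: lorentz_simps lorentz_commute[of v u])
  qed
  show ?thesis
    by (rule that[OF xP xw h[unfolded h_def] nonneg]) (assumption | fact v_eq[unfolded h_def Z_def])+
qed

text \<open>Evaluate the expansion of \<open>v\<close> at a point \<open>y\<close> of its facet: if
  \<open>lorentz v w\<close> were nonnegative, all terms would be nonpositive and the one with
  \<open>lorentz x v * lorentz y x\<close> negative.\<close>

lemma disjoint_facets_neg:
  assumes v: "v \<in> N" and w: "w \<in> N" and disj: "\<And>z. z \<in> P \<Longrightarrow> lorentz z v = 0 \<Longrightarrow> lorentz z w \<noteq> 0"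
  shows "lorentz v w < 0"
proof (rule ccontr)
  assume pos: "\<not> lorentz v w < 0"
  obtain x where x: "x \<in> P" "lorentz x w = 0" "lorentz x v < 0"
    "\<And>u. u \<in> N \<Longrightarrow> lorentz x u = 0 \<Longrightarrow> u \<noteq> w \<Longrightarrow> lorentz v u \<ge> 0"
    "v = (\<Sum>u\<in>{u\<in>N. lorentz x u = 0}. lorentz v u *\<^sub>R u) - lorentz x v *\<^sub>R x"
    by (rule closest_point[OF assms]) (assumption | rule that)+
  obtain y where y: "y \<in> P" "lorentz y v = 0" using facet[OF v] by blast
  have "lorentz y v = (\<Sum>u\<in>{u\<in>N. lorentz x u = 0}. lorentz v u * lorentz y u) - lorentz x v * lorentz y x"
    by (subst x(5)) (simp add: lorentz_simps lorentz.sum_right)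
  moreover have "(\<Sum>u\<in>{u\<in>N. lorentz x u = 0}. lorentz v u * lorentz y u) \<le> 0"
  proof (intro sum_nonpos)
    fix u assume "u \<in> {u\<in>N. lorentz x u = 0}"
    then have "lorentz v u \<ge> 0" "lorentz y u \<le> 0"
      using x(4)[of u] pos polyhedronD(2)[OF y(1), of u] by (cases "u = w", auto)
    then show "lorentz v u * lorentz y u \<le> 0" by (simp add: mult_nonneg_nonpos)
  qed
  moreover have "lorentz x v * lorentz y x > 0"
    using x(3) hyperbolic_lorentz_neg[OF polyhedronD(1)[OF y(1)] polyhedronD(1)[OF x(1)]] by (simp add: mult_neg_neg)
  ultimately show False using y(2) by simp
qed

text \<open>For disjoint facets, the other normals at the closest point have nonnegative product
  with \<open>v\<close>, so their facets meet that of \<open>v\<close> and are orthogonal to it.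
  Then \<open>v\<close> is a combination of \<open>w\<close> and \<open>x\<close> alone, and its
  norm gives \<open>(lorentz v w)\<^sup>2 = 1 + (lorentz x v)\<^sup>2\<close>.\<close>

lemma gram_matrix:
  assumes v: "v \<in> N" and w: "w \<in> N" and "v \<noteq> w"
  shows "lorentz v w = 0 \<or> lorentz v w \<le> -1"
proof (cases "\<exists>z\<in>P. lorentz z v = 0 \<and> lorentz z w = 0")
  case True
  then show ?thesis using orthogonal_if_meet v w \<open>v \<noteq> w\<close> by blast
next
  case False
  then have disj: "\<And>z. z \<in> P \<Longrightarrow> lorentz z v = 0 \<Longrightarrow> lorentz z w \<noteq> 0" by blast
  obtain x where x: "x \<in> P" "lorentz x w = 0" "lorentz x v < 0"
    "\<And>u. u \<in> N \<Longrightarrow> lorentz x u = 0 \<Longrightarrow> u \<noteq> w \<Longrightarrow> lorentz v u \<ge> 0"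
    "v = (\<Sum>u\<in>{u\<in>N. lorentz x u = 0}. lorentz v u *\<^sub>R u) - lorentz x v *\<^sub>R x"
    by (rule closest_point[OF v w disj]) (assumption | rule that)+
  let ?Z = "{u\<in>N. lorentz x u = 0}"
  have "lorentz v u = 0" if u: "u \<in> ?Z - {w}" for u
  proof -
    have "v \<noteq> u" using u x(3) by auto
    have "\<exists>z\<in>P. lorentz z v = 0 \<and> lorentz z u = 0"
      using disjoint_facets_neg[OF v, of u] x(4)[of u] u by force
    then show ?thesis using orthogonal_if_meet v u \<open>v \<noteq> u\<close> by blast
  qed
  then have "(\<Sum>u\<in>?Z. lorentz v u *\<^sub>R u) = (\<Sum>u\<in>{w}. lorentz v u *\<^sub>R u)"
    using fin w x(2) by (intro sum.mono_neutral_right) auto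
  then have v_eq: "v = lorentz v w *\<^sub>R w - lorentz x v *\<^sub>R x" using x(5) by simp
  have "lorentz v v = lorentz v w * lorentz v w - lorentz x v * lorentz v x"
    by (subst (2) v_eq) (simp add: lorentz_simps)
  then have "(lorentz v w)\<^sup>2 = 1 + (lorentz x v)\<^sup>2"
    using unit[OF v] by (simp add: power2_eq_square lorentz_commute[of v x])
  then have "1\<^sup>2 \<le> (- lorentz v w)\<^sup>2" by simp
  then have "1 \<le> - lorentz v w"
    by (rule power2_le_imp_le) (use disjoint_facets_neg[OF v w disj] in simp)
  then show ?thesis by simp
qed

end

sublocale compact_polyhedron \<subseteq> right_angled N
  by unfold_locales (use unit gram_matrix in blast)+

section \<open>Facets of convex polyhedra\<close>

text \<open>The Euclidean vector representing the functional \<open>lorentz _ v\<close>, through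
  which dimension counts for Euclidean orthogonal complements apply.\<close>

definition lorentz_dual :: "(real^'m::finite) \<times> real \<Rightarrow> (real^'m) \<times> real" where
  "lorentz_dual v = (fst v, - snd v)"

lemma lorentz_dual_inner: "lorentz_dual v \<bullet> x = lorentz x v"
  by (simp add: lorentz_dual_def lorentz_def inner_prod_def inner_commute)

lemma dim_lorentz_orthogonal:
  fixes v :: "(real^'m::finite) \<times> real"
  assumes "v \<noteq> 0"
  shows "dim {x. lorentz x v = 0} = CARD('m)"
proof -
  have "lorentz_dual v \<noteq> 0" using assms by (auto simp: lorentz_dual_def prod_eq_iff)
  then show ?thesis using dim_hyperplane[of "lorentz_dual v"] by (simp add: lorentz_dual_inner)
qed

lemma dim_lorentz_orthogonal2:
  fixes v w :: "(real^'m::finite) \<times> real"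
  assumes "v \<noteq> 0" and "\<And>c. w \<noteq> c *\<^sub>R v"
  shows "dim {x. lorentz x v = 0 \<and> lorentz x w = 0} = CARD('m) - 1"
proof -
  let ?A = "span {lorentz_dual w, lorentz_dual v}"
  have v: "lorentz_dual v \<noteq> 0" using assms(1) by (auto simp: lorentz_dual_def prod_eq_iff)
  have w: "lorentz_dual w \<notin> span {lorentz_dual v}"
  proof
    assume "lorentz_dual w \<in> span {lorentz_dual v}"
    then obtain c where "lorentz_dual w = c *\<^sub>R lorentz_dual v" by (auto simp: span_singleton)
    then have "w = c *\<^sub>R v" by (auto simp: lorentz_dual_def prod_eq_iff)
    then show False using assms(2) by blast
  qed
  have "independent {lorentz_dual w, lorentz_dual v}"
    using v w by (intro independent_insertI) (simp_all add: independent_empty)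
  moreover have "lorentz_dual w \<noteq> lorentz_dual v"
    using w span_base[of "lorentz_dual v" "{lorentz_dual v}"] by auto
  ultimately have "dim ?A = 2" using dim_span_eq_card_independent by fastforce
  have "{x. lorentz x v = 0 \<and> lorentz x w = 0} = {y \<in> UNIV. \<forall>x\<in>?A. orthogonal x y}"
  proof (intro Set.set_eqI iffI)
    fix y assume "y \<in> {x. lorentz x v = 0 \<and> lorentz x w = 0}"
    then have "orthogonal y x" if "x \<in> {lorentz_dual w, lorentz_dual v}" for x
      using that by (auto simp: orthogonal_def inner_commute[of y] lorentz_dual_inner)
    then have "orthogonal y x" if "x \<in> ?A" for x using orthogonal_to_span that by blast
    then show "y \<in> {y \<in> UNIV. \<forall>x\<in>?A. orthogonal x y}" by (simp add: orthogonal_commute)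
  next
    fix y assume "y \<in> {y \<in> UNIV. \<forall>x\<in>?A. orthogonal x y}"
    then have "orthogonal (lorentz_dual w) y" "orthogonal (lorentz_dual v) y"
      by (auto simp: span_base)
    then show "y \<in> {x. lorentz x v = 0 \<and> lorentz x w = 0}"
      by (simp add: orthogonal_def lorentz_dual_inner)
  qed
  then have "dim {x. lorentz x v = 0 \<and> lorentz x w = 0} + dim ?A = dim (UNIV :: ((real^'m) \<times> real) set)"
    using dim_subspace_orthogonal_to_vectors[of ?A UNIV] by simp
  then show ?thesis using \<open>dim ?A = 2\<close> by simp
qed

text \<open>At \<open>z\<close> all inequalities outside \<open>A\<close> are strict, so for every
  \<open>t\<close> in the linear space a multiple of some \<open>z + e *\<^sub>R t\<close> lies in
  the face, and \<open>t\<close> is a combination of this point and \<open>z\<close>.\<close>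

lemma dim_face:
  fixes N :: "((real^'m::finite) \<times> real) set"
  assumes fin: "finite N" and z: "z \<in> hyperbolic_space" "\<And>u. u \<in> N \<Longrightarrow> lorentz z u \<le> 0"
    and A: "A = {u \<in> N. lorentz z u = 0}"
  shows "dim {x \<in> hyperbolic_space. (\<forall>v\<in>N. lorentz x v \<le> 0) \<and> (\<forall>v\<in>A. lorentz x v = 0)} =
    dim {x. \<forall>v\<in>A. lorentz x v = 0}" (is "dim ?F = dim ?S")
proof (rule antisym)
  show "dim ?F \<le> dim ?S" by (rule dim_subset) auto
  have zF: "z \<in> ?F" using z A by auto
  have "?S \<subseteq> span ?F"
  proof
    fix t assume t: "t \<in> ?S"
    have "finite (N - A)" "\<And>u. u \<in> N - A \<Longrightarrow> lorentz z u < 0" using fin z A by (auto simp: less_le)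
    from hyperbolic_perturbation[OF z(1) this, of t] obtain e where e: "e > 0"
      "\<forall>d. 0 < d \<and> d \<le> e \<longrightarrow> (\<forall>u\<in>N - A. lorentz (z + d *\<^sub>R t) u < 0) \<and>
        (\<exists>c>0. c *\<^sub>R (z + d *\<^sub>R t) \<in> hyperbolic_space)" by blast
    then have neg: "\<forall>u\<in>N - A. lorentz (z + e *\<^sub>R t) u < 0"
      and "\<exists>c>0. c *\<^sub>R (z + e *\<^sub>R t) \<in> hyperbolic_space" using e(2)[rule_format, of e] by simp_all
    then obtain c where c: "c > 0" "c *\<^sub>R (z + e *\<^sub>R t) \<in> hyperbolic_space" by blast
    let ?z = "c *\<^sub>R (z + e *\<^sub>R t)"
    have zero: "lorentz ?z u = 0" if u: "u \<in> A" for u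
    proof -
      have "lorentz z u = 0" using u unfolding A by simp
      moreover have "lorentz t u = 0" using t u by blast
      ultimately show ?thesis by (simp add: lorentz_simps)
    qed
    have "lorentz ?z u \<le> 0" if "u \<in> N" for u
    proof (cases "u \<in> A")
      case False
      then have "lorentz (z + e *\<^sub>R t) u < 0" using neg that by blast
      then show ?thesis using c(1) by (simp add: lorentz_simps(7) mult_nonneg_nonpos)
    qed (simp add: zero)
    then have "?z \<in> span ?F" using c zero by (intro span_base) blast
    then have "(1 / e) *\<^sub>R ((1 / c) *\<^sub>R ?z - z) \<in> span ?F"
      using span_base[OF zF] by (blast intro: span_scale span_diff)
    moreover have "(1 / e) *\<^sub>R ((1 / c) *\<^sub>R ?z - z) = t" using c(1) e(1) by simp
    ultimately show "t \<in> span ?F" by simp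
  qed
  then show "dim ?S \<le> dim ?F" using dim_subset[of ?S "span ?F"] by simp
qed

lemma sum_neg:
  fixes f :: "'b \<Rightarrow> real"
  assumes "finite B" "B \<noteq> {}" "\<And>b. b \<in> B \<Longrightarrow> f b < 0"
  shows "sum f B < 0"
  using sum_pos[of B "\<lambda>b. - f b"] assms by (simp add: sum_negf)

lemma sum_nonpos_zeroD:
  fixes f :: "'b \<Rightarrow> real"
  assumes "finite B" "\<And>b. b \<in> B \<Longrightarrow> f b \<le> 0" "sum f B = 0"
  shows "\<forall>b\<in>B. f b = 0"
  using sum_nonneg_eq_0_iff[of B "\<lambda>b. - f b"] assms by (simp add: sum_negf)

lemma hyperbolic_sum:
  assumes B: "finite B" "B \<noteq> {}" "B \<subseteq> hyperbolic_space"
  obtains c where "c > 0" "c *\<^sub>R (\<Sum>b\<in>B. b) \<in> hyperbolic_space"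
proof -
  obtain b0 where b0: "b0 \<in> B" using B by blast
  have neg: "lorentz (\<Sum>b\<in>B. b) x < 0" if "x \<in> hyperbolic_space" for x
    unfolding lorentz.sum_left using B hyperbolic_lorentz_neg[OF _ that] by (intro sum_neg) blast+
  have "lorentz (\<Sum>b\<in>B. b) (\<Sum>b\<in>B. b) < 0"
    unfolding lorentz.sum_right[of "\<Sum>b\<in>B. b"] using B neg by (intro sum_neg) blast+
  then show ?thesis using normalize_hyperbolic[of b0 "\<Sum>b\<in>B. b"] neg B b0 that by blast
qed

lemma hyperplane_subset_imp:
  fixes v w :: "(real^'m::finite) \<times> real"
  assumes v: "lorentz v v = 1" and sub: "\<And>x. lorentz x v = 0 \<Longrightarrow> lorentz x w = 0"
  shows "w = lorentz w v *\<^sub>R v"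
proof -
  define t where "t = w - lorentz w v *\<^sub>R v"
  have "lorentz z t = 0" for z
  proof -
    define z' where "z' = z - lorentz z v *\<^sub>R v"
    have "lorentz z' v = 0" using v by (simp add: z'_def lorentz_simps)
    then have "lorentz z' t = 0" using sub by (simp add: t_def lorentz_simps)
    moreover have "lorentz v t = 0" using v by (simp add: t_def lorentz_simps lorentz_commute[of v w])
    ultimately show ?thesis by (simp add: z'_def lorentz_simps)
  qed
  then have "t = 0" by (rule lorentz_nondegenerate)
  then show ?thesis by (simp add: t_def)
qed

text \<open>A defining set of least cardinality is irredundant. The centre \<open>o'\<close> is the
  normalized sum of a basis contained in \<open>P\<close>; no normal can vanish on the whole basis,
  so \<open>o'\<close> is an interior point.\<close>

lemma minimal_facets:
  fixes P :: "((real^'m::finite) \<times> real) set"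
  assumes "convex_polyhedron P"
  obtains N o' where "finite N" "\<And>v. v \<in> N \<Longrightarrow> lorentz v v = 1"
    "P = {x \<in> hyperbolic_space. \<forall>v\<in>N. lorentz x v \<le> 0}" "o' \<in> hyperbolic_space"
    "\<And>v. v \<in> N \<Longrightarrow> lorentz o' v < 0"
    "\<And>v. v \<in> N \<Longrightarrow> \<exists>y\<in>P. lorentz y v = 0 \<and> (\<forall>w\<in>N - {v}. lorentz y w < 0)"
proof -
  define D where "D = (\<lambda>V::((real^'m) \<times> real) set. {x \<in> hyperbolic_space. \<forall>v\<in>V. lorentz x v \<le> 0})"
  obtain V where V: "finite V" "\<forall>v\<in>V. lorentz v v = 1"
    "P = hyperbolic_space \<inter> (\<Inter>v\<in>V. half_space v)" and dimP: "dim P = CARD('m) + 1"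
    using assms unfolding convex_polyhedron_def by (elim conjE exE)
  have PV: "P = D V" by (auto simp: V(3) D_def half_space_def)
  have "V \<subseteq> V \<and> D V = P" by (simp only: PV order_refl)
  from ex_has_least_nat[of "\<lambda>N. N \<subseteq> V \<and> D N = P", OF this, of card]
  obtain N where Nmin: "(N \<subseteq> V \<and> D N = P) \<and> (\<forall>N'. N' \<subseteq> V \<and> D N' = P \<longrightarrow> card N \<le> card N')"
    by (rule exE)
  have N: "N \<subseteq> V" "D N = P"
    by (rule conjunct1[OF conjunct1[OF Nmin]], rule conjunct2[OF conjunct1[OF Nmin]])
  have min: "card N \<le> card N'" if N': "N' \<subseteq> V" "D N' = P" for N'
    using conjunct2[OF Nmin, rule_format, OF conjI[OF N']] .
  have finN: "finite N" using N(1) V(1) finite_subset by blast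
  have unit: "lorentz v v = 1" if v: "v \<in> N" for v using v N(1) V(2) by blast
  obtain B where B: "B \<subseteq> P" "independent B" "P \<subseteq> span B"
    using maximal_independent_subset[of P] by blast
  have spanB: "span B = UNIV"
  proof -
    have "dim P \<le> dim B" using B(3) dim_subset[of P "span B"] by simp
    then have "dim B = DIM((real^'m) \<times> real)"
      using dimP dim_subset_UNIV[of B] by simp
    then show ?thesis using dim_eq_full by blast
  qed
  have finB: "finite B" using B(2) independent_imp_finite by blast
  have "B \<noteq> {}"
  proof
    assume "B = {}"
    then have "dim P \<le> dim ({0} :: ((real^'m) \<times> real) set)"
      using B(3) by (intro dim_subset) simp
    then show False using dimP by simp
  qed
  moreover have BH: "B \<subseteq> hyperbolic_space" using B PV by (auto simp: D_def)
  ultimately obtain c where c: "c > 0" "c *\<^sub>R (\<Sum>b\<in>B. b) \<in> hyperbolic_space"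
    using hyperbolic_sum finB by blast
  define o' where "o' = c *\<^sub>R (\<Sum>b\<in>B. b)"
  have Ble: "lorentz b v \<le> 0" if "b \<in> B" "v \<in> N" for b v
    using that B(1) N by (auto simp: D_def)
  have o_neg: "lorentz o' v < 0" if v: "v \<in> N" for v
  proof -
    have "lorentz o' v \<le> 0"
      using c(1) Ble[OF _ v] by (simp add: o'_def lorentz_simps lorentz.sum_left mult_nonneg_nonpos sum_nonpos)
    moreover have "lorentz o' v \<noteq> 0"
    proof
      assume "lorentz o' v = 0"
      then have "(\<Sum>b\<in>B. lorentz b v) = 0"
        using c(1) by (simp add: o'_def lorentz_simps lorentz.sum_left)
      then have "\<forall>b\<in>B. lorentz b v = 0" using Ble[OF _ v] finB by (intro sum_nonpos_zeroD)
      then have "B \<subseteq> {x. lorentz x v = 0}" by blast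
      moreover have "subspace {x. lorentz x v = 0}" by (simp add: subspace_def lorentz_simps)
      ultimately have "span B \<subseteq> {x. lorentz x v = 0}" by (rule span_minimal)
      then have "lorentz v v = 0" using spanB by blast
      then show False using unit v by simp
    qed
    ultimately show ?thesis by simp
  qed
  have oH: "o' \<in> hyperbolic_space" using c by (simp add: o'_def)
  have facet: "\<exists>y\<in>P. lorentz y v = 0 \<and> (\<forall>w\<in>N - {v}. lorentz y w < 0)" if v: "v \<in> N" for v
  proof -
    have "card (N - {v}) < card N" using v finN by (intro card_Diff1_less)
    then have "D (N - {v}) \<noteq> P" using min[of "N - {v}"] N by auto
    moreover have "P \<subseteq> D (N - {v})" using N by (auto simp: D_def)
    ultimately obtain z where "z \<in> D (N - {v})" "z \<notin> D N" using N by blast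
    then have z: "z \<in> hyperbolic_space" "\<forall>w\<in>N - {v}. lorentz z w \<le> 0"
      and "\<exists>w\<in>N. \<not> lorentz z w \<le> 0" unfolding D_def by blast+
    then have "\<not> lorentz z v \<le> 0" by blast
    then have "lorentz z v > 0" by simp
    note z = z this
    define a b where "a = lorentz z v" and "b = - lorentz o' v"
    have ab: "a > 0" "b > 0" using z(3) o_neg[OF v] by (simp_all add: a_def b_def)
    define y where "y = a *\<^sub>R o' + b *\<^sub>R z"
    have oz: "lorentz z o' < 0" using hyperbolic_lorentz_neg z oH by blast
    have "lorentz y o' = - a + b * lorentz z o'"
      using hyperbolic_spaceD(1)[OF oH] by (simp add: y_def lorentz_simps)
    also have "\<dots> < 0" using ab mult_pos_neg[OF ab(2) oz] by linarith
    finally have yo: "lorentz y o' < 0" .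
    have "lorentz y z = a * lorentz z o' - b"
      using hyperbolic_spaceD(1)[OF z(1)] by (simp add: y_def lorentz_simps lorentz_commute[of o' z])
    also have "\<dots> < 0" using ab mult_pos_neg[OF ab(1) oz] by linarith
    finally have yz: "lorentz y z < 0" .
    have "lorentz y y = a * lorentz y o' + b * lorentz y z"
      by (subst (2) y_def) (simp add: lorentz_simps)
    also have "\<dots> < 0" using mult_pos_neg[OF ab(1) yo] mult_pos_neg[OF ab(2) yz] by linarith
    finally obtain c where c: "c > 0" "c *\<^sub>R y \<in> hyperbolic_space"
      using normalize_hyperbolic[OF oH _ yo] by blast
    have yv: "lorentz y v = 0" by (simp add: y_def lorentz_simps a_def b_def)
    have yw: "lorentz y w < 0" if "w \<in> N - {v}" for w
    proof -
      have "lorentz z w \<le> 0" "lorentz o' w < 0" using z(2) o_neg that by auto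
      then have "a * lorentz o' w < 0" "b * lorentz z w \<le> 0"
        using ab by (auto simp: mult_pos_neg mult_nonneg_nonpos)
      then show ?thesis by (simp add: y_def lorentz_simps)
    qed
    have cyw: "lorentz (c *\<^sub>R y) w < 0" if "w \<in> N - {v}" for w
      using yw[OF that] c by (simp add: lorentz_simps mult_pos_neg)
    have cyv: "lorentz (c *\<^sub>R y) v = 0" using yv by (simp add: lorentz_simps)
    have "lorentz (c *\<^sub>R y) w \<le> 0" if "w \<in> N" for w
      using cyw[of w] cyv that by (cases "w = v") auto
    then have "c *\<^sub>R y \<in> P" unfolding N(2)[symmetric] D_def using c by blast
    then show ?thesis using cyw cyv by blast
  qed
  have P_eq: "P = {x \<in> hyperbolic_space. \<forall>v\<in>N. lorentz x v \<le> 0}" using N(2) by (simp add: D_def)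
  show ?thesis by (rule that[OF finN unit P_eq oH o_neg facet])
qed

lemma all_right_polyhedron_facets:
  fixes P :: "((real^'m::finite) \<times> real) set"
  assumes arp: "all_right_polyhedron P" and cpt: "compact P" and m: "CARD('m) \<ge> 2"
  obtains o' where "compact_polyhedron P {v. facet_normal P v} o'"
proof -
  have cp: "convex_polyhedron P" using arp by (simp add: all_right_polyhedron_def)
  obtain N o' where N: "finite N" "\<And>v. v \<in> N \<Longrightarrow> lorentz v v = 1"
    "P = {x \<in> hyperbolic_space. \<forall>v\<in>N. lorentz x v \<le> 0}" and o: "o' \<in> hyperbolic_space"
    "\<And>v. v \<in> N \<Longrightarrow> lorentz o' v < 0"
    and facet: "\<And>v. v \<in> N \<Longrightarrow> \<exists>y\<in>P. lorentz y v = 0 \<and> (\<forall>w\<in>N - {v}. lorentz y w < 0)"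
    by (rule minimal_facets[OF cp]) (assumption | rule that)+
  have oP: "o' \<in> P" using o N(3) by (auto intro: less_imp_le)
  have PH: "x \<in> hyperbolic_space" if "x \<in> P" for x using that N(3) by blast
  have Ple: "lorentz x v \<le> 0" if "x \<in> P" "v \<in> N" for x v using that N(3) by blast
  have sub: "P \<subseteq> half_space v" if "v \<in> N" for v
    unfolding half_space_def using PH Ple[OF _ that] by blast
  have nz: "v \<noteq> 0" if "v \<in> N" for v using N(2)[OF that] by (auto simp: lorentz_simps)
  have face: "dim {x \<in> P. \<forall>v\<in>A. lorentz x v = 0} = dim {x. \<forall>v\<in>A. lorentz x v = 0}"
    if "z \<in> P" "A = {u \<in> N. lorentz z u = 0}" for z A
  proof -
    have "{x \<in> P. \<forall>v\<in>A. lorentz x v = 0} =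
        {x \<in> hyperbolic_space. (\<forall>v\<in>N. lorentz x v \<le> 0) \<and> (\<forall>v\<in>A. lorentz x v = 0)}"
      by (subst N(3)) blast
    then show ?thesis using dim_face[OF N(1) PH[OF that(1)] Ple[OF that(1)] that(2)] by simp
  qed
  have normal1: "facet_normal P v" if v: "v \<in> N" for v
  proof -
    obtain y where y: "y \<in> P" "lorentz y v = 0" "\<forall>w\<in>N - {v}. lorentz y w < 0" using facet[OF v] by blast
    then have "u = v" if "u \<in> N" "lorentz y u = 0" for u
      using that by (metis DiffI empty_iff insert_iff less_irrefl)
    then have "{v} = {u \<in> N. lorentz y u = 0}" using v y(2) by blast
    from face[OF y(1) this] have "dim {x \<in> P. lorentz x v = 0} = CARD('m)"
      using dim_lorentz_orthogonal[OF nz[OF v]] by simp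
    moreover have "P \<inter> hyperplane v = {x \<in> P. lorentz x v = 0}"
      unfolding hyperplane_def using PH by blast
    ultimately show ?thesis using N(2)[OF v] sub[OF v] by (simp add: facet_normal_def)
  qed
  \<comment> \<open>The normalized sum \<open>y\<close> of a basis of the facet is a relatively
    interior point of it. If a wall of \<open>N\<close> contains \<open>y\<close>, it contains the
    basis, so its normal is \<open>v\<close> up to a sign fixed by \<open>o'\<close>.\<close>
  have normal2: "v \<in> N" if v: "facet_normal P v" for v
  proof -
    have vv: "lorentz v v = 1" and Pv: "P \<subseteq> half_space v" and dimv: "dim (P \<inter> hyperplane v) = CARD('m)"
      using v by (auto simp: facet_normal_def)
    obtain B where B: "B \<subseteq> P \<inter> hyperplane v" "independent B" "P \<inter> hyperplane v \<subseteq> span B"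
      using maximal_independent_subset[of "P \<inter> hyperplane v"] by blast
    have finB: "finite B" using B(2) independent_imp_finite by blast
    have dimB: "dim (span B) \<ge> CARD('m)" using dim_subset[OF B(3)] dimv by simp
    then have "B \<noteq> {}" by auto
    moreover have BP: "B \<subseteq> P" "\<And>b. b \<in> B \<Longrightarrow> lorentz b v = 0" using B(1) by (auto simp: hyperplane_def)
    moreover have "B \<subseteq> hyperbolic_space" using BP PH by blast
    ultimately obtain c where c: "c > 0" "c *\<^sub>R (\<Sum>b\<in>B. b) \<in> hyperbolic_space"
      using hyperbolic_sum finB by blast
    define y where "y = c *\<^sub>R (\<Sum>b\<in>B. b)"
    have yu: "lorentz y u = c * (\<Sum>b\<in>B. lorentz b u)" for u
      by (simp add: y_def lorentz_simps lorentz.sum_left)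
    have yv: "lorentz y v = 0" using BP by (simp add: yu)
    have yle: "lorentz y u \<le> 0" if "u \<in> N" for u
      unfolding yu using c(1) Ple[OF subsetD[OF BP(1)] that] by (simp add: mult_nonneg_nonpos sum_nonpos)
    have yH: "y \<in> hyperbolic_space" using c by (simp add: y_def)
    have sspv: "subspace {x. lorentz x u = 0}" for u :: "(real^'m) \<times> real"
      by (simp add: subspace_def lorentz_simps)
    have vnz: "v \<noteq> 0" using vv by (auto simp: lorentz_simps)
    have spanB: "span B = {x. lorentz x v = 0}"
    proof (rule subspace_dim_equal)
      show "span B \<subseteq> {x. lorentz x v = 0}" using BP(2) sspv by (intro span_minimal) auto
      show "dim {x. lorentz x v = 0} \<le> dim (span B)" using dimB dim_lorentz_orthogonal[OF vnz] by simp
    qed (simp_all add: sspv)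
    show ?thesis
    proof (cases "\<exists>w\<in>N. lorentz y w = 0")
      case True
      then obtain w where w: "w \<in> N" "lorentz y w = 0" by blast
      then have "(\<Sum>b\<in>B. lorentz b w) = 0" using c(1) yu by simp
      then have "\<forall>b\<in>B. lorentz b w = 0"
        using Ple[OF subsetD[OF BP(1)] w(1)] finB by (intro sum_nonpos_zeroD)
      then have "span B \<subseteq> {x. lorentz x w = 0}" using sspv by (intro span_minimal) auto
      then have w_eq: "w = lorentz w v *\<^sub>R v"
        using spanB by (intro hyperplane_subset_imp[OF vv]) blast
      have "lorentz w w = lorentz w v * lorentz w v"
        by (subst (2) w_eq) (simp add: lorentz_simps)
      then have "(lorentz w v)\<^sup>2 = 1" using N(2)[OF w(1)] by (simp add: power2_eq_square)
      then have cases: "lorentz w v = 1 \<or> lorentz w v = -1" by (simp add: power2_eq_1_iff)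
      have "lorentz o' w = lorentz w v * lorentz o' v"
        by (subst (1) w_eq) (simp add: lorentz_simps)
      moreover have "lorentz o' w < 0" "lorentz o' v \<le> 0" using o(2)[OF w(1)] oP Pv by (auto simp: half_space_def)
      ultimately have "lorentz w v = 1" using cases by auto
      then have "w = v" by (subst w_eq) simp
      then show ?thesis using w(1) by simp
    next
      case False
      then have neg: "\<And>u. u \<in> N \<Longrightarrow> lorentz y u < 0" using yle by (metis less_le)
      \<comment> \<open>Otherwise \<open>y\<close> is interior to \<open>P\<close> and can be pushed
        in the direction \<open>v\<close> across the wall, out of a half-space containing
        \<open>P\<close>.\<close>
      from hyperbolic_perturbation[OF yH N(1) neg, of v] obtain e where e: "e > 0"
        "\<forall>d. 0 < d \<and> d \<le> e \<longrightarrow> (\<forall>u\<in>N. lorentz (y + d *\<^sub>R v) u < 0) \<and>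
          (\<exists>c>0. c *\<^sub>R (y + d *\<^sub>R v) \<in> hyperbolic_space)" by blast
      then have neg: "\<forall>u\<in>N. lorentz (y + e *\<^sub>R v) u < 0"
        and "\<exists>c>0. c *\<^sub>R (y + e *\<^sub>R v) \<in> hyperbolic_space" using e(2)[rule_format, of e] by simp_all
      then obtain c where c: "c > 0" "c *\<^sub>R (y + e *\<^sub>R v) \<in> hyperbolic_space" by blast
      have "lorentz (c *\<^sub>R (y + e *\<^sub>R v)) u \<le> 0" if "u \<in> N" for u
        using neg that c(1) by (simp add: lorentz_simps(7) mult_nonneg_nonpos less_imp_le)
      then have "c *\<^sub>R (y + e *\<^sub>R v) \<in> P" using c(2) by (subst N(3)) blast
      then have "lorentz (c *\<^sub>R (y + e *\<^sub>R v)) v \<le> 0" using Pv by (auto simp: half_space_def)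
      then have "c * e \<le> 0" using yv vv by (simp add: lorentz_simps)
      then show ?thesis using mult_pos_pos[OF c(1) e(1)] by linarith
    qed
  qed
  have N_eq: "{v. facet_normal P v} = N" using normal1 normal2 by blast
  have adj: "lorentz v w = 0" if vw: "v \<in> N" "w \<in> N" "v \<noteq> w" and z: "z \<in> P" "{u \<in> N. lorentz z u = 0} = {v, w}"
    for v w z
  proof -
    have "v \<in> {u \<in> N. lorentz z u = 0}" "w \<in> {u \<in> N. lorentz z u = 0}" unfolding z(2) by simp_all
    then have zv: "lorentz z v = 0" "lorentz z w = 0" by simp_all
    have indep: "w \<noteq> c *\<^sub>R v" for c
    proof
      assume w: "w = c *\<^sub>R v"
      then have "c * c = 1" using N(2)[OF vw(1)] N(2)[OF vw(2)] by (simp add: lorentz_simps)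
      then have "c = 1 \<or> c = -1" by (simp add: square_eq_1_iff)
      then show False using vw(3) w o(2)[OF vw(1)] o(2)[OF vw(2)] by (auto simp: lorentz_simps)
    qed
    have "P \<inter> hyperplane v \<inter> hyperplane w = {x \<in> P. \<forall>u\<in>{v, w}. lorentz x u = 0}"
      unfolding hyperplane_def using PH by blast
    moreover have "{x. \<forall>u\<in>{v, w}. lorentz x u = 0} = {x. lorentz x v = 0 \<and> lorentz x w = 0}" by blast
    ultimately have "dim (P \<inter> hyperplane v \<inter> hyperplane w) = CARD('m) - 1"
      using face[OF z(1) z(2)[symmetric]] dim_lorentz_orthogonal2[OF nz[OF vw(1)] indep] by simp
    then have "adjacent_facets P v w"
      using normal1 vw by (simp add: adjacent_facets_def)
    then have "dihedral_angle v w = pi / 2"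
      using arp unfolding all_right_polyhedron_def by blast
    then have "arccos (lorentz v w) = pi / 2" unfolding dihedral_angle_def by simp
    \<comment> \<open>The definition of \<open>dihedral_angle\<close> says something about
      \<open>lorentz v w\<close> only within the domain of \<open>arccos\<close>; both normals are
      tangent vectors at \<open>z\<close>, so Cauchy-Schwarz applies.\<close>
    moreover have "\<bar>lorentz v w\<bar> \<le> 1"
      using tangent_Cauchy_Schwarz[OF PH[OF z(1)], of v w] zv N(2) vw
      by (simp add: lorentz_commute[of v z] lorentz_commute[of w z])
    ultimately show ?thesis using cos_arccos_abs[of "lorentz v w"] by (metis cos_pi_half)
  qed
  have "compact_polyhedron P N o'"
  proof
    show "finite N" "P = {x \<in> hyperbolic_space. \<forall>v\<in>N. lorentz x v \<le> 0}" by (fact N)+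
  qed (use N(2) o facet adj cpt in blast)+
  then show ?thesis by (intro that[of o']) (simp only: N_eq)
qed

section \<open>Discreteness of the reflection group\<close>

lemma finite_pos_lower_bound:
  fixes f :: "'b \<Rightarrow> real"
  assumes "finite V" "\<And>v. v \<in> V \<Longrightarrow> f v > 0"
  shows "\<exists>\<beta>>0. \<forall>v\<in>V. \<beta> \<le> f v"
  using assms
proof (induction V rule: finite_induct)
  case empty
  then show ?case by (intro exI[of _ 1]) simp
next
  case (insert x V)
  then obtain \<beta> where "\<beta> > 0" "\<forall>v\<in>V. \<beta> \<le> f v" by auto
  then show ?case using insert.prems[of x] by (intro exI[of _ "min \<beta> (f x)"]) auto
qed

lemma closed_hyperbolic_space: "closed (hyperbolic_space :: ((real^'m::finite) \<times> real) set)"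
proof -
  have "x \<in> hyperbolic_space \<longleftrightarrow> lorentz x x = -1 \<and> snd x \<ge> 1" for x :: "(real^'m) \<times> real"
    using hyperbolic_spaceD(5)[of x] by (auto simp: hyperbolic_space_def)
  then have eq: "hyperbolic_space = {x::(real^'m) \<times> real. lorentz x x = -1} \<inter> {x. snd x \<ge> 1}" by blast
  have "closed {x::(real^'m) \<times> real. lorentz x x = -1}"
    by (intro closed_Collect_eq lorentz.continuous_on continuous_intros)
  moreover have "closed {x::(real^'m) \<times> real. snd x \<ge> 1}"
    by (intro closed_Collect_le continuous_intros)
  ultimately show ?thesis unfolding eq by (rule closed_Int)
qed

text \<open>Since \<open>y\<close> is strictly inside the light cone, \<open>- lorentz y x\<close>
  is at least \<open>k\<close> times the time component of \<open>x\<close>, which in turn dominates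
  the spatial part.\<close>

lemma compact_hyperbolic_ball:
  fixes y :: "(real^'m::finite) \<times> real"
  assumes y: "y \<in> hyperbolic_space"
  shows "compact {x \<in> hyperbolic_space. - lorentz y x \<le> c}"
proof -
  define k where "k = snd y - norm (fst y)"
  have k: "k > 0" using hyperbolic_spaceD[OF y] by (simp add: k_def)
  have bound: "norm x \<le> 2 * (c / k)" if x: "x \<in> hyperbolic_space" "- lorentz y x \<le> c" for x
  proof -
    have "fst y \<bullet> fst x \<le> norm (fst y) * norm (fst x)" by (rule norm_cauchy_schwarz)
    also have "\<dots> \<le> norm (fst y) * snd x"
      using hyperbolic_spaceD[OF x(1)] by (intro mult_left_mono) auto
    finally have "k * snd x \<le> c" using x(2) by (simp add: lorentz_def k_def algebra_simps)
    then have "snd x \<le> c / k" using k by (simp add: pos_le_divide_eq mult.commute)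
    moreover have "norm x \<le> norm (fst x) + norm (snd x)"
      using norm_Pair_le[of "fst x" "snd x"] by simp
    ultimately show ?thesis using hyperbolic_spaceD[OF x(1)] by simp
  qed
  have eq: "{x \<in> hyperbolic_space. - lorentz y x \<le> c} = hyperbolic_space \<inter> {x. - lorentz y x \<le> c}"
    by blast
  have "closed {x. - lorentz y x \<le> c}"
    by (intro closed_Collect_le lorentz.continuous_on continuous_intros)
  then have "closed {x \<in> hyperbolic_space. - lorentz y x \<le> c}"
    unfolding eq by (rule closed_Int[OF closed_hyperbolic_space])
  moreover have "bounded {x \<in> hyperbolic_space. - lorentz y x \<le> c}"
    using bound by (intro boundedI) blast
  ultimately show ?thesis by (simp add: compact_eq_bounded_closed)
qed

lemma cosh_arcosh_lorentz:
  assumes "x \<in> hyperbolic_space" "y \<in> hyperbolic_space"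
  shows "cosh (arcosh (- lorentz x y)) = - lorentz x y" "arcosh (- lorentz x y) \<ge> 0"
  using hyperbolic_lorentz_le(1)[OF assms] by simp_all

text \<open>An orbit point closest to \<open>p\<close> lies in the fundamental chamber, since the reflection in a
  violated wall decreases the distance to \<open>p\<close>.\<close>

lemma translate_into_chamber:
  fixes M :: "((real^'m::finite) \<times> real) set"
  assumes unit: "\<And>v. v \<in> M \<Longrightarrow> lorentz v v = 1" and p: "\<And>v. v \<in> M \<Longrightarrow> lorentz p v < 0"
    and fin: "finite {- lorentz p (act ws z) | ws. set ws \<subseteq> M \<and> - lorentz p (act ws z) \<le> - lorentz p z}"
  obtains ws where "set ws \<subseteq> M" "\<And>v. v \<in> M \<Longrightarrow> lorentz (act ws z) v \<le> 0"
proof -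
  let ?S = "{- lorentz p (act ws z) | ws. set ws \<subseteq> M \<and> - lorentz p (act ws z) \<le> - lorentz p z}"
  have "- lorentz p z \<in> ?S" by (rule CollectI, rule exI[of _ "[]"]) simp
  then have ne: "?S \<noteq> {}" by blast
  have "Min ?S \<in> ?S" by (rule Min_in[OF fin ne])
  then obtain ws where ws: "set ws \<subseteq> M" "- lorentz p (act ws z) \<le> - lorentz p z"
    "Min ?S = - lorentz p (act ws z)" by blast
  have "lorentz (act ws z) v \<le> 0" if v: "v \<in> M" for v
  proof (rule ccontr)
    assume pos: "\<not> lorentz (act ws z) v \<le> 0"
    have "lorentz p (act (v # ws) z) = lorentz p (act ws z) - 2 * lorentz (act ws z) v * lorentz p v"
      by (simp add: mrefl_def lorentz_simps)
    moreover have "lorentz (act ws z) v * lorentz p v < 0" using pos p[OF v] by (intro mult_pos_neg) auto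
    ultimately have less: "- lorentz p (act (v # ws) z) < - lorentz p (act ws z)" by linarith
    have "set (v # ws) \<subseteq> M" using v ws by simp
    moreover have "- lorentz p (act (v # ws) z) \<le> - lorentz p z" using less ws(2) by linarith
    ultimately have "- lorentz p (act (v # ws) z) \<in> ?S" by blast
    then have "Min ?S \<le> - lorentz p (act (v # ws) z)" by (rule Min_le[OF fin])
    then show False using less ws(3) by linarith
  qed
  then show ?thesis using that ws(1) by blast
qed

context compact_polyhedron
begin

section \<open>Chamber centres and roots\<close>

definition orbit_pts where "orbit_pts = {act ws o' | ws. set ws \<subseteq> N}"

text \<open>Unit normals of the walls of all chambers. Every wall has two opposite roots, so a root
  amounts to a half-space bounded by a wall.\<close>

definition root where "root r \<longleftrightarrow> (\<exists>ws v. set ws \<subseteq> N \<and> v \<in> N \<and> r = act ws v)"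

lemma unit_word: "set ws \<subseteq> N \<Longrightarrow> \<forall>v\<in>set ws. lorentz v v = 1"
  using unit by blast

lemma act_hyperbolic_N: "set ws \<subseteq> N \<Longrightarrow> x \<in> hyperbolic_space \<Longrightarrow> act ws x \<in> hyperbolic_space"
  by (rule act_hyperbolic[OF unit_word])

lemma orbit_hyperbolic: "y \<in> orbit_pts \<Longrightarrow> y \<in> hyperbolic_space"
  unfolding orbit_pts_def using act_hyperbolic_N[OF _ o] by blast

lemma act_orbit: "y \<in> orbit_pts \<Longrightarrow> set ws \<subseteq> N \<Longrightarrow> act ws y \<in> orbit_pts"
proof -
  assume "y \<in> orbit_pts" "set ws \<subseteq> N"
  then obtain us where "set us \<subseteq> N" "y = act us o'" unfolding orbit_pts_def by blast
  then show ?thesis unfolding orbit_pts_def using \<open>set ws \<subseteq> N\<close>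
    by (intro CollectI exI[of _ "ws @ us"]) simp
qed

lemma center_in_P: "o' \<in> P"
  unfolding P_eq using o o_neg by (auto intro: less_imp_le)

text \<open>\<open>\<beta>\<close> is the least hyperbolic sine of the distance from
  \<open>o'\<close> to a facet hyperplane, so \<open>sqrt (1 + \<beta>\<^sup>2)\<close> is the
  hyperbolic cosine of the radius of a ball about \<open>o'\<close> that crosses none of
  them.\<close>

lemma ball_in_P: "\<exists>\<kappa>>1. \<forall>z\<in>hyperbolic_space. - lorentz o' z \<le> \<kappa> \<longrightarrow> z \<in> P"
proof -
  obtain \<beta> where \<beta>: "\<beta> > 0" "\<forall>v\<in>N. \<beta> \<le> - lorentz o' v"
    using finite_pos_lower_bound[OF fin, of "\<lambda>v. - lorentz o' v"] o_neg by auto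
  have "z \<in> P" if z: "z \<in> hyperbolic_space" "- lorentz o' z \<le> sqrt (1 + \<beta>\<^sup>2)" for z
  proof -
    have "lorentz z v \<le> 0" if v: "v \<in> N" for v
    proof -
      define c B where "c = - lorentz o' z" and "B = - lorentz o' v"
      have c: "1 \<le> c" using hyperbolic_lorentz_le(1)[OF o z(1)] by (simp add: c_def)
      have B: "0 < B" "\<beta> \<le> B" using \<beta> v by (auto simp: B_def)
      have "c\<^sup>2 \<le> (sqrt (1 + \<beta>\<^sup>2))\<^sup>2" using c z(2) by (intro power_mono) (auto simp: c_def)
      also have "\<dots> \<le> 1 + B\<^sup>2" using B \<beta>(1) by (simp add: power_mono)
      finally have cB: "c\<^sup>2 \<le> 1 + B\<^sup>2" .
      have zz: "lorentz (tangent_proj o' z) (tangent_proj o' z) = c\<^sup>2 - 1"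
        using lorentz_tangent_proj[OF o, of z z] hyperbolic_spaceD(1)[OF z(1)]
        by (simp add: c_def power2_eq_square lorentz_commute[of z o'])
      have vv: "lorentz (tangent_proj o' v) (tangent_proj o' v) = 1 + B\<^sup>2"
        using lorentz_tangent_proj[OF o, of v v] unit[OF v]
        by (simp add: B_def power2_eq_square lorentz_commute[of v o'])
      have "lorentz z v = lorentz (tangent_proj o' z) (tangent_proj o' v) - c * B"
        using lorentz_tangent_proj[OF o, of z v]
        by (simp add: B_def c_def lorentz_commute[of v o'] lorentz_commute[of z o'])
      also have "\<dots> \<le> sqrt (c\<^sup>2 - 1) * sqrt (1 + B\<^sup>2) - c * B"
        using tangent_Cauchy_Schwarz[OF o tangent_proj_orth[OF o] tangent_proj_orth[OF o], of z v]
        unfolding zz vv by linarith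
      also have "sqrt (c\<^sup>2 - 1) * sqrt (1 + B\<^sup>2) \<le> c * B"
      proof -
        have "sqrt (c\<^sup>2 - 1) * sqrt (1 + B\<^sup>2) = sqrt ((c\<^sup>2 - 1) * (1 + B\<^sup>2))" by (simp add: real_sqrt_mult)
        also have "\<dots> \<le> sqrt ((c * B)\<^sup>2)"
          using cB by (intro real_sqrt_le_mono) (simp add: power_mult_distrib algebra_simps)
        finally show ?thesis using c B by simp
      qed
      finally show ?thesis by simp
    qed
    then show ?thesis unfolding P_eq using z(1) by blast
  qed
  moreover have "sqrt (1 + \<beta>\<^sup>2) > 1" using \<beta>(1) by simp
  ultimately show ?thesis by blast
qed

lemma orbit_trivial_stabilizer:
  assumes "set ws \<subseteq> N" "act ws o' \<in> P"
  shows "act ws = id"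
  using act_strict_interior[OF assms(1) o_neg] polyhedronD(2)[OF assms(2)] by blast

text \<open>Infinitely many orbit points in a compact ball would accumulate, so two of them would be
  closer than the inradius of \<open>P\<close>. Translating one to \<open>o'\<close> puts the other
  into \<open>P\<close>, and the trivial stabilizer makes them equal.\<close>

lemma finite_orbit_ball0: "finite {y \<in> orbit_pts. - lorentz o' y \<le> c}" (is "finite ?S")
proof (rule ccontr)
  assume inf: "infinite ?S"
  obtain \<kappa> where \<kappa>: "\<kappa> > 1" "\<forall>z\<in>hyperbolic_space. - lorentz o' z \<le> \<kappa> \<longrightarrow> z \<in> P"
    using ball_in_P by blast
  have sep: "y = y'" if y: "y \<in> orbit_pts" "y' \<in> orbit_pts" "- lorentz y y' \<le> \<kappa>" for y y'
  proof -
    obtain ws ws' where ws: "set ws \<subseteq> N" "y = act ws o'" "set ws' \<subseteq> N" "y' = act ws' o'"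
      using y unfolding orbit_pts_def by blast
    have *: "set (rev ws @ ws') \<subseteq> N" using ws by simp
    have "lorentz y y' = lorentz o' (act (rev ws @ ws') o')"
      using lorentz_act_rev[OF unit_word[OF ws(1)], of o' y'] ws by simp
    then have "act (rev ws @ ws') o' \<in> P" using \<kappa>(2) y(3) act_hyperbolic_N[OF * o] by simp
    then have "act (rev ws @ ws') = id" by (rule orbit_trivial_stabilizer[OF *])
    from fun_cong[OF this, of o'] have "act (rev ws) (act ws' o') = o'" by simp
    then show ?thesis using act_rev(2)[OF unit_word[OF ws(1)], of "act ws' o'"] ws by simp
  qed
  have "?S \<subseteq> {x \<in> hyperbolic_space. - lorentz o' x \<le> c}" using orbit_hyperbolic by blast
  then obtain x where x: "x \<in> hyperbolic_space" "x islimpt ?S"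
    using compact_hyperbolic_ball[OF o, of c, unfolded compact_eq_Bolzano_Weierstrass, rule_format, of ?S] inf
    by blast
  have "continuous (at (x, x)) (\<lambda>q. - lorentz (fst q) (snd q))"
    by (intro continuous_intros lorentz.continuous)
  moreover have "- lorentz x x < \<kappa>" using hyperbolic_spaceD(1)[OF x(1)] \<kappa>(1) by simp
  ultimately have "\<forall>\<^sub>F q in at (x, x). - lorentz (fst q) (snd q) < \<kappa>"
    by (intro order_tendstoD(2)[of _ "- lorentz x x"]) (simp_all add: continuous_at)
  then obtain d where d: "d > 0" "\<forall>q. q \<noteq> (x, x) \<and> dist q (x, x) < d \<longrightarrow> - lorentz (fst q) (snd q) < \<kappa>"
    unfolding eventually_at by auto
  have "infinite (?S \<inter> ball x (d / 2))"
    using x(2) d(1) unfolding islimpt_eq_infinite_ball by simp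
  then obtain y where "y \<in> ?S \<inter> ball x (d / 2)" using infinite_imp_nonempty by blast
  moreover have "infinite (?S \<inter> ball x (d / 2) - {y})"
    using \<open>infinite (?S \<inter> ball x (d / 2))\<close> by simp
  then obtain y' where "y' \<in> ?S \<inter> ball x (d / 2) - {y}" using infinite_imp_nonempty by blast
  ultimately have y: "y \<in> ?S \<inter> ball x (d / 2)" "y' \<in> ?S \<inter> ball x (d / 2)" "y \<noteq> y'" by blast+
  have "dist (y, y') (x, x) \<le> dist y x + dist y' x"
    unfolding dist_Pair_Pair by (rule sqrt_sum_squares_le_sum) simp_all
  also have "\<dots> < d" using y by (simp add: dist_commute)
  finally have "dist (y, y') (x, x) < d" .
  moreover have "(y, y') \<noteq> (x, x)" using y(3) by blast
  ultimately have "- lorentz y y' < \<kappa>" using d(2)[rule_format, of "(y, y')"] by simp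
  then show False using sep[of y y'] y by simp
qed

lemma finite_orbit_ball:
  assumes x: "x \<in> hyperbolic_space"
  shows "finite {y \<in> orbit_pts. - lorentz x y \<le> c}"
proof (rule finite_subset[OF _ finite_orbit_ball0])
  let ?a = "arcosh (- lorentz o' x)" and ?b = "arcosh (max 1 c)"
  show "{y \<in> orbit_pts. - lorentz x y \<le> c} \<subseteq> {y \<in> orbit_pts. - lorentz o' y \<le> cosh (?a + ?b)}"
  proof
    fix y assume "y \<in> {y \<in> orbit_pts. - lorentz x y \<le> c}"
    then have y: "y \<in> orbit_pts" "- lorentz x y \<le> c" by simp_all
    have "- lorentz o' y \<le> cosh (?a + ?b)"
      using hyperbolic_cosh_triangle[OF o x orbit_hyperbolic[OF y(1)], of ?a ?b] cosh_arcosh_lorentz[OF o x] y(2)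
      by simp
    then show "y \<in> {y \<in> orbit_pts. - lorentz o' y \<le> cosh (?a + ?b)}" using y(1) by blast
  qed
qed

text \<open>The distances from \<open>o'\<close> to the translates of \<open>z\<close> are those
  from \<open>z\<close> to orbit points, so only finitely many lie below a given bound and a closest
  translate exists.\<close>

lemma translate_into_P:
  assumes z: "z \<in> hyperbolic_space"
  obtains ws where "set ws \<subseteq> N" "act ws z \<in> P"
proof -
  let ?S = "{- lorentz o' (act ws z) | ws. set ws \<subseteq> N \<and> - lorentz o' (act ws z) \<le> - lorentz o' z}"
  have "?S \<subseteq> (\<lambda>y. - lorentz z y) ` {y \<in> orbit_pts. - lorentz z y \<le> - lorentz o' z}"
  proof
    fix s assume "s \<in> ?S"
    then obtain ws where ws: "s = - lorentz o' (act ws z)" "set ws \<subseteq> N" "s \<le> - lorentz o' z" by blast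
    have "lorentz o' (act ws z) = lorentz z (act (rev ws) o')"
      using lorentz_act_rev[OF unit_word[OF ws(2)], of z o'] by (simp add: lorentz_commute[of o'])
    moreover have "act (rev ws) o' \<in> orbit_pts" unfolding orbit_pts_def using ws(2)
      by (intro CollectI exI[of _ "rev ws"]) simp
    ultimately show "s \<in> (\<lambda>y. - lorentz z y) ` {y \<in> orbit_pts. - lorentz z y \<le> - lorentz o' z}"
      using ws by (intro image_eqI[of _ _ "act (rev ws) o'"]) simp_all
  qed
  then have "finite ?S" by (rule finite_subset) (intro finite_imageI finite_orbit_ball z)
  then obtain ws where ws: "set ws \<subseteq> N" "\<And>v. v \<in> N \<Longrightarrow> lorentz (act ws z) v \<le> 0"
    using translate_into_chamber[of N o' z] unit o_neg by blast
  then have "act ws z \<in> P" unfolding P_eq using act_hyperbolic_N[OF ws(1) z] by blast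
  then show ?thesis using that ws(1) by blast
qed

lemma root_unit: "root r \<Longrightarrow> lorentz r r = 1"
  unfolding root_def using lorentz_act[OF unit_word] unit by auto

lemma mrefl_root_word:
  assumes "root r"
  obtains ws where "set ws \<subseteq> N" "mrefl r = act ws"
proof -
  obtain ws v where r: "set ws \<subseteq> N" "v \<in> N" "r = act ws v" using assms unfolding root_def by blast
  have "mrefl r = act (ws @ v # rev ws)"
    by (intro ext) (simp add: r(3) mrefl_conj[OF unit_word[OF r(1)]])
  then show ?thesis using that[of "ws @ v # rev ws"] r by simp
qed

text \<open>A product of absolute value less than 1 means that the walls cross. Translating a
  crossing point into \<open>P\<close> turns both roots, up to sign, into facet normals at a common
  point, and these are equal or orthogonal.\<close>

lemma roots_gram:
  assumes r: "root r" and s: "root s"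
  shows "lorentz r s = 0 \<or> \<bar>lorentz r s\<bar> \<ge> 1"
proof (rule ccontr)
  define c where "c = lorentz r s"
  assume "\<not> ?thesis"
  then have c: "c \<noteq> 0" "\<bar>c\<bar> < 1" by (auto simp: c_def)
  then have c2: "c\<^sup>2 < 1" by (simp add: abs_square_less_1)
  have rr: "lorentz r r = 1" "lorentz s s = 1" "lorentz s r = c"
    using root_unit r s by (auto simp: c_def lorentz_commute[of s r])
  define p q where "p = lorentz o' r" and "q = lorentz o' s"
  \<comment> \<open>The coefficients solve the 2 by 2 Gram system, so \<open>z\<close> is the
    orthogonal projection of \<open>o'\<close> onto the intersection of both walls; it is timelike
    because the removed part has nonnegative square.\<close>
  define a b where "a = (p - c * q) / (1 - c\<^sup>2)" and "b = (q - c * p) / (1 - c\<^sup>2)"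
  define z where "z = o' - a *\<^sub>R r - b *\<^sub>R s"
  have ab: "a + c * b = p" "c * a + b = q"
    using c2 by (simp_all add: a_def b_def divide_simps) (simp_all add: power2_eq_square algebra_simps)
  have "lorentz z r = p - (a + c * b)" "lorentz z s = q - (c * a + b)"
    using rr by (simp_all add: z_def lorentz_simps p_def q_def c_def[symmetric])
  then have zr: "lorentz z r = 0" "lorentz z s = 0" by (simp_all only: ab)
  have zo: "lorentz z o' = -1 - (a * p + b * q)"
    using hyperbolic_spaceD(1)[OF o]
    by (simp add: z_def lorentz_simps p_def q_def lorentz_commute[of r o'] lorentz_commute[of s o'])
  have zz: "lorentz z z = lorentz z o'"
  proof -
    have "lorentz z z = lorentz z (o' - a *\<^sub>R r - b *\<^sub>R s)" by (simp only: z_def[symmetric])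
    then show ?thesis using zr by (simp only: lorentz_simps) simp
  qed
  have "a * p + b * q = a\<^sup>2 + b\<^sup>2 + 2 * c * a * b"
    unfolding ab[symmetric] by (simp add: power2_eq_square algebra_simps)
  also have "\<dots> = (a + c * b)\<^sup>2 + (1 - c\<^sup>2) * b\<^sup>2" by (simp add: power2_eq_square algebra_simps)
  also have "\<dots> \<ge> 0" using c2 by simp
  finally have neg: "lorentz z o' < 0" using zo by linarith
  then have "lorentz z z < 0" unfolding zz .
  then obtain k where k: "k > 0" "k *\<^sub>R z \<in> hyperbolic_space"
    using neg by (rule normalize_hyperbolic[OF o])
  obtain ws where ws: "set ws \<subseteq> N" "act ws (k *\<^sub>R z) \<in> P" using translate_into_P[OF k(2)] by blast
  let ?z = "act ws (k *\<^sub>R z)"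
  have in_N: "act ws r \<in> N \<or> - act ws r \<in> N" if r: "root r" "lorentz z r = 0" for r
  proof -
    obtain us v where us: "set us \<subseteq> N" "v \<in> N" "r = act us v" using r(1) unfolding root_def by blast
    have "lorentz ?z (act ws r) = 0"
      using lorentz_act[OF unit_word[OF ws(1)]] r(2) by (simp add: lorentz_simps)
    then show ?thesis
      using root_through_chamber[OF o_neg polyhedronD(1)[OF ws(2)] polyhedronD(2)[OF ws(2)], of "ws @ us" v "act ws r"] us ws(1)
      by simp
  qed
  have zero: "lorentz ?z (act ws r) = 0" "lorentz ?z (act ws s) = 0"
    using lorentz_act[OF unit_word[OF ws(1)]] zr by (simp_all add: lorentz_simps)
  have c_eq: "lorentz (act ws r) (act ws s) = c"
    using lorentz_act[OF unit_word[OF ws(1)]] by (simp add: c_def)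
  have bad: False if v: "v \<in> N" "w \<in> N" "lorentz ?z v = 0" "lorentz ?z w = 0" "\<bar>lorentz v w\<bar> = \<bar>c\<bar>" for v w
  proof (cases "v = w")
    case True
    then show False using unit v c(2) by simp
  next
    case False
    then show False using orthogonal_at_point[OF o_neg polyhedronD(1)[OF ws(2)] v(1,3) v(2,4)] v(5) c(1) by simp
  qed
  obtain v where v: "v \<in> N" "v = act ws r \<or> v = - act ws r" using in_N[OF r zr(1)] by blast
  obtain w where w: "w \<in> N" "w = act ws s \<or> w = - act ws s" using in_N[OF s zr(2)] by blast
  have "lorentz ?z v = 0" "lorentz ?z w = 0" "\<bar>lorentz v w\<bar> = \<bar>c\<bar>"
    subgoal using v(2) zero(1) by (auto simp: lorentz.minus_right)
    subgoal using w(2) zero(2) by (auto simp: lorentz.minus_right)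
    subgoal using v(2) w(2) c_eq by (auto simp: lorentz.minus_right lorentz.minus_left)
    done
  then show False by (rule bad[OF v(1) w(1)])
qed

text \<open>The mirror image of \<open>y\<close> in the wall is again an orbit point, at bounded
  distance from \<open>y\<close>, and it determines the root because the sign of
  \<open>lorentz y r\<close> is fixed.\<close>

lemma finite_near_roots:
  assumes y: "y \<in> orbit_pts"
  shows "finite {r. root r \<and> lorentz y r < 0 \<and> - c \<le> lorentz y r}" (is "finite ?R")
proof -
  have yH: "y \<in> hyperbolic_space" using y orbit_hyperbolic by blast
  have sub: "(\<lambda>r. mrefl r y) ` ?R \<subseteq> {x \<in> orbit_pts. - lorentz y x \<le> 1 + 2 * c\<^sup>2}"
  proof (rule image_subsetI)
    fix r assume "r \<in> ?R"
    then have r: "root r" "lorentz y r < 0" "- c \<le> lorentz y r" by simp_all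
    obtain ws where "set ws \<subseteq> N" "mrefl r = act ws" using mrefl_root_word[OF r(1)] by blast
    then have "mrefl r y \<in> orbit_pts" using act_orbit y by metis
    moreover have "(- lorentz y r)\<^sup>2 \<le> c\<^sup>2" using r by (intro power_mono) auto
    then have "- lorentz y (mrefl r y) \<le> 1 + 2 * c\<^sup>2"
      using hyperbolic_spaceD(1)[OF yH] by (simp add: mrefl_def lorentz_simps power2_eq_square)
    ultimately show "mrefl r y \<in> {x \<in> orbit_pts. - lorentz y x \<le> 1 + 2 * c\<^sup>2}" by blast
  qed
  have "inj_on (\<lambda>r. mrefl r y) ?R"
  proof (rule inj_onI)
    fix r s assume rs: "r \<in> ?R" "s \<in> ?R" "mrefl r y = mrefl s y"
    define p q where "p = lorentz y r" and "q = lorentz y s"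
    have pq: "p < 0" "q < 0" using rs by (simp_all add: p_def q_def)
    have eq: "p *\<^sub>R r = q *\<^sub>R s"
    proof -
      have "(2 * p) *\<^sub>R r = (2 * q) *\<^sub>R s" using rs(3) by (simp add: mrefl_def p_def q_def)
      then have "(1 / 2) *\<^sub>R ((2 * p) *\<^sub>R r) = (1 / 2) *\<^sub>R ((2 * q) *\<^sub>R s)" by (rule arg_cong)
      then show ?thesis by simp
    qed
    have "lorentz (p *\<^sub>R r) (p *\<^sub>R r) = lorentz (q *\<^sub>R s) (q *\<^sub>R s)" by (simp only: eq)
    then have "p\<^sup>2 = q\<^sup>2"
      using rs root_unit by (simp add: lorentz_simps power2_eq_square)
    then have "p = q" using pq by (simp add: power2_eq_iff)
    then show "r = s" using eq pq by simp
  qed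
  then show ?thesis
    using finite_subset[OF sub finite_orbit_ball[OF yH]] by (rule finite_imageD[rotated])
qed

end

section \<open>Half-spaces containing two chambers\<close>

lemma snd_le_norm: "snd x \<le> norm (x :: 'b::real_normed_vector \<times> real)"
  using norm_snd_le[of "snd x" "fst x"] by simp

context compact_polyhedron
begin

definition hull_roots where
  "hull_roots x0 x1 = {r. root r \<and> lorentz x0 r < 0 \<and> lorentz x1 r < 0}"

text \<open>The outward normals of the minimal half-spaces among those of \<open>hull_roots\<close>.\<close>

definition hull_normals where
  "hull_normals x0 x1 = {r \<in> hull_roots x0 x1. \<forall>s\<in>hull_roots x0 x1.
     (\<forall>z\<in>hyperbolic_space. lorentz z r \<le> lorentz z s) \<longrightarrow> lorentz x0 s \<le> lorentz x0 r}"

lemma hull_normals_roots: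
  assumes "r \<in> hull_normals x0 x1"
  shows "root r" "lorentz x0 r < 0" "lorentz x1 r < 0"
  using assms by (simp_all add: hull_normals_def hull_roots_def)

text \<open>If \<open>lorentz r s \<ge> 1\<close>, then \<open>r - s\<close> is causal, so that the two half-spaces are nested.\<close>

lemma hull_normals_right_angled:
  assumes x0: "x0 \<in> hyperbolic_space"
  shows "right_angled (hull_normals x0 x1)"
proof
  fix r assume "r \<in> hull_normals x0 x1"
  then show "lorentz r r = 1" using hull_normals_roots root_unit by blast
next
  fix r s assume r: "r \<in> hull_normals x0 x1" and s: "s \<in> hull_normals x0 x1" and "r \<noteq> s"
  have bad: "\<not> (\<forall>z\<in>hyperbolic_space. lorentz z (r - s) < 0)"
    if r: "r \<in> hull_normals x0 x1" and s: "s \<in> hull_normals x0 x1" for r s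
  proof
    assume neg: "\<forall>z\<in>hyperbolic_space. lorentz z (r - s) < 0"
    then have "\<forall>z\<in>hyperbolic_space. lorentz z r \<le> lorentz z s"
      by (auto simp: lorentz.diff_right intro: less_imp_le)
    moreover have "s \<in> hull_roots x0 x1" using s by (simp add: hull_normals_def)
    ultimately have "lorentz x0 s \<le> lorentz x0 r" using r by (simp add: hull_normals_def)
    moreover have "lorentz x0 (r - s) < 0" using neg x0 by blast
    ultimately show False by (simp add: lorentz.diff_right)
  qed
  have "\<not> lorentz r s \<ge> 1"
  proof
    assume ge: "lorentz r s \<ge> 1"
    have "lorentz (r - s) (r - s) \<le> 0"
      using ge root_unit[OF hull_normals_roots(1)[OF r]] root_unit[OF hull_normals_roots(1)[OF s]]
      by (simp add: lorentz_simps lorentz_commute[of s r])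
    moreover have "r - s \<noteq> 0" using \<open>r \<noteq> s\<close> by simp
    ultimately consider "\<forall>z\<in>hyperbolic_space. lorentz z (r - s) < 0"
      | "\<forall>z\<in>hyperbolic_space. lorentz z (r - s) > 0" using causal_sign by blast
    then show False
    proof cases
      case 1
      then show ?thesis using bad[OF r s] by blast
    next
      case 2
      then have "\<forall>z\<in>hyperbolic_space. lorentz z (s - r) < 0" by (simp add: lorentz.diff_right)
      then show ?thesis using bad[OF s r] by blast
    qed
  qed
  then show "lorentz r s = 0 \<or> lorentz r s \<le> - 1"
    using roots_gram[OF hull_normals_roots(1)[OF r] hull_normals_roots(1)[OF s]] by linarith
qed

text \<open>Among the roots of the hull whose half-space is contained in that of \<open>r\<close>
  through the pointwise inequality, finitely many compete, and one whose wall is nearest to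
  \<open>x0\<close> is minimal.\<close>

lemma hull_normals_imp:
  assumes x0: "x0 \<in> orbit_pts" and z: "z \<in> hyperbolic_space"
    and le: "\<And>r. r \<in> hull_normals x0 x1 \<Longrightarrow> lorentz z r \<le> 0" and r: "r \<in> hull_roots x0 x1"
  shows "lorentz z r \<le> 0"
proof -
  let ?F = "{s \<in> hull_roots x0 x1. \<forall>z\<in>hyperbolic_space. lorentz z r \<le> lorentz z s}"
  have x0H: "x0 \<in> hyperbolic_space" using orbit_hyperbolic x0 by blast
  have "?F \<subseteq> {s. root s \<and> lorentz x0 s < 0 \<and> - (- lorentz x0 r) \<le> lorentz x0 s}"
    using x0H by (simp add: hull_roots_def) blast
  then have fin: "finite ?F" using finite_near_roots[OF x0] by (rule finite_subset)
  have rF: "r \<in> ?F" using r by simp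
  then have "Max (lorentz x0 ` ?F) \<in> lorentz x0 ` ?F" using fin by (intro Max_in) blast+
  then obtain s where s: "s \<in> ?F" "Max (lorentz x0 ` ?F) = lorentz x0 s" by (elim imageE)
  have max: "lorentz x0 t \<le> lorentz x0 s" if "t \<in> ?F" for t
    unfolding s(2)[symmetric] using fin that by (intro Max_ge) auto
  have sH: "s \<in> hull_roots x0 x1" using s(1) by simp
  have "s \<in> hull_normals x0 x1"
    unfolding hull_normals_def
  proof (intro CollectI conjI ballI impI sH)
    fix t assume t: "t \<in> hull_roots x0 x1" "\<forall>z\<in>hyperbolic_space. lorentz z s \<le> lorentz z t"
    have "\<forall>z\<in>hyperbolic_space. lorentz z r \<le> lorentz z t"
      using s(1) t(2) by (blast intro: order_trans)
    then show "lorentz x0 t \<le> lorentz x0 s" using max t(1) by simp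
  qed
  then have "lorentz z s \<le> 0" by (rule le)
  moreover have "lorentz z r \<le> lorentz z s" using s(1) z by blast
  ultimately show ?thesis by linarith
qed

section \<open>Walls across geodesics\<close>

lemma lightlike_direction:
  "\<exists>\<epsilon>>0. \<forall>u. norm u = 1 \<longrightarrow> (\<exists>v\<in>N. lorentz (u, 1) v \<ge> \<epsilon>)"
proof -
  obtain B where B: "\<forall>x\<in>P. norm x \<le> B" using compact_imp_bounded[OF compact] bounded_iff by blast
  \<comment> \<open>A compact \<open>P\<close> has no ideal points: if no normal were positive on
    \<open>(u, 1)\<close>, the whole geodesic ray from \<open>o'\<close> towards this ideal point
    would stay in \<open>P\<close>.\<close>
  have ex: "\<exists>v\<in>N. lorentz (u, 1) v > 0" if u: "norm u = 1" for u
  proof (rule ccontr)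
    assume "\<not> ?thesis"
    then have le: "lorentz (u, 1) v \<le> 0" if "v \<in> N" for v using that by force
    define \<mu> where "\<mu> = - lorentz o' (u, 1)"
    have "fst o' \<bullet> u \<le> norm (fst o')" using norm_cauchy_schwarz[of "fst o'" u] u by simp
    then have \<mu>: "\<mu> > 0" using hyperbolic_spaceD(4)[OF o] by (simp add: \<mu>_def lorentz_def)
    have uu: "lorentz (u, 1) (u, 1) = 0"
      using u by (simp add: lorentz_def norm_eq_sqrt_inner)
    \<comment> \<open>Large enough that \<open>s\<^sup>2\<close> exceeds
      \<open>B\<^sup>2 * (1 + 2 * s * \<mu>)\<close>, which puts the normalized point
      \<open>c *\<^sub>R x\<close> outside the ball of radius \<open>B\<close>.\<close>
    define s where "s = 2 * B\<^sup>2 * \<mu> + B\<^sup>2 + 1"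
    have s1: "s \<ge> 1" using \<mu> by (simp add: s_def)
    define x where "x = o' + s *\<^sub>R (u, 1)"
    have xx: "lorentz x x = - (1 + 2 * s * \<mu>)"
      using hyperbolic_spaceD(1)[OF o] uu
      by (simp only: x_def lorentz_simps lorentz_commute[of "(u, 1)" o']) (simp add: \<mu>_def)
    have pos: "1 + 2 * s * \<mu> > 0" using s1 \<mu> by (intro add_pos_nonneg) auto
    have xo: "lorentz x o' = - 1 - s * \<mu>"
      using hyperbolic_spaceD(1)[OF o]
      by (simp only: x_def lorentz_simps lorentz_commute[of "(u, 1)" o']) (simp add: \<mu>_def)
    have "s * \<mu> > 0" using s1 \<mu> by simp
    then have "lorentz x x < 0" "lorentz x o' < 0" using xx pos xo by linarith+
    then obtain c where c: "c > 0" "c *\<^sub>R x \<in> hyperbolic_space" by (rule normalize_hyperbolic[OF o])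
    have "lorentz (c *\<^sub>R x) v \<le> 0" if v: "v \<in> N" for v
    proof -
      have "s * lorentz (u, 1) v \<le> 0" using le[OF v] s1 by (intro mult_nonneg_nonpos) auto
      then have "lorentz x v \<le> 0" using o_neg[OF v] unfolding x_def by (simp only: lorentz_simps) simp
      then show ?thesis using c(1) by (simp add: lorentz_simps mult_nonneg_nonpos)
    qed
    then have "c *\<^sub>R x \<in> P" unfolding P_eq using c(2) by blast
    then have "norm (c *\<^sub>R x) \<le> B" using B by blast
    moreover have "snd (c *\<^sub>R x) \<le> norm (c *\<^sub>R x)" by (rule snd_le_norm)
    moreover have "c * s \<le> snd (c *\<^sub>R x)"
      using c(1) hyperbolic_spaceD(2)[OF o] by (simp add: x_def)
    ultimately have "c * s \<le> B" by linarith
    then have "(c * s)\<^sup>2 \<le> B\<^sup>2" using c(1) s1 by (intro power_mono) auto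
    moreover have "c\<^sup>2 * (1 + 2 * s * \<mu>) = 1"
      using hyperbolic_spaceD(1)[OF c(2)] xx by (simp add: lorentz_simps power2_eq_square algebra_simps)
    ultimately have "c\<^sup>2 * s\<^sup>2 \<le> c\<^sup>2 * (B\<^sup>2 * (1 + 2 * s * \<mu>))"
      by (simp add: power_mult_distrib mult.left_commute)
    then have "s\<^sup>2 \<le> B\<^sup>2 * (1 + 2 * s * \<mu>)" using c(1) by simp
    moreover have "s\<^sup>2 = s * (2 * B\<^sup>2 * \<mu>) + s * (B\<^sup>2 + 1)"
      by (simp add: power2_eq_square s_def algebra_simps)
    moreover have "s * (B\<^sup>2 + 1) \<ge> 1 * (B\<^sup>2 + 1)" using s1 by (intro mult_right_mono) auto
    ultimately show False by (simp add: algebra_simps)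
  qed
  \<comment> \<open>The sum of positive parts is a continuous positive function on the sphere and
    has a positive minimum; averaging over \<open>N\<close> gives the uniform bound for a single
    normal.\<close>
  define F where "F = (\<lambda>u. \<Sum>v\<in>N. max 0 (lorentz (u, 1) v))"
  have "continuous_on (sphere 0 1) F"
    unfolding F_def by (intro continuous_intros lorentz.continuous_on)
  moreover have "\<exists>u::real^'m. norm u = 1" using vector_choose_size[of 1] by auto
  then have "sphere (0::real^'m) 1 \<noteq> {}" by auto
  ultimately obtain u0 where u0: "norm u0 = 1" "\<forall>u\<in>sphere 0 1. F u0 \<le> F u"
    using continuous_attains_inf[of "sphere 0 1" F] by auto
  obtain v0 where v0: "v0 \<in> N" "lorentz (u0, 1) v0 > 0" using ex[OF u0(1)] by blast
  have "F u0 > 0"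
    unfolding F_def using v0 fin by (intro sum_pos2[of _ v0]) auto
  have cN: "card N > 0" using v0(1) fin card_gt_0_iff by blast
  have "\<exists>v\<in>N. lorentz (u, 1) v \<ge> F u0 / card N" if u: "norm u = 1" for u
  proof (rule ccontr)
    assume "\<not> ?thesis"
    then have "max 0 (lorentz (u, 1) v) < F u0 / card N" if "v \<in> N" for v
      using that \<open>F u0 > 0\<close> cN by (simp add: not_le)
    then have "F u < (\<Sum>v\<in>N. F u0 / card N)"
      unfolding F_def using fin v0(1) by (intro sum_strict_mono) auto
    also have "\<dots> = F u0" using cN by simp
    finally show False using u0(2) u by force
  qed
  then show ?thesis using \<open>F u0 > 0\<close> cN by (intro exI[of _ "F u0 / card N"]) simp
qed

text \<open>\<open>q + t\<close> is a lightlike vector, the ideal endpoint of the ray from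
  \<open>q\<close> in direction \<open>t\<close>. After translating \<open>q\<close> into
  \<open>P\<close>, some facet wall separates \<open>q\<close> from this endpoint (\<open>q\<close>
  may lie on it), with uniform bounds by compactness.\<close>

lemma wall_across:
  "\<exists>\<epsilon>>0. \<exists>M. \<forall>q t. q \<in> hyperbolic_space \<longrightarrow> lorentz t q = 0 \<longrightarrow> lorentz t t = 1 \<longrightarrow>
    (\<exists>r. root r \<and> lorentz q r \<le> 0 \<and> lorentz q r \<ge> - M \<and> lorentz q r + lorentz t r \<ge> \<epsilon>)"
proof -
  obtain \<epsilon> where \<epsilon>: "\<epsilon> > 0" "\<forall>u. norm u = 1 \<longrightarrow> (\<exists>v\<in>N. lorentz (u, 1) v \<ge> \<epsilon>)"
    using lightlike_direction by blast
  obtain B where B: "\<forall>x\<in>P. norm x \<le> B" using compact_imp_bounded[OF compact] bounded_iff by blast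
  have sndB: "snd q \<le> B" if "q \<in> P" for q
    using B[rule_format, OF that] snd_le_norm[of q] by simp
  have B1: "B \<ge> 1" using sndB[OF center_in_P] hyperbolic_spaceD(5)[OF o] by simp
  define M where "M = (\<Sum>v\<in>N. norm v) * B"
  have M: "- M \<le> lorentz q v" if "q \<in> P" "v \<in> N" for q v
  proof -
    have "\<bar>lorentz q v\<bar> = \<bar>lorentz_dual v \<bullet> q\<bar>" by (simp add: lorentz_dual_inner)
    also have "\<dots> \<le> norm (lorentz_dual v) * norm q" by (rule Cauchy_Schwarz_ineq2)
    also have "norm (lorentz_dual v) = norm v" by (simp add: lorentz_dual_def norm_prod_def)
    also have "norm v * norm q \<le> (\<Sum>v\<in>N. norm v) * B"
      using B that fin by (intro mult_mono member_le_sum sum_nonneg) auto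
    finally show ?thesis by (simp add: M_def)
  qed
  have main: "\<exists>v\<in>N. lorentz (q + t) v \<ge> \<epsilon> / (2 * B)"
    if q: "q \<in> P" and t: "lorentz t q = 0" "lorentz t t = 1" for q t
  proof -
    have qH: "q \<in> hyperbolic_space" using q polyhedronD by blast
    define l where "l = q + t"
    have ll: "lorentz l l = 0" "lorentz q l = -1"
      using t hyperbolic_spaceD(1)[OF qH] by (simp_all add: l_def lorentz_simps lorentz_commute[of q t])
    have "(norm (fst l))\<^sup>2 = \<bar>snd l\<bar>\<^sup>2"
      using ll(1) by (simp add: lorentz_def power2_norm_eq_inner) (simp add: power2_eq_square)
    then have nl: "norm (fst l) = \<bar>snd l\<bar>" by (rule power2_eq_imp_eq) simp_all
    have cs: "\<bar>fst q \<bullet> fst l\<bar> \<le> norm (fst q) * \<bar>snd l\<bar>" using Cauchy_Schwarz_ineq2[of "fst q" "fst l"] nl by simp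
    have eq1: "snd q * snd l = 1 + fst q \<bullet> fst l" using ll(2) by (simp add: lorentz_def)
    have nq: "norm (fst q) < snd q" using hyperbolic_spaceD(4)[OF qH] .
    have sl: "snd l > 0"
    proof (rule ccontr)
      assume "\<not> snd l > 0"
      then have neg: "snd l \<le> 0" by simp
      have "1 \<le> snd q * snd l + norm (fst q) * \<bar>snd l\<bar>" using eq1 cs by linarith
      also have "\<dots> = (snd q - norm (fst q)) * snd l" using neg by (simp add: algebra_simps)
      also have "\<dots> \<le> 0" using nq neg by (intro mult_nonneg_nonpos) auto
      finally show False by simp
    qed
    have "1 \<le> snd q * snd l + norm (fst q) * snd l" using eq1 cs sl by simp
    also have "\<dots> \<le> B * snd l + B * snd l"
      using sndB[OF q] nq sl by (intro add_mono mult_right_mono) auto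
    \<comment> \<open>Rescaling the lightlike vector \<open>l\<close> to the form
      \<open>(u, 1)\<close> divides by its time component; this lower bound is the origin of the
      factor \<open>2 * B\<close>.\<close>
    finally have sl2: "1 / (2 * B) \<le> snd l" using B1 by (simp add: divide_le_eq algebra_simps)
    define u where "u = (1 / snd l) *\<^sub>R fst l"
    have "norm u = 1" using nl sl by (simp add: u_def)
    then obtain v where v: "v \<in> N" "lorentz (u, 1) v \<ge> \<epsilon>" using \<epsilon> by blast
    have "l = snd l *\<^sub>R (u, 1)" using sl by (simp add: u_def prod_eq_iff)
    then have "lorentz l v = snd l * lorentz (u, 1) v" by (metis lorentz.scaleR_left real_scaleR_def)
    moreover have "(1 / (2 * B)) * \<epsilon> \<le> snd l * lorentz (u, 1) v"
      using sl2 v(2) \<epsilon>(1) sl by (intro mult_mono) auto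
    ultimately have "\<epsilon> / (2 * B) \<le> lorentz l v" by (simp only: times_divide_eq_left mult_1)
    then show ?thesis using v(1) unfolding l_def by blast
  qed
  have "\<exists>r. root r \<and> lorentz q r \<le> 0 \<and> lorentz q r \<ge> - M \<and> lorentz q r + lorentz t r \<ge> \<epsilon> / (2 * B)"
    if q: "q \<in> hyperbolic_space" and t: "lorentz t q = 0" "lorentz t t = 1" for q t
  proof -
    obtain ws where ws: "set ws \<subseteq> N" "act ws q \<in> P" using translate_into_P[OF q] by blast
    have uw: "\<forall>v\<in>set ws. lorentz v v = 1" using unit_word ws by blast
    obtain v where v: "v \<in> N" "lorentz (act ws q + act ws t) v \<ge> \<epsilon> / (2 * B)"
      using main[OF ws(2), of "act ws t"] t lorentz_act[OF uw] by auto
    have "root (act (rev ws) v)" unfolding root_def using ws v(1)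
      by (intro exI[of _ "rev ws"] exI[of _ v]) simp
    moreover have "lorentz q (act (rev ws) v) = lorentz (act ws q) v"
      "lorentz t (act (rev ws) v) = lorentz (act ws t) v"
      using lorentz_act_rev[OF uw] by simp_all
    ultimately show ?thesis using M[OF ws(2) v(1)] polyhedronD(2)[OF ws(2) v(1)] v(2)
      by (intro exI[of _ "act (rev ws) v"]) (simp add: lorentz.add_left)
  qed
  moreover have "\<epsilon> / (2 * B) > 0" using \<epsilon>(1) B1 by simp
  ultimately show ?thesis by blast
qed

text \<open>The wall is taken across the geodesic from \<open>y\<close> to \<open>z\<close>, at distance \<open>r\<close> from \<open>y\<close>.\<close>

lemma separating_wall:
  "\<exists>R>0. \<forall>y n D. y \<in> hyperbolic_space \<longrightarrow> lorentz n y = 0 \<longrightarrow> lorentz n n = 1 \<longrightarrow> D \<ge> R \<longrightarrow>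
    (\<exists>v. root v \<and> lorentz (cosh D *\<^sub>R y + sinh D *\<^sub>R n) v > 0 \<and>
      (\<forall>w\<in>hyperbolic_space. lorentz w n \<le> 0 \<longrightarrow> lorentz w v < 0))"
proof -
  obtain \<epsilon> M where \<epsilon>: "\<epsilon> > 0"
    and wall: "\<And>q t. q \<in> hyperbolic_space \<Longrightarrow> lorentz t q = 0 \<Longrightarrow> lorentz t t = 1 \<Longrightarrow>
    (\<exists>r. root r \<and> lorentz q r \<le> 0 \<and> lorentz q r \<ge> - M \<and> lorentz q r + lorentz t r \<ge> \<epsilon>)"
    using wall_across by metis
  \<comment> \<open>The added 1 gives \<open>M\<^sup>2 + 1 \<le> M'\<^sup>2\<close>, which later
    bounds the transverse part \<open>v'\<close> of the unit vector \<open>v\<close> by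
    \<open>M'\<close>.\<close>
  define M' where "M' = \<bar>M\<bar> + 1"
  \<comment> \<open>Beyond this distance \<open>\<epsilon> * sinh s\<close> strictly exceeds
    \<open>M'\<close>. It is used on both sides of \<open>q\<close>, towards \<open>y\<close> and
    towards the far point, hence the threshold \<open>2 * r\<close>.\<close>
  define r where "r = arsinh (M' / \<epsilon>) + 1"
  have M': "M' \<ge> 1" "M' \<ge> M" by (auto simp: M'_def)
  have "arsinh (M' / \<epsilon>) > 0" unfolding arsinh_real_pos_iff using M'(1) \<epsilon> by simp
  then have r0: "r > 0" unfolding r_def by linarith
  have sr: "\<epsilon> * sinh s > M'" if "s \<ge> r" for s
  proof -
    have "arsinh (M' / \<epsilon>) < s" using that by (simp add: r_def)
    then have "sinh (arsinh (M' / \<epsilon>)) < sinh s" by (rule strict_monoD[OF sinh_real_strict_mono])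
    then have "M' / \<epsilon> < sinh s" by (simp only: sinh_arsinh_real)
    then show ?thesis using \<epsilon> by (simp add: pos_divide_less_eq mult.commute)
  qed
  have "\<exists>v. root v \<and> lorentz (cosh D *\<^sub>R y + sinh D *\<^sub>R n) v > 0 \<and>
      (\<forall>w\<in>hyperbolic_space. lorentz w n \<le> 0 \<longrightarrow> lorentz w v < 0)"
    if y: "y \<in> hyperbolic_space" and n: "lorentz n y = 0" "lorentz n n = 1" and D: "D \<ge> 2 * r" for y n D
  proof -
    \<comment> \<open>\<open>q\<close> is the point at distance \<open>r\<close> from
      \<open>y\<close> in direction \<open>n\<close>, and \<open>t\<close> the unit tangent of the
      geodesic there.\<close>
    define q where "q = cosh r *\<^sub>R y + sinh r *\<^sub>R n"
    define t where "t = sinh r *\<^sub>R y + cosh r *\<^sub>R n"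
    have yy: "lorentz y y = -1" "lorentz y n = 0"
      using hyperbolic_spaceD(1)[OF y] n by (simp_all add: lorentz_commute[of y n])
    have ch: "cosh r * cosh r = 1 + sinh r * sinh r"
      using cosh_square_eq[of r] by (simp add: power2_eq_square)
    have qq: "lorentz q q = -1" using yy n ch by (simp add: q_def lorentz_simps)
    have qt: "lorentz t q = 0" using yy n by (simp add: q_def t_def lorentz_simps)
    have tt: "lorentz t t = 1" using yy n ch by (simp add: t_def lorentz_simps)
    have "lorentz q y < 0" using yy n by (simp add: q_def lorentz_simps)
    then have qH: "q \<in> hyperbolic_space"
      using timelike_future[OF y, of q] qq by (simp add: hyperbolic_space_def)
    obtain v where v: "root v" "lorentz q v \<le> 0" "lorentz q v \<ge> - M" "lorentz q v + lorentz t v \<ge> \<epsilon>"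
      using wall[OF qH qt tt] by blast
    define a b where "a = lorentz q v" and "b = lorentz t v"
    have ab: "a \<le> 0" "a \<ge> - M'" "a + b \<ge> \<epsilon>" "b \<ge> \<epsilon>" using v M' by (auto simp: a_def b_def)
    define k where "k = D - r"
    have k: "k \<ge> r" "k > 0" using D r0 by (simp_all add: k_def)
    have z: "cosh D *\<^sub>R y + sinh D *\<^sub>R n = cosh k *\<^sub>R q + sinh k *\<^sub>R t"
    proof -
      have D_eq: "D = k + r" by (simp add: k_def)
      show ?thesis unfolding D_eq cosh_add sinh_add by (simp add: q_def t_def algebra_simps)
    qed
    have "cosh k * a + sinh k * b = sinh k * (a + b) + (cosh k - sinh k) * a" by (simp add: algebra_simps)
    moreover have "sinh k * \<epsilon> + (cosh k - sinh k) * (- M') \<le> sinh k * (a + b) + (cosh k - sinh k) * a"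
      using ab k by (intro add_mono mult_left_mono) (auto simp: sinh_le_cosh_real)
    moreover have "cosh k - sinh k \<le> 1" using k by (simp add: cosh_minus_sinh)
    then have "(cosh k - sinh k) * (- M') \<ge> 1 * (- M')" using M' by (intro mult_right_mono_neg) auto
    moreover have "sinh k * \<epsilon> > M'" using sr[OF k(1)] by (simp add: mult.commute)
    ultimately have pos: "cosh k * a + sinh k * b > 0" by linarith
    \<comment> \<open>The components of \<open>v\<close> at \<open>y\<close> and at \<open>q\<close>
      are related by a hyperbolic rotation, so
      \<open>p\<^sup>2 - s\<^sup>2 = a\<^sup>2 - b\<^sup>2\<close>, while \<open>p\<close> itself
      becomes very negative.\<close>
    define p s where "p = lorentz y v" and "s = lorentz n v"
    have ap: "a = cosh r * p + sinh r * s" "b = sinh r * p + cosh r * s"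
      by (simp_all add: a_def b_def p_def s_def q_def t_def lorentz_simps)
    have p_eq: "p = cosh r * a - sinh r * b" and s_eq: "s = cosh r * b - sinh r * a"
      unfolding ap using ch by (simp_all add: algebra_simps)
    have ps: "p\<^sup>2 - s\<^sup>2 = a\<^sup>2 - b\<^sup>2"
    proof -
      have "a\<^sup>2 - b\<^sup>2 = (cosh r * cosh r - sinh r * sinh r) * (p\<^sup>2 - s\<^sup>2)"
        unfolding ap by (simp add: power2_eq_square algebra_simps)
      then show ?thesis using ch by simp
    qed
    have p_le: "p \<le> - (\<epsilon> * sinh r)"
    proof -
      have "cosh r * a \<le> 0" using ab by (simp add: mult_nonneg_nonpos)
      moreover have "sinh r * b \<ge> sinh r * \<epsilon>" using ab r0 by (intro mult_left_mono) auto
      ultimately show ?thesis unfolding p_eq by (simp add: mult.commute)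
    qed
    have s_ge: "s \<ge> 0"
    proof -
      have "cosh r * b \<ge> 0" "sinh r * a \<le> 0" using ab \<epsilon> r0 by (auto simp: mult_nonneg_nonpos)
      then show ?thesis unfolding s_eq by linarith
    qed
    have "lorentz w v < 0" if w: "w \<in> hyperbolic_space" "lorentz w n \<le> 0" for w
    proof -
      define \<alpha> \<beta> where "\<alpha> = - lorentz w y" and "\<beta> = lorentz w n"
      have \<alpha>: "\<alpha> \<ge> 1" using hyperbolic_lorentz_le(1)[OF w(1) y] by (simp add: \<alpha>_def)
      have \<beta>: "\<beta> \<le> 0" using w by (simp add: \<beta>_def)
      \<comment> \<open>The parts of \<open>w\<close> and \<open>v\<close> orthogonal to the plane
        of the geodesic. Their product is at most \<open>\<alpha> * M'\<close>, which is beaten by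
        \<open>\<alpha> * p\<close>, and the remaining term \<open>\<beta> * s\<close> is
        nonpositive.\<close>
      define w' v' where "w' = w - \<alpha> *\<^sub>R y - \<beta> *\<^sub>R n" and "v' = v + p *\<^sub>R y - s *\<^sub>R n"
      have vv: "lorentz v v = 1" using root_unit v by blast
      have sym: "lorentz v y = p" "lorentz v n = s" "lorentz y w = - \<alpha>" "lorentz n w = \<beta>"
        "lorentz w y = - \<alpha>" "lorentz w n = \<beta>" "lorentz y v = p" "lorentz n v = s"
        by (simp_all add: p_def s_def \<alpha>_def \<beta>_def lorentz_commute[of v y] lorentz_commute[of v n]
            lorentz_commute[of y w] lorentz_commute[of n w])
      have w'y: "lorentz w' y = 0" and v'y: "lorentz v' y = 0"
        using yy n by (simp_all add: w'_def v'_def lorentz_simps sym)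
      have "lorentz w' w' = \<alpha>\<^sup>2 - 1 - \<beta>\<^sup>2"
        using yy n hyperbolic_spaceD(1)[OF w(1)]
        by (simp add: w'_def lorentz_simps sym) (simp add: power2_eq_square algebra_simps)
      moreover have "\<beta>\<^sup>2 \<ge> 0" by simp
      ultimately have "lorentz w' w' \<le> \<alpha>\<^sup>2" by linarith
      then have w'w': "sqrt (lorentz w' w') \<le> \<alpha>" using \<alpha> by (intro real_le_lsqrt) auto
      have "lorentz v' v' = 1 + p\<^sup>2 - s\<^sup>2"
        using yy n vv by (simp add: v'_def lorentz_simps sym) (simp add: power2_eq_square algebra_simps)
      then have "lorentz v' v' = 1 + a\<^sup>2 - b\<^sup>2" using ps by simp
      moreover have "(- a)\<^sup>2 \<le> \<bar>M\<bar>\<^sup>2" using ab(1) v(3) by (intro power_mono) (auto simp: a_def)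
      then have "a\<^sup>2 + 1 \<le> M'\<^sup>2" by (simp add: M'_def power2_eq_square algebra_simps)
      moreover have "b\<^sup>2 \<ge> 0" by simp
      ultimately have "lorentz v' v' \<le> M'\<^sup>2" by linarith
      then have v'v': "sqrt (lorentz v' v') \<le> M'"
        using M' by (intro real_le_lsqrt) auto
      have "\<bar>lorentz w' v'\<bar> \<le> sqrt (lorentz w' w') * sqrt (lorentz v' v')"
        by (rule tangent_Cauchy_Schwarz[OF y w'y v'y])
      also have "\<dots> \<le> \<alpha> * M'"
        using w'w' v'v' \<alpha> tangent_nonneg(1)[OF y v'y] by (intro mult_mono) auto
      finally have cs: "lorentz w' v' \<le> \<alpha> * M'" by linarith
      have "lorentz w v = lorentz w' v' + \<alpha> * p + \<beta> * s"
        using yy n by (simp add: w'_def v'_def lorentz_simps sym)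
      also have "\<beta> * s \<le> 0" using \<beta> s_ge by (simp add: mult_nonpos_nonneg)
      also have "\<alpha> * p \<le> \<alpha> * (- (\<epsilon> * sinh r))" using p_le \<alpha> by (intro mult_left_mono) auto
      finally have "lorentz w v \<le> \<alpha> * (M' - \<epsilon> * sinh r)" using cs by (simp add: algebra_simps)
      also have "\<dots> < 0" using \<alpha> sr[of r] by (intro mult_pos_neg) auto
      finally show ?thesis .
    qed
    moreover have "lorentz (cosh D *\<^sub>R y + sinh D *\<^sub>R n) v > 0"
      unfolding z using pos by (simp add: lorentz_simps a_def b_def)
    ultimately show ?thesis using v(1) by blast
  qed
  then show ?thesis using r0 by (intro exI[of _ "2 * r"]) auto
qed

section \<open>The hull stays close to the geodesic segment\<close>

definition geodesic_pt where
  "geodesic_pt x0 t s = cosh s *\<^sub>R x0 + sinh s *\<^sub>R t"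

lemma geodesic_pt_H:
  assumes x: "x \<in> hyperbolic_space" and t: "lorentz t x = 0" "lorentz t t = 1"
  shows "geodesic_pt x t s \<in> hyperbolic_space"
    and "lorentz (geodesic_pt x t s) (geodesic_pt x t s') = - cosh (s - s')"
proof -
  have xx: "lorentz x x = -1" "lorentz x t = 0"
    using hyperbolic_spaceD(1)[OF x] t by (simp_all add: lorentz_commute[of x t])
  show *: "lorentz (geodesic_pt x t s) (geodesic_pt x t s') = - cosh (s - s')" for s s'
    using xx t by (simp add: geodesic_pt_def lorentz_simps cosh_diff)
  have "lorentz (geodesic_pt x t s) x < 0" using xx t by (simp add: geodesic_pt_def lorentz_simps)
  then show "geodesic_pt x t s \<in> hyperbolic_space"
    using *[of s s] timelike_future[OF x, of "geodesic_pt x t s"] by (simp add: hyperbolic_space_def)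
qed

text \<open>Let \<open>y\<close> be the point of the segment nearest to \<open>z\<close> and
  \<open>n\<close> the direction from \<open>y\<close> to \<open>z\<close>. By minimality both
  endpoints satisfy \<open>lorentz _ n \<le> 0\<close>, so a wall across a long geodesic from
  \<open>y\<close> to \<open>z\<close> separates both endpoints from \<open>z\<close> and is a root
  of the hull violated at \<open>z\<close>.\<close>

lemma hull_near_geodesic:
  "\<exists>R>0. \<forall>x0 t d z. x0 \<in> hyperbolic_space \<longrightarrow> lorentz t x0 = 0 \<longrightarrow> lorentz t t = 1 \<longrightarrow> d > 0 \<longrightarrow>
    z \<in> hyperbolic_space \<longrightarrow> (\<forall>r\<in>hull_roots x0 (geodesic_pt x0 t d). lorentz z r \<le> 0) \<longrightarrow>
    (\<exists>s\<in>{0..d}. - lorentz (geodesic_pt x0 t s) z < cosh R)"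
proof -
  obtain R where R: "R > 0"
    and sep: "\<And>y n D. y \<in> hyperbolic_space \<Longrightarrow> lorentz n y = 0 \<Longrightarrow> lorentz n n = 1 \<Longrightarrow> D \<ge> R \<Longrightarrow>
    (\<exists>v. root v \<and> lorentz (cosh D *\<^sub>R y + sinh D *\<^sub>R n) v > 0 \<and>
      (\<forall>w\<in>hyperbolic_space. lorentz w n \<le> 0 \<longrightarrow> lorentz w v < 0))"
    using separating_wall by metis
  have "\<exists>s\<in>{0..d}. - lorentz (geodesic_pt x0 t s) z < cosh R"
    if x0: "x0 \<in> hyperbolic_space" and t: "lorentz t x0 = 0" "lorentz t t = 1" and d: "d > 0"
      and z: "z \<in> hyperbolic_space"
      and hull: "\<forall>r\<in>hull_roots x0 (geodesic_pt x0 t d). lorentz z r \<le> 0" for x0 t d z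
  proof (rule ccontr)
    assume "\<not> ?thesis"
    then have far: "cosh R \<le> - lorentz (geodesic_pt x0 t s) z" if "s \<in> {0..d}" for s
      using that by force
    define A B where "A = lorentz x0 z" and "B = lorentz t z"
    define f where "f = (\<lambda>s. cosh s * A + sinh s * B)"
    have f: "lorentz (geodesic_pt x0 t s) z = f s" for s
      by (simp add: f_def geodesic_pt_def lorentz_simps A_def B_def)
    have "continuous_on {0..d} f" unfolding f_def by (intro continuous_intros)
    then obtain s0 where s0: "s0 \<in> {0..d}" "\<forall>s\<in>{0..d}. f s \<le> f s0"
      using continuous_attains_sup[of "{0..d}" f] d by auto
    define f' where "f' = sinh s0 * A + cosh s0 * B"
    have deriv: "DERIV f s0 :> f'"
      unfolding f_def f'_def by (auto intro!: derivative_eq_intros)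
    have right: "f' \<le> 0" if "s0 < d"
    proof (rule ccontr)
      assume "\<not> f' \<le> 0"
      then obtain e where e: "e > 0" "\<forall>h>0. h < e \<longrightarrow> f s0 < f (s0 + h)"
        using DERIV_pos_inc_right[OF deriv] by auto
      define h where "h = min (e / 2) (d - s0)"
      have "h > 0" "h < e" "s0 + h \<in> {0..d}" using e(1) that s0(1) by (auto simp: h_def)
      then have "f s0 < f (s0 + h)" "f (s0 + h) \<le> f s0" using e(2) s0(2) by blast+
      then show False by simp
    qed
    have left: "f' \<ge> 0" if "0 < s0"
    proof (rule ccontr)
      assume "\<not> f' \<ge> 0"
      then obtain e where e: "e > 0" "\<forall>h>0. h < e \<longrightarrow> f s0 < f (s0 - h)"
        using DERIV_neg_dec_left[OF deriv] by auto
      define h where "h = min (e / 2) s0"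
      have "h > 0" "h < e" "s0 - h \<in> {0..d}" using e(1) that s0(1) by (auto simp: h_def)
      then have "f s0 < f (s0 - h)" "f (s0 - h) \<le> f s0" using e(2) s0(2) by blast+
      then show False by simp
    qed
    define y where "y = geodesic_pt x0 t s0"
    have yH: "y \<in> hyperbolic_space" unfolding y_def by (rule geodesic_pt_H(1)[OF x0 t])
    have yz: "lorentz y z = f s0" by (simp add: y_def f)
    define D where "D = arcosh (- lorentz y z)"
    have coshD: "cosh D = - f s0" "D \<ge> 0"
      using cosh_arcosh_lorentz[OF yH z] by (simp_all add: D_def yz)
    have "cosh R \<le> cosh D" using far[OF s0(1)] coshD f by simp
    then have DR: "D \<ge> R" using R coshD(2) by (simp add: cosh_real_nonneg_le_iff)
    then have sD: "sinh D > 0" using R by simp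
    define n where "n = (1 / sinh D) *\<^sub>R (z - cosh D *\<^sub>R y)"
    have zn: "cosh D *\<^sub>R y + sinh D *\<^sub>R n = z" using sD by (simp add: n_def)
    have ny: "lorentz n y = 0"
      using hyperbolic_spaceD(1)[OF yH] yz coshD(1) by (simp add: n_def lorentz_simps lorentz_commute[of z y])
    have yn: "lorentz y n = 0" using ny by (simp add: lorentz_commute[of y n])
    have nn: "lorentz n n = 1"
    proof -
      have "-1 = lorentz (cosh D *\<^sub>R y + sinh D *\<^sub>R n) (cosh D *\<^sub>R y + sinh D *\<^sub>R n)"
        unfolding zn using hyperbolic_spaceD(1)[OF z] by simp
      also have "\<dots> = - (cosh D)\<^sup>2 + (sinh D)\<^sup>2 * lorentz n n"
        using hyperbolic_spaceD(1)[OF yH] ny yn by (simp add: lorentz_simps power2_eq_square)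
      finally have "(sinh D)\<^sup>2 * lorentz n n = (sinh D)\<^sup>2" using cosh_square_eq[of D] by simp
      then show ?thesis using sD by simp
    qed
    obtain v where v: "root v" "lorentz z v > 0"
      "\<forall>w\<in>hyperbolic_space. lorentz w n \<le> 0 \<longrightarrow> lorentz w v < 0"
      using sep[OF yH ny nn DR] unfolding zn by blast
    \<comment> \<open>\<open>f\<close> is minus the hyperbolic cosine of the distance to
      \<open>z\<close> and solves \<open>f'' = f\<close>, so it is determined by its value and slope
      at \<open>s0\<close>; the value terms cancel and only the slope \<open>f'\<close> decides the
      side.\<close>
    have slope: "lorentz (geodesic_pt x0 t s) n = f' * sinh (s - s0) / sinh D" for s
    proof -
      have "lorentz (geodesic_pt x0 t s) (z - cosh D *\<^sub>R y) = f s + cosh D * cosh (s - s0)"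
        using geodesic_pt_H(2)[OF x0 t, of s s0] by (simp add: lorentz.diff_right lorentz.scaleR_right f y_def)
      also have "\<dots> = f s - f s0 * cosh (s - s0)" by (simp add: coshD)
      also have "\<dots> = f' * sinh (s - s0)"
      proof -
        have s: "s = s0 + (s - s0)" by simp
        have "f (s0 + h) = f s0 * cosh h + f' * sinh h" for h
          by (simp add: f_def f'_def cosh_add sinh_add algebra_simps)
        from this[of "s - s0"] show ?thesis by simp
      qed
      finally show ?thesis by (simp add: n_def lorentz.scaleR_right)
    qed
    have "lorentz (geodesic_pt x0 t 0) n \<le> 0"
    proof (cases "s0 = 0")
      case False
      then have "f' \<ge> 0" "sinh (0 - s0) \<le> 0" using left s0(1) by auto
      then show ?thesis unfolding slope using sD by (simp add: divide_nonpos_pos mult_nonneg_nonpos)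
    qed (simp add: slope)
    moreover have "lorentz (geodesic_pt x0 t d) n \<le> 0"
    proof (cases "s0 = d")
      case False
      then have "f' \<le> 0" "sinh (d - s0) \<ge> 0" using right s0(1) by auto
      then show ?thesis unfolding slope using sD by (simp add: divide_nonpos_pos mult_nonpos_nonneg)
    qed (simp add: slope)
    ultimately have "lorentz (geodesic_pt x0 t 0) v < 0" "lorentz (geodesic_pt x0 t d) v < 0"
      using v(3) geodesic_pt_H(1)[OF x0 t] by blast+
    then have "v \<in> hull_roots x0 (geodesic_pt x0 t d)"
      using v(1) by (simp add: hull_roots_def geodesic_pt_def)
    then show False using hull v(2) by force
  qed
  then show ?thesis using R by blast
qed

section \<open>Counting chambers\<close>

text \<open>Uniformity in \<open>x\<close> comes from cocompactness: after translating
  \<open>x\<close> into \<open>P\<close>, whose points are within \<open>\<delta>\<close> of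
  \<open>o'\<close>, the ball is contained in one fixed ball about \<open>o'\<close>.\<close>

lemma card_orbit_ball:
  "\<exists>C. \<forall>x\<in>hyperbolic_space. card {y \<in> orbit_pts. - lorentz x y \<le> cosh R} \<le> C" if "R \<ge> 0"
proof -
  obtain m where m: "\<forall>x\<in>P. - lorentz o' x \<le> m"
  proof -
    have "continuous_on P (\<lambda>x. - lorentz o' x)" by (intro continuous_intros lorentz.continuous_on)
    then show ?thesis using continuous_attains_sup[OF compact, of "\<lambda>x. - lorentz o' x"] center_in_P that by blast
  qed
  define \<delta> where "\<delta> = arcosh (max 1 m)"
  have \<delta>: "\<delta> \<ge> 0" "cosh \<delta> = max 1 m" by (simp_all add: \<delta>_def)
  let ?S = "{y \<in> orbit_pts. - lorentz o' y \<le> cosh (\<delta> + R)}"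
  have "card {y \<in> orbit_pts. - lorentz x y \<le> cosh R} \<le> card ?S" if x: "x \<in> hyperbolic_space" for x
  proof -
    obtain ws where ws: "set ws \<subseteq> N" "act ws x \<in> P" using translate_into_P[OF x] by blast
    have uw: "\<forall>v\<in>set ws. lorentz v v = 1" using unit_word ws by blast
    have "inj_on (act ws) {y \<in> orbit_pts. - lorentz x y \<le> cosh R}"
      by (rule inj_on_inverseI[of _ "act (rev ws)"]) (simp add: act_rev[OF uw])
    moreover have "act ws ` {y \<in> orbit_pts. - lorentz x y \<le> cosh R} \<subseteq> ?S"
    proof (rule image_subsetI)
      fix y assume "y \<in> {y \<in> orbit_pts. - lorentz x y \<le> cosh R}"
      then have y: "y \<in> orbit_pts" "- lorentz x y \<le> cosh R" by simp_all
      have wy: "act ws y \<in> orbit_pts" using act_orbit y ws by blast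
      have "- lorentz (act ws x) (act ws y) \<le> cosh R" using lorentz_act[OF uw] y by simp
      moreover have "- lorentz o' (act ws x) \<le> cosh \<delta>" using m ws(2) \<delta>(2) by force
      ultimately have "- lorentz o' (act ws y) \<le> cosh (\<delta> + R)"
        using hyperbolic_cosh_triangle[OF o polyhedronD(1)[OF ws(2)] orbit_hyperbolic[OF wy]] \<delta>(1) \<open>R \<ge> 0\<close> by blast
      then show "act ws y \<in> ?S" using wy by simp
    qed
    ultimately show ?thesis using card_inj_on_le finite_orbit_ball[OF o] by blast
  qed
  then show ?thesis by blast
qed

text \<open>Every chamber centre in the hull is within \<open>R\<close> of the segment, hence within
  \<open>1 + R\<close> of one of its points at integer distance from \<open>x0\<close>. There are at
  most \<open>d + 1\<close> of these, and each ball holds at most \<open>C\<close> centres.\<close>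

lemma card_hull:
  "\<exists>C>0. \<forall>x0\<in>orbit_pts. \<forall>x1\<in>orbit_pts. x0 \<noteq> x1 \<longrightarrow>
    (let Y = {y \<in> orbit_pts. \<forall>r\<in>hull_normals x0 x1. lorentz y r \<le> 0} in
      finite Y \<and> real (card Y) \<le> C * (arcosh (- lorentz x0 x1) + 1))"
proof -
  obtain R where R: "R > 0"
    and near: "\<And>x0 t d z. x0 \<in> hyperbolic_space \<Longrightarrow> lorentz t x0 = 0 \<Longrightarrow> lorentz t t = 1 \<Longrightarrow> d > 0 \<Longrightarrow>
    z \<in> hyperbolic_space \<Longrightarrow> (\<forall>r\<in>hull_roots x0 (geodesic_pt x0 t d). lorentz z r \<le> 0) \<Longrightarrow>
    (\<exists>s\<in>{0..d}. - lorentz (geodesic_pt x0 t s) z < cosh R)"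
    using hull_near_geodesic by metis
  obtain C where C: "\<forall>x\<in>hyperbolic_space. card {y \<in> orbit_pts. - lorentz x y \<le> cosh (1 + R)} \<le> C"
    using card_orbit_ball[of "1 + R"] R by auto
  have "finite Y \<and> real (card Y) \<le> (real C + 1) * (arcosh (- lorentz x0 x1) + 1)"
    if x: "x0 \<in> orbit_pts" "x1 \<in> orbit_pts" "x0 \<noteq> x1"
      and Y: "Y = {y \<in> orbit_pts. \<forall>r\<in>hull_normals x0 x1. lorentz y r \<le> 0}" for x0 x1 Y
  proof -
    have xH: "x0 \<in> hyperbolic_space" "x1 \<in> hyperbolic_space" using orbit_hyperbolic x by blast+
    define d where "d = arcosh (- lorentz x0 x1)"
    have d: "cosh d = - lorentz x0 x1" "d \<ge> 0" using cosh_arcosh_lorentz[OF xH] by (simp_all add: d_def)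
    have "d \<noteq> 0" using d(1) hyperbolic_lorentz_le(2)[OF xH] x(3) by auto
    then have d0: "d > 0" using d by simp
    then have sd: "sinh d > 0" by simp
    define t where "t = (1 / sinh d) *\<^sub>R (x1 - cosh d *\<^sub>R x0)"
    have tx: "lorentz t x0 = 0"
      using hyperbolic_spaceD(1)[OF xH(1)] d(1) by (simp add: t_def lorentz_simps lorentz_commute[of x1 x0])
    have x1_eq: "geodesic_pt x0 t d = x1" using sd by (simp add: geodesic_pt_def t_def)
    have tt: "lorentz t t = 1"
    proof -
      have xt: "lorentz x0 t = 0" using tx by (simp add: lorentz_commute[of x0 t])
      have "-1 = lorentz (geodesic_pt x0 t d) (geodesic_pt x0 t d)"
        unfolding x1_eq using hyperbolic_spaceD(1)[OF xH(2)] by simp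
      also have "\<dots> = - (cosh d)\<^sup>2 + (sinh d)\<^sup>2 * lorentz t t"
        using hyperbolic_spaceD(1)[OF xH(1)] tx xt
        by (simp add: geodesic_pt_def lorentz_simps power2_eq_square)
      finally have "(sinh d)\<^sup>2 * lorentz t t = (sinh d)\<^sup>2" using cosh_square_eq[of d] by simp
      then show ?thesis using sd by simp
    qed
    define S where "S = (\<lambda>i::nat. {y \<in> orbit_pts. - lorentz (geodesic_pt x0 t (real i)) y \<le> cosh (1 + R)})"
    define k where "k = nat \<lfloor>d\<rfloor>"
    have sub: "Y \<subseteq> (\<Union>i\<in>{..k}. S i)"
    proof
      fix y assume "y \<in> Y"
      then have y: "y \<in> orbit_pts" "\<And>r. r \<in> hull_normals x0 x1 \<Longrightarrow> lorentz y r \<le> 0" by (auto simp: Y)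
      have yH: "y \<in> hyperbolic_space" using orbit_hyperbolic y by blast
      have "\<forall>r\<in>hull_roots x0 (geodesic_pt x0 t d). lorentz y r \<le> 0"
        using hull_normals_imp[OF x(1) yH y(2)] unfolding x1_eq by blast
      then obtain s where s: "s \<in> {0..d}" "- lorentz (geodesic_pt x0 t s) y < cosh R"
        using near[OF xH(1) tx tt d0 yH] by blast
      define i where "i = nat \<lfloor>s\<rfloor>"
      have i: "real i \<le> s" "s - real i \<le> 1" using s(1) by (auto simp: i_def) linarith+
      have "i \<le> k" unfolding i_def k_def using s(1) by (intro nat_mono floor_mono) auto
      have "lorentz (geodesic_pt x0 t (real i)) (geodesic_pt x0 t s) = - cosh (real i - s)"
        by (rule geodesic_pt_H(2)[OF xH(1) tx tt])
      moreover have "cosh (real i - s) = cosh (s - real i)"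
        using cosh_minus[of "s - real i"] unfolding minus_diff_eq .
      moreover have "cosh (s - real i) \<le> cosh 1" using cosh_real_nonneg_le_iff[of "s - real i" 1] i by linarith
      ultimately have 1: "- lorentz (geodesic_pt x0 t (real i)) (geodesic_pt x0 t s) \<le> cosh 1" by linarith
      have "(0::real) \<le> 1" by simp
      then have "- lorentz (geodesic_pt x0 t (real i)) y \<le> cosh (1 + R)"
        using hyperbolic_cosh_triangle[OF geodesic_pt_H(1)[OF xH(1) tx tt] geodesic_pt_H(1)[OF xH(1) tx tt] yH
          1 less_imp_le[OF s(2)]] R by linarith
      then show "y \<in> (\<Union>i\<in>{..k}. S i)" using y(1) \<open>i \<le> k\<close> by (auto simp: S_def)
    qed
    have fin: "finite (S i)" "card (S i) \<le> C" for i
      unfolding S_def by (rule finite_orbit_ball[OF geodesic_pt_H(1)[OF xH(1) tx tt]]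
        bspec[OF C geodesic_pt_H(1)[OF xH(1) tx tt]])+
    have finU: "finite (\<Union>i\<in>{..k}. S i)" using fin(1) by blast
    have finY: "finite Y" by (rule finite_subset[OF sub finU])
    have "card Y \<le> card (\<Union>i\<in>{..k}. S i)" by (rule card_mono[OF finU sub])
    also have "card (\<Union>i\<in>{..k}. S i) \<le> (\<Sum>i\<in>{..k}. card (S i))" by (intro card_UN_le) simp
    also have "\<dots> \<le> (\<Sum>i\<in>{..k}. C)" using fin by (intro sum_mono)
    finally have "card Y \<le> (k + 1) * C" by simp
    then have "real (card Y) \<le> (real k + 1) * real C" by (metis of_nat_1 of_nat_add of_nat_le_iff of_nat_mult)
    also have "\<dots> \<le> (d + 1) * (real C + 1)" using d(2) by (intro mult_mono) (auto simp: k_def)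
    finally show ?thesis using finY by (simp add: d_def mult.commute)
  qed
  note bound = this[OF _ _ _ HOL.refl]
  have "\<forall>x0\<in>orbit_pts. \<forall>x1\<in>orbit_pts. x0 \<noteq> x1 \<longrightarrow>
    (let Y = {y \<in> orbit_pts. \<forall>r\<in>hull_normals x0 x1. lorentz y r \<le> 0} in
      finite Y \<and> real (card Y) \<le> (real C + 1) * (arcosh (- lorentz x0 x1) + 1))"
    unfolding Let_def by (intro ballI impI) (rule bound; assumption)
  moreover have "real C + 1 > 0" by simp
  ultimately show ?thesis by (intro exI[of _ "real C + 1"] conjI)
qed

text \<open>The words in the reflections normal to \<open>M\<close> form the group whose fundamental chamber is the
  hull of two chambers near \<open>x\<close> and \<open>act gs x\<close>; the points of \<open>Y\<close> are the centres of the chambers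
  in that hull.\<close>

lemma separating_reflections:
  "\<exists>C>0. \<forall>x\<in>hyperbolic_space. \<forall>gs. set gs \<subseteq> N \<longrightarrow> act gs x \<noteq> x \<longrightarrow>
    (\<exists>M Y. (\<forall>r\<in>M. root r) \<and> finite Y \<and>
      real (card Y) \<le> C * (arcosh (- lorentz x (act gs x)) + 1) \<and>
      (\<forall>ks. set ks \<subseteq> M \<longrightarrow> act ks \<noteq> act gs) \<and>
      (\<forall>y\<in>orbit_pts. \<exists>ks. set ks \<subseteq> M \<and> act ks y \<in> Y))"
proof -
  obtain C where C: "C > 0" and "\<forall>x0\<in>orbit_pts. \<forall>x1\<in>orbit_pts. x0 \<noteq> x1 \<longrightarrow>
    (let Y = {y \<in> orbit_pts. \<forall>r\<in>hull_normals x0 x1. lorentz y r \<le> 0} in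
      finite Y \<and> real (card Y) \<le> C * (arcosh (- lorentz x0 x1) + 1))"
    using card_hull by (elim exE conjE)
  note card = this(2)[unfolded Let_def, rule_format]
  obtain m where m: "\<forall>x\<in>P. - lorentz o' x \<le> m"
  proof -
    have "continuous_on P (\<lambda>x. - lorentz o' x)" by (intro continuous_intros lorentz.continuous_on)
    then show ?thesis using continuous_attains_sup[OF compact, of "\<lambda>x. - lorentz o' x"] center_in_P that by blast
  qed
  define \<delta> where "\<delta> = arcosh (max 1 m)"
  have \<delta>: "\<delta> \<ge> 0" "cosh \<delta> = max 1 m" by (simp_all add: \<delta>_def)
  have "\<exists>M Y. (\<forall>r\<in>M. root r) \<and> finite Y \<and>
      real (card Y) \<le> C * (2 * \<delta> + 1) * (arcosh (- lorentz x (act gs x)) + 1) \<and>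
      (\<forall>ks. set ks \<subseteq> M \<longrightarrow> act ks \<noteq> act gs) \<and>
      (\<forall>y\<in>orbit_pts. \<exists>ks. set ks \<subseteq> M \<and> act ks y \<in> Y)"
    if x: "x \<in> hyperbolic_space" and gs: "set gs \<subseteq> N" "act gs x \<noteq> x" for x gs
  proof -
    obtain h where h: "set h \<subseteq> N" "act h x \<in> P" using translate_into_P[OF x] by blast
    have uh: "\<forall>v\<in>set h. lorentz v v = 1" using unit_word h by blast
    have ug: "\<forall>v\<in>set gs. lorentz v v = 1" using unit_word gs by blast
    \<comment> \<open>\<open>h\<close> carries \<open>x\<close> into \<open>P\<close>, so
      \<open>x0\<close> is the centre of a chamber containing \<open>x\<close>, and
      \<open>x1\<close> that of its image under \<open>gs\<close>.\<close>
    define x0 x1 where "x0 = act (rev h) o'" and "x1 = act gs x0"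
    have x0: "x0 \<in> orbit_pts" unfolding x0_def orbit_pts_def using h(1)
      by (intro CollectI exI[of _ "rev h"]) simp
    have x1: "x1 \<in> orbit_pts" unfolding x1_def using act_orbit x0 gs by blast
    have x0H: "x0 \<in> hyperbolic_space" and x1H: "x1 \<in> hyperbolic_space" using orbit_hyperbolic x0 x1 by blast+
    \<comment> \<open>If \<open>gs\<close> fixed \<open>x0\<close>, its conjugate by
      \<open>h\<close> would fix \<open>o'\<close> and so be the identity; then \<open>gs\<close>
      would fix \<open>x\<close> as well.\<close>
    have ne: "x0 \<noteq> x1"
    proof
      assume "x0 = x1"
      then have "act (h @ gs @ rev h) o' = o'"
        using act_rev(2)[OF uh, of o'] by (simp add: x0_def x1_def)
      moreover have *: "set (h @ gs @ rev h) \<subseteq> N" using h gs by simp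
      ultimately have "act (h @ gs @ rev h) = id" using orbit_trivial_stabilizer center_in_P by metis
      from fun_cong[OF this, of "act h x"] have "act h (act gs x) = act h x"
        using act_rev(1)[OF uh] by simp
      then show False using gs(2) act_rev(1)[OF uh] by metis
    qed
    define M where "M = hull_normals x0 x1"
    define Y where "Y = {y \<in> orbit_pts. \<forall>r\<in>M. lorentz y r \<le> 0}"
    have M_root: "root r" "lorentz x0 r < 0" "lorentz x1 r < 0" if "r \<in> M" for r
      using hull_normals_roots that unfolding M_def by blast+
    interpret M: right_angled M unfolding M_def by (rule hull_normals_right_angled[OF x0H])
    have kset: "act ks \<noteq> act gs" if ks: "set ks \<subseteq> M" for ks
    proof
      assume eq: "act ks = act gs"
      then have "act ks x0 = x1" by (simp add: x1_def)
      then have "act ks = id"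
        using M_root by (intro M.act_strict_interior[OF ks, of x0]) (auto intro: less_imp_le)
      then show False using \<open>act ks x0 = x1\<close> ne by simp
    qed
    have act_M_orbit: "act ks y \<in> orbit_pts" if "set ks \<subseteq> M" "y \<in> orbit_pts" for ks y
      using that
    proof (induction ks)
      case (Cons r ks)
      have "root r" using M_root(1)[of r] Cons.prems(1) by simp
      then obtain ws where "set ws \<subseteq> N" "mrefl r = act ws" by (rule mrefl_root_word)
      then show ?case using Cons act_orbit by simp
    qed simp
    have cover: "\<exists>ks. set ks \<subseteq> M \<and> act ks y \<in> Y" if y: "y \<in> orbit_pts" for y
    proof -
      have "{- lorentz x0 (act ws y) | ws. set ws \<subseteq> M \<and> - lorentz x0 (act ws y) \<le> - lorentz x0 y}
          \<subseteq> (\<lambda>y. - lorentz x0 y) ` {z \<in> orbit_pts. - lorentz x0 z \<le> - lorentz x0 y}"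
        using act_M_orbit[OF _ y] by blast
      then have "finite {- lorentz x0 (act ws y) | ws. set ws \<subseteq> M \<and> - lorentz x0 (act ws y) \<le> - lorentz x0 y}"
        by (rule finite_subset) (intro finite_imageI finite_orbit_ball x0H)
      then obtain ks where ks: "set ks \<subseteq> M" "\<And>v. v \<in> M \<Longrightarrow> lorentz (act ks y) v \<le> 0"
        using translate_into_chamber[of M x0 y] M.unit M_root(2) by blast
      then show ?thesis using act_M_orbit[OF ks(1) y] unfolding Y_def by blast
    qed
    define L where "L = arcosh (- lorentz x (act gs x))"
    have gxH: "act gs x \<in> hyperbolic_space" using act_hyperbolic_N gs x by blast
    have L: "cosh L = - lorentz x (act gs x)" "L \<ge> 0"
      using cosh_arcosh_lorentz[OF x gxH] by (simp_all add: L_def)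
    have "lorentz x0 x = lorentz x x0" by (rule lorentz_commute)
    also have "\<dots> = lorentz (act h x) o'" unfolding x0_def by (rule lorentz_act_rev[OF uh, symmetric])
    also have "\<dots> = lorentz o' (act h x)" by (rule lorentz_commute)
    finally have 1: "- lorentz x0 x \<le> cosh \<delta>" using m h(2) \<delta>(2) by force
    have "lorentz (act gs x) x1 = lorentz x x0" unfolding x1_def by (rule lorentz_act[OF ug])
    then have 2: "- lorentz (act gs x) x1 \<le> cosh \<delta>" using 1 by (simp add: lorentz_commute[of x x0])
    have "- lorentz x0 (act gs x) \<le> cosh (\<delta> + L)"
      using hyperbolic_cosh_triangle[OF x0H x gxH 1] L \<delta> by simp
    then have "- lorentz x0 x1 \<le> cosh ((\<delta> + L) + \<delta>)"
      using L(2) \<delta>(1) by (intro hyperbolic_cosh_triangle[OF x0H gxH x1H _ 2]) auto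
    then have "arcosh (- lorentz x0 x1) \<le> (\<delta> + L) + \<delta>"
      using cosh_arcosh_lorentz[OF x0H x1H] L \<delta>
      by (metis add_nonneg_nonneg cosh_real_nonneg_le_iff)
    \<comment> \<open>Passing from \<open>x\<close> and its image to the chamber centres costs
      \<open>\<delta>\<close> at each end; the product absorbs this additive
      \<open>2 * \<delta>\<close> into the constant.\<close>
    then have le: "arcosh (- lorentz x0 x1) + 1 \<le> (2 * \<delta> + 1) * (L + 1)"
    proof -
      have "(2 * \<delta> + 1) * (L + 1) = 2 * (\<delta> * L) + 2 * \<delta> + L + 1" by (simp add: algebra_simps)
      moreover have "\<delta> * L \<ge> 0" using L(2) \<delta>(1) by simp
      ultimately show ?thesis using \<open>arcosh (- lorentz x0 x1) \<le> (\<delta> + L) + \<delta>\<close> by linarith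
    qed
    have Yc: "finite Y \<and> real (card Y) \<le> C * (arcosh (- lorentz x0 x1) + 1)"
      unfolding Y_def M_def by (intro conjI card[THEN conjunct1] card[THEN conjunct2] x0 x1 ne)
    have "C * (arcosh (- lorentz x0 x1) + 1) \<le> C * ((2 * \<delta> + 1) * (L + 1))"
      using C le by (intro mult_left_mono) auto
    then have "finite Y" "real (card Y) \<le> C * (2 * \<delta> + 1) * (L + 1)"
      using Yc by (simp_all only: mult.assoc) linarith
    then show ?thesis using M_root(1) kset cover unfolding L_def by blast
  qed
  moreover have "C * (2 * \<delta> + 1) > 0" using C \<delta>(1) by simp
  ultimately show ?thesis by (intro exI[of _ "C * (2 * \<delta> + 1)"] conjI ballI allI impI)
qed

end

section \<open>Finite index subgroups of the reflection group\<close>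

text \<open>The preimage of \<open>K\<close> excludes \<open>\<alpha>\<close>, and each of its
  cosets is the preimage of a coset of \<open>K\<close>, so its index is not larger.\<close>

lemma divisibility_hom:
  assumes \<phi>: "\<phi> \<in> hom G H" and "group G" and "group H" and K: "subgroup K H"
    and fin: "finite (rcosets\<^bsub>H\<^esub> K)" and \<alpha>: "\<alpha> \<in> carrier G" "\<phi> \<alpha> \<notin> K"
  shows "divisibility G \<alpha> \<le> enat (card (rcosets\<^bsub>H\<^esub> K))"
proof -
  interpret group_hom G H \<phi> using assms by (simp add: group_hom_def group_hom_axioms_def)
  define L where "L = {x \<in> carrier G. \<phi> x \<in> K}"
  have "subgroup L G"
    by (rule subgroup.intro)
      (auto simp: L_def subgroup.one_closed[OF K] subgroup.m_closed[OF K] subgroup.m_inv_closed[OF K])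
  have coset: "L #>\<^bsub>G\<^esub> x = {y \<in> carrier G. \<phi> y \<in> K #>\<^bsub>H\<^esub> \<phi> x}" if x: "x \<in> carrier G" for x
  proof (rule Set.set_eqI)
    fix y
    have "y \<in> L #>\<^bsub>G\<^esub> x \<longleftrightarrow> y \<in> carrier G \<and> y \<otimes>\<^bsub>G\<^esub> inv\<^bsub>G\<^esub> x \<in> L"
      using subgroup.rcos_module[OF \<open>subgroup L G\<close> G.is_group x, of y]
        G.r_coset_subset_G[OF subgroup.subset[OF \<open>subgroup L G\<close>] x] by blast
    also have "\<dots> \<longleftrightarrow> y \<in> carrier G \<and> \<phi> y \<otimes>\<^bsub>H\<^esub> inv\<^bsub>H\<^esub> \<phi> x \<in> K"
      using x by (auto simp: L_def)
    also have "\<dots> \<longleftrightarrow> y \<in> carrier G \<and> \<phi> y \<in> K #>\<^bsub>H\<^esub> \<phi> x"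
      using x subgroup.rcos_module[OF K H.is_group, of "\<phi> x" "\<phi> y"] by auto
    finally show "y \<in> L #>\<^bsub>G\<^esub> x \<longleftrightarrow> y \<in> {y \<in> carrier G. \<phi> y \<in> K #>\<^bsub>H\<^esub> \<phi> x}" by simp
  qed
  have sub: "rcosets\<^bsub>G\<^esub> L \<subseteq> (\<lambda>D. {y \<in> carrier G. \<phi> y \<in> D}) ` (rcosets\<^bsub>H\<^esub> K)"
  proof
    fix D assume "D \<in> rcosets\<^bsub>G\<^esub> L"
    then obtain x where x: "x \<in> carrier G" "D = L #>\<^bsub>G\<^esub> x" unfolding RCOSETS_def by blast
    have "K #>\<^bsub>H\<^esub> \<phi> x \<in> rcosets\<^bsub>H\<^esub> K"
      by (rule H.rcosetsI[OF subgroup.subset[OF K] hom_closed[OF x(1)]])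
    then show "D \<in> (\<lambda>D. {y \<in> carrier G. \<phi> y \<in> D}) ` (rcosets\<^bsub>H\<^esub> K)"
      unfolding x(2) coset[OF x(1)] by (rule imageI)
  qed
  have finL: "finite (rcosets\<^bsub>G\<^esub> L)" by (rule finite_subset[OF sub]) (rule finite_imageI[OF fin])
  have "card (rcosets\<^bsub>G\<^esub> L) \<le> card (rcosets\<^bsub>H\<^esub> K)" by (rule surj_card_le[OF fin sub])
  moreover have "divisibility G \<alpha> \<le> enat (card (rcosets\<^bsub>G\<^esub> L))"
    unfolding divisibility_def using \<open>subgroup L G\<close> \<alpha> finL by (intro INF_lower) (simp add: L_def)
  ultimately show ?thesis by (meson enat_ord_simps(1) order_trans)
qed

section \<open>Isometries represented by words\<close>

lemma isometry_group_simps: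
  "carrier isometry_group = {h \<in> Bij hyperbolic_space. \<forall>x\<in>hyperbolic_space. \<forall>y\<in>hyperbolic_space.
    hyperbolic_dist (h x) (h y) = hyperbolic_dist x y}"
  "\<one>\<^bsub>isometry_group\<^esub> = (\<lambda>x\<in>hyperbolic_space. x)"
  "g \<in> Bij hyperbolic_space \<Longrightarrow> h \<in> Bij hyperbolic_space \<Longrightarrow>
    g \<otimes>\<^bsub>isometry_group\<^esub> h = compose hyperbolic_space g h"
  by (auto simp: isometry_group_def BijGroup_def restrict_def)

lemma group_isometry_group:
  "group (isometry_group :: ((real^'m::finite) \<times> real \<Rightarrow> (real^'m) \<times> real) monoid)"
proof -
  let ?H = "hyperbolic_space :: ((real^'m) \<times> real) set"
  let ?B = "BijGroup ?H"
  let ?I = "{h \<in> Bij ?H. \<forall>x\<in>?H. \<forall>y\<in>?H. hyperbolic_dist (h x) (h y) = hyperbolic_dist x y}"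
  interpret B: group ?B by (rule group_BijGroup)
  have "subgroup ?I ?B"
  proof (rule B.subgroupI)
    show "?I \<subseteq> carrier ?B" by (auto simp: BijGroup_def)
    have "(\<lambda>x\<in>?H. x) \<in> ?I" using id_Bij[of ?H] by simp
    then show "?I \<noteq> {}" by blast
    fix f assume f: "f \<in> ?I"
    then have B: "f \<in> Bij ?H" by simp
    have inv: "inv\<^bsub>?B\<^esub> f = (\<lambda>x\<in>?H. inv_into ?H f x)" by (rule inv_BijGroup[OF B])
    have *: "hyperbolic_dist (inv_into ?H f x) (inv_into ?H f y) = hyperbolic_dist x y"
      if "x \<in> ?H" "y \<in> ?H" for x y
    proof -
      have "f ` ?H = ?H" using B by (simp add: Bij_def bij_betw_def)
      then have "f (inv_into ?H f x) = x" "f (inv_into ?H f y) = y"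
        using that by (auto intro: f_inv_into_f)
      moreover have "hyperbolic_dist (f (inv_into ?H f x)) (f (inv_into ?H f y))
          = hyperbolic_dist (inv_into ?H f x) (inv_into ?H f y)"
        using CollectD[OF f] Bij_inv_into_mem[OF B that(1)] Bij_inv_into_mem[OF B that(2)] by blast
      ultimately show ?thesis by simp
    qed
    show "inv\<^bsub>?B\<^esub> f \<in> ?I" unfolding inv using restrict_inv_into_Bij[OF B] * by simp
    fix g assume g: "g \<in> ?I"
    then have "f \<otimes>\<^bsub>?B\<^esub> g = compose ?H f g" using B by (simp add: BijGroup_def)
    moreover have "compose ?H f g \<in> ?I"
    proof -
      have "g x \<in> ?H" if "x \<in> ?H" for x
        using g Bij_imp_funcset[of g ?H] funcset_mem[OF _ that] by blast
      then show ?thesis using f g compose_Bij[of f ?H g] by (simp add: compose_def)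
    qed
    ultimately show "f \<otimes>\<^bsub>?B\<^esub> g \<in> ?I" by simp
  qed
  then show ?thesis unfolding isometry_group_def by (rule subgroup.subgroup_is_group) (rule B.is_group)
qed

text \<open>Elements of \<open>Bij\<close> are extensional functions, hence the restriction;
  \<open>act\<close> itself is linear on all of Minkowski space.\<close>

definition isom :: "((real^'m::finite) \<times> real) list \<Rightarrow> (real^'m) \<times> real \<Rightarrow> (real^'m) \<times> real" where
  "isom ws = restrict (act ws) hyperbolic_space"

lemma isom_carrier:
  assumes "\<forall>v\<in>set ws. lorentz v v = 1"
  shows "isom ws \<in> carrier isometry_group"
proof -
  have r: "\<forall>v\<in>set (rev ws). lorentz v v = 1" using assms by simp
  have "bij_betw (isom ws) hyperbolic_space hyperbolic_space"
    by (rule bij_betwI[where g = "act (rev ws)"])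
      (auto simp: isom_def act_rev[OF assms] intro: act_hyperbolic[OF assms] act_hyperbolic[OF r])
  then have "isom ws \<in> Bij hyperbolic_space" by (simp add: Bij_def isom_def)
  then show ?thesis unfolding isometry_group_simps(1)
    by (simp add: isom_def hyperbolic_dist_def lorentz_act[OF assms])
qed

lemma isom_mult:
  assumes "\<forall>v\<in>set ws. lorentz v v = 1" "\<forall>v\<in>set us. lorentz v v = 1"
  shows "isom ws \<otimes>\<^bsub>isometry_group\<^esub> isom us = isom (ws @ us)"
proof -
  have "isom ws \<in> Bij hyperbolic_space" "isom us \<in> Bij hyperbolic_space"
    using isom_carrier assms unfolding isometry_group_simps(1) by blast+
  then have "isom ws \<otimes>\<^bsub>isometry_group\<^esub> isom us = compose hyperbolic_space (isom ws) (isom us)"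
    by (simp add: isometry_group_simps(3))
  also have "\<dots> = isom (ws @ us)"
    by (rule ext) (simp add: isom_def compose_def act_hyperbolic[OF assms(2)])
  finally show ?thesis .
qed

lemma isom_Nil: "isom [] = \<one>\<^bsub>isometry_group\<^esub>"
  by (rule ext) (simp add: isom_def isometry_group_simps(2))

lemma isom_subgroup:
  assumes M: "\<And>v. v \<in> M \<Longrightarrow> lorentz v v = 1"
  shows "subgroup {isom ws | ws. set ws \<subseteq> M} isometry_group"
proof -
  interpret group isometry_group by (rule group_isometry_group)
  have u: "\<forall>v\<in>set ws. lorentz v v = 1" if "set ws \<subseteq> M" for ws using M that by blast
  show ?thesis
  proof (rule subgroupI)
    show "{isom ws | ws. set ws \<subseteq> M} \<subseteq> carrier isometry_group" using isom_carrier[OF u] by blast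
    show "{isom ws | ws. set ws \<subseteq> M} \<noteq> {}" by (auto intro: exI[of _ "[]"])
  next
    fix g assume "g \<in> {isom ws | ws. set ws \<subseteq> M}"
    then obtain ws where g: "set ws \<subseteq> M" "g = isom ws" by blast
    have "inv\<^bsub>isometry_group\<^esub> g = isom (rev ws)"
    proof (rule inv_equality)
      have r: "\<forall>v\<in>set (rev ws). lorentz v v = 1" using u[OF g(1)] by simp
      show "isom (rev ws) \<otimes>\<^bsub>isometry_group\<^esub> g = \<one>\<^bsub>isometry_group\<^esub>"
        unfolding g(2) isom_mult[OF r u[OF g(1)]]
        by (rule ext) (simp add: isom_def isometry_group_simps(2) act_rev[OF u[OF g(1)]])
      show "g \<in> carrier isometry_group" "isom (rev ws) \<in> carrier isometry_group"
        using isom_carrier[OF r] isom_carrier[OF u[OF g(1)]] g(2) by simp_all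
    qed
    then show "inv\<^bsub>isometry_group\<^esub> g \<in> {isom ws | ws. set ws \<subseteq> M}"
      using g(1) by (intro CollectI exI[of _ "rev ws"]) simp
    fix h assume "h \<in> {isom ws | ws. set ws \<subseteq> M}"
    then obtain us where h: "set us \<subseteq> M" "h = isom us" by blast
    show "g \<otimes>\<^bsub>isometry_group\<^esub> h \<in> {isom ws | ws. set ws \<subseteq> M}"
      unfolding g(2) h(2) isom_mult[OF u[OF g(1)] u[OF h(1)]] using g(1) h(1)
      by (intro CollectI exI[of _ "ws @ us"]) simp
  qed
qed

text \<open>Reflections are involutions, so reversing a word inverts it, and words without inverse
  letters are already closed under the group operations.\<close>

lemma carrier_reflection_group:
  "carrier (reflection_group P) = {isom ws | ws. set ws \<subseteq> {v. facet_normal P v}}" (is "_ = ?W")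
proof
  interpret group isometry_group by (rule group_isometry_group)
  have unit: "\<And>v. v \<in> {v. facet_normal P v} \<Longrightarrow> lorentz v v = 1" by (simp add: facet_normal_def)
  have refl_isom: "reflection v = isom [v]" for v :: "(real^'m) \<times> real"
    by (rule ext) (simp add: reflection_def isom_def mrefl_def)
  show "carrier (reflection_group P) \<subseteq> ?W"
    unfolding reflection_group_def
  proof (rule subgroup_generated_minimal[OF isom_subgroup[OF unit]])
    show "{reflection v |v. facet_normal P v} \<subseteq> ?W"
    proof
      fix g assume "g \<in> {reflection v |v. facet_normal P v}"
      then obtain v where "facet_normal P v" "g = isom [v]" using refl_isom by blast
      then show "g \<in> ?W" by (intro CollectI exI[of _ "[v]"]) simp
    qed
  qed
  show "?W \<subseteq> carrier (reflection_group P)"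
  proof
    fix g assume "g \<in> ?W"
    then obtain ws where "set ws \<subseteq> {v. facet_normal P v}" "g = isom ws" by blast
    then show "g \<in> carrier (reflection_group P)"
    proof (induction ws arbitrary: g)
      case Nil
      then show ?case unfolding reflection_group_def carrier_subgroup_generated isom_Nil
        by (simp add: generate.one)
    next
      case (Cons v ws)
      have v: "facet_normal P v" and ws: "set ws \<subseteq> {v. facet_normal P v}" using Cons.prems(1) by simp_all
      have u: "\<forall>v\<in>set [v]. lorentz v v = 1" "\<forall>v\<in>set ws. lorentz v v = 1" using unit v ws by auto
      have "isom [v] \<in> carrier isometry_group \<inter> {reflection v |v. facet_normal P v}"
        using isom_carrier[OF u(1)] v refl_isom[of v, symmetric] by blast
      then have "isom [v] \<otimes>\<^bsub>isometry_group\<^esub> isom ws \<in> carrier (reflection_group P)"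
        using Cons.IH[OF ws HOL.refl] unfolding reflection_group_def carrier_subgroup_generated
        by (rule generate.eng[OF generate.incl])
      then show ?case using isom_mult[OF u] Cons.prems(2) by simp
    qed
  qed
qed

lemma group_reflection_group: "group (reflection_group P)"
  unfolding reflection_group_def by (rule group.group_subgroup_generated[OF group_isometry_group])

text \<open>Hyperbolic space spans Minkowski space: every \<open>w\<close> is a combination of the
  base point \<open>(0, 1)\<close> and a point of hyperbolic space near it, and \<open>act\<close>
  is linear.\<close>

lemma isom_eq_imp:
  assumes "isom ws = isom us"
  shows "act ws = act (us :: ((real^'m::finite) \<times> real) list)"
proof
  fix w :: "(real^'m) \<times> real"
  have eq: "act ws x = act us x" if "x \<in> hyperbolic_space" for x
    using fun_cong[OF assms, of x] that by (simp add: isom_def)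
  let ?z = "(0, 1) :: (real^'m) \<times> real"
  have z: "?z \<in> hyperbolic_space" by (simp add: hyperbolic_space_def lorentz_def)
  obtain e where e: "e > 0" "\<And>d. 0 < d \<Longrightarrow> d \<le> e \<Longrightarrow> \<exists>c>0. c *\<^sub>R (?z + d *\<^sub>R w) \<in> hyperbolic_space"
    using hyperbolic_perturbation[OF z, of "{}" w] by auto
  then obtain c where c: "c > 0" "c *\<^sub>R (?z + e *\<^sub>R w) \<in> hyperbolic_space" by blast
  have "act ws ?z = act us ?z" by (rule eq[OF z])
  with eq[OF c(2)] show "act ws w = act us w" using c(1) e(1) by (simp add: act_linear_simps)
qed

context compact_polyhedron
begin

text \<open>Every coset of \<open>K\<close> contains an element carrying \<open>o'\<close> into the
  finite set \<open>Y\<close>. Since group elements are determined by their value at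
  \<open>o'\<close>, the point of \<open>Y\<close> determines the coset, so the index is at most
  \<open>card Y\<close>.\<close>

lemma reflection_group_separation:
  assumes N: "N = {v. facet_normal P v}"
  shows "\<exists>C>0. \<forall>\<gamma>\<in>carrier (reflection_group P). \<forall>x\<in>hyperbolic_space. \<gamma> x \<noteq> x \<longrightarrow>
    (\<exists>K. subgroup K (reflection_group P) \<and> \<gamma> \<notin> K \<and> finite (rcosets\<^bsub>reflection_group P\<^esub> K) \<and>
      real (card (rcosets\<^bsub>reflection_group P\<^esub> K)) \<le> C * (hyperbolic_dist x (\<gamma> x) + 1))"
proof -
  let ?G = "reflection_group P"
  interpret I: group isometry_group by (rule group_isometry_group)
  interpret group ?G by (rule group_reflection_group)
  have car: "carrier ?G = {isom ws | ws. set ws \<subseteq> N}" unfolding N by (rule carrier_reflection_group)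
  have mult: "g \<otimes>\<^bsub>?G\<^esub> h = g \<otimes>\<^bsub>isometry_group\<^esub> h" for g h by (simp add: reflection_group_def)
  obtain C where C: "C > 0" and sep: "\<forall>x\<in>hyperbolic_space. \<forall>gs. set gs \<subseteq> N \<longrightarrow> act gs x \<noteq> x \<longrightarrow>
    (\<exists>M Y. (\<forall>r\<in>M. root r) \<and> finite Y \<and>
      real (card Y) \<le> C * (arcosh (- lorentz x (act gs x)) + 1) \<and>
      (\<forall>ks. set ks \<subseteq> M \<longrightarrow> act ks \<noteq> act gs) \<and>
      (\<forall>y\<in>orbit_pts. \<exists>ks. set ks \<subseteq> M \<and> act ks y \<in> Y))"
    using separating_reflections by (elim exE conjE)
  have "\<exists>K. subgroup K ?G \<and> \<gamma> \<notin> K \<and> finite (rcosets\<^bsub>?G\<^esub> K) \<and>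
      real (card (rcosets\<^bsub>?G\<^esub> K)) \<le> C * (hyperbolic_dist x (\<gamma> x) + 1)"
    if \<gamma>: "\<gamma> \<in> carrier ?G" and x: "x \<in> hyperbolic_space" and ne: "\<gamma> x \<noteq> x" for \<gamma> x
  proof -
    obtain gs where gs: "set gs \<subseteq> N" "\<gamma> = isom gs" using \<gamma> car by blast
    have \<gamma>x: "\<gamma> x = act gs x" using gs(2) x by (simp add: isom_def)
    obtain M Y where M: "\<forall>r\<in>M. root r" and Y: "finite Y"
      "real (card Y) \<le> C * (arcosh (- lorentz x (act gs x)) + 1)"
      and notin: "\<forall>ks. set ks \<subseteq> M \<longrightarrow> act ks \<noteq> act gs"
      and cover: "\<forall>y\<in>orbit_pts. \<exists>ks. set ks \<subseteq> M \<and> act ks y \<in> Y"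
      using sep[rule_format, OF x gs(1) ne[unfolded \<gamma>x]] by (elim exE conjE)
    define K where "K = {isom ks | ks. set ks \<subseteq> M}"
    have uM: "\<And>v. v \<in> M \<Longrightarrow> lorentz v v = 1" using M root_unit by blast
    have word: "\<exists>ws. set ws \<subseteq> N \<and> act ks = act ws" if "set ks \<subseteq> M" for ks
      using that
    proof (induction ks)
      case Nil
      then show ?case by (intro exI[of _ "[]"]) simp
    next
      case (Cons r ks)
      then obtain ws where ws: "set ws \<subseteq> N" "act ks = act ws" by auto
      have "root r" using M Cons.prems by simp
      then obtain us where us: "set us \<subseteq> N" "mrefl r = act us" by (rule mrefl_root_word)
      have "act (r # ks) = act (us @ ws)" by (rule ext) (simp add: ws(2) us(2))
      then show ?case using ws us by (intro exI[of _ "us @ ws"]) simp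
    qed
    have KG: "K \<subseteq> carrier ?G"
    proof
      fix g assume "g \<in> K"
      then obtain ks where ks: "set ks \<subseteq> M" "g = isom ks" unfolding K_def by blast
      then obtain ws where "set ws \<subseteq> N" "act ks = act ws" using word by blast
      then have "g = isom ws" "set ws \<subseteq> N" using ks by (simp_all add: isom_def)
      then show "g \<in> carrier ?G" unfolding car by blast
    qed
    have K: "subgroup K ?G"
      using I.subgroup_incl[OF isom_subgroup[OF uM] I.generate_is_subgroup[OF Int_lower1]] KG
      unfolding K_def reflection_group_def subgroup_generated_def by simp
    have \<gamma>K: "\<gamma> \<notin> K"
    proof
      assume "\<gamma> \<in> K"
      then obtain ks where "set ks \<subseteq> M" "isom ks = isom gs" unfolding K_def gs(2) by auto
      then show False using isom_eq_imp notin by blast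
    qed
    have free: "g = h" if gh: "g \<in> carrier ?G" "h \<in> carrier ?G" "g o' = h o'" for g h
    proof -
      obtain ws us where w: "set ws \<subseteq> N" "g = isom ws" "set us \<subseteq> N" "h = isom us" using gh(1,2) car by blast
      have "act ws o' = act us o'" using gh(3) w o by (simp add: isom_def)
      then have "act (rev us @ ws) o' \<in> P" using act_rev[OF unit_word[OF w(3)]] center_in_P by simp
      moreover have "set (rev us @ ws) \<subseteq> N" using w by simp
      ultimately have "act (rev us @ ws) = id" by (intro orbit_trivial_stabilizer)
      then have "act ws y = act us y" for y
        using fun_cong[of "act (rev us @ ws)" id y] act_rev[OF unit_word[OF w(3)]] by (metis act_simps(3) id_apply)
      then have "act ws = act us" by (rule ext)
      then show ?thesis using w by (simp add: isom_def)
    qed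
    have sub: "rcosets\<^bsub>?G\<^esub> K \<subseteq> (\<lambda>y. K #>\<^bsub>?G\<^esub> (SOME g. g \<in> carrier ?G \<and> g o' = y)) ` Y"
    proof
      fix D assume "D \<in> rcosets\<^bsub>?G\<^esub> K"
      then obtain g where g: "g \<in> carrier ?G" "D = K #>\<^bsub>?G\<^esub> g" unfolding RCOSETS_def by blast
      then obtain ws where ws: "set ws \<subseteq> N" "g = isom ws" using car by blast
      have "act ws o' \<in> orbit_pts" unfolding orbit_pts_def using ws by blast
      then obtain ks where ks: "set ks \<subseteq> M" "act ks (act ws o') \<in> Y" using cover by blast
      have uk: "\<forall>v\<in>set ks. lorentz v v = 1" using uM ks by blast
      have kK: "isom ks \<in> K" using ks unfolding K_def by blast
      define h where "h = isom ks \<otimes>\<^bsub>?G\<^esub> g"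
      have hG: "h \<in> carrier ?G" unfolding h_def using kK KG g(1) by blast
      have "h = isom (ks @ ws)" unfolding h_def mult ws(2) by (rule isom_mult[OF uk unit_word[OF ws(1)]])
      then have ho: "h o' = act ks (act ws o')" using o by (simp add: isom_def)
      have "(SOME g. g \<in> carrier ?G \<and> g o' = h o') = h" using hG free by (intro some_equality) blast+
      moreover have "K #>\<^bsub>?G\<^esub> h = D"
        unfolding g(2) by (rule repr_independence[symmetric, OF _ g(1) K])
          (use kK in \<open>auto simp: r_coset_def h_def\<close>)
      ultimately have "D = (\<lambda>y. K #>\<^bsub>?G\<^esub> (SOME g. g \<in> carrier ?G \<and> g o' = y)) (h o')" by simp
      then show "D \<in> (\<lambda>y. K #>\<^bsub>?G\<^esub> (SOME g. g \<in> carrier ?G \<and> g o' = y)) ` Y"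
        using ks(2) ho by (intro image_eqI[of _ _ "h o'"]) simp_all
    qed
    have "finite (rcosets\<^bsub>?G\<^esub> K)" by (rule finite_subset[OF sub finite_imageI[OF Y(1)]])
    moreover have "real (card (rcosets\<^bsub>?G\<^esub> K)) \<le> C * (hyperbolic_dist x (\<gamma> x) + 1)"
      using surj_card_le[OF Y(1) sub] Y(2) unfolding hyperbolic_dist_def \<gamma>x by linarith
    ultimately show ?thesis using K \<gamma>K by blast
  qed
  then show ?thesis using C by (intro exI[of _ C] conjI ballI impI)
qed

end

section \<open>Geodesics under a totally geodesic immersion\<close>

lemma Basis_axis: "axis i (1::real) \<in> Basis"
  by (auto simp: Basis_vec_def)

lemma has_derivative_coord_deriv:
  fixes f :: "real^'k::finite \<Rightarrow> 'b::real_normed_vector"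
  assumes "f differentiable at x"
  shows "(f has_derivative (\<lambda>u. \<Sum>i\<in>UNIV. u $ i *\<^sub>R coord_deriv i f x)) (at x)"
proof -
  let ?D = "frechet_derivative f (at x)"
  have D: "(f has_derivative ?D) (at x)" using assms by (simp add: frechet_derivative_works)
  then have lin: "linear ?D" by (rule has_derivative_linear)
  have "?D u = (\<Sum>i\<in>UNIV. u $ i *\<^sub>R coord_deriv i f x)" for u
  proof -
    have "u = (\<Sum>i\<in>UNIV. u $ i *\<^sub>R axis i 1)"
      using basis_expansion[of u] by (simp add: scalar_mult_eq_scaleR)
    then have "?D u = ?D (\<Sum>i\<in>UNIV. u $ i *\<^sub>R axis i 1)" by simp
    also have "\<dots> = (\<Sum>i\<in>UNIV. u $ i *\<^sub>R ?D (axis i 1))"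
      by (simp add: linear_sum[OF lin] linear_scale[OF lin])
    finally show ?thesis by (simp add: partial_deriv_def)
  qed
  then have "?D = (\<lambda>u. \<Sum>i\<in>UNIV. u $ i *\<^sub>R coord_deriv i f x)" by (rule ext)
  with D show ?thesis by simp
qed

lemma has_vector_derivative_coord_deriv:
  fixes f :: "real^'k::finite \<Rightarrow> 'b::real_normed_vector"
  assumes f: "f differentiable at (\<xi> t)" and \<xi>: "(\<xi> has_vector_derivative v) (at t within S)"
  shows "((\<lambda>s. f (\<xi> s)) has_vector_derivative (\<Sum>i\<in>UNIV. v $ i *\<^sub>R coord_deriv i f (\<xi> t))) (at t within S)"
proof -
  have "((\<lambda>s. f (\<xi> s)) has_derivative
      (\<lambda>h. \<Sum>i\<in>UNIV. (h *\<^sub>R v) $ i *\<^sub>R coord_deriv i f (\<xi> t))) (at t within S)"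
    using has_derivative_compose[OF \<xi>[unfolded has_vector_derivative_def] has_derivative_coord_deriv[OF f]] .
  moreover have "(\<lambda>h. \<Sum>i\<in>UNIV. (h *\<^sub>R v) $ i *\<^sub>R coord_deriv i f (\<xi> t)) =
      (\<lambda>h. h *\<^sub>R (\<Sum>i\<in>UNIV. v $ i *\<^sub>R coord_deriv i f (\<xi> t)))"
    by (simp add: scaleR_sum_right)
  ultimately show ?thesis unfolding has_vector_derivative_def by simp
qed

text \<open>\<open>f\<close> expresses \<open>F\<close> in the pulled-back chart on the sheet
  \<open>V\<close>, whose coordinate map is \<open>coord c \<circ> p\<close> and whose Gram matrix
  is that of \<open>c\<close>; only two derivatives are extracted from smoothness.\<close>

lemma immersion_chart:
  assumes F: "totally_geodesic_isometric_immersion (pullback_atlas p A) F"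
    and c: "c \<in> A" "riemannian_chart c" and V: "open V" "inj_on p V" "p ` V \<subseteq> chart_dom c"
  obtains f where "\<And>y. y \<in> V \<Longrightarrow> F y = f (coord c (p y))"
    "\<And>y. y \<in> V \<Longrightarrow> f differentiable at (coord c (p y))"
    "\<And>y j. y \<in> V \<Longrightarrow> coord_deriv j f differentiable at (coord c (p y))"
    "\<And>y i j. y \<in> V \<Longrightarrow> lorentz (coord_deriv i f (coord c (p y))) (coord_deriv j f (coord c (p y)))
      = gram c (coord c (p y)) $ i $ j"
    "\<And>y i j. y \<in> V \<Longrightarrow> second_fundamental_form (gram c) f i j (coord c (p y)) = 0"
proof -
  define d where "d = \<lparr>chart_dom = V, coord = coord c \<circ> p, gram = gram c\<rparr>"
  have d: "d \<in> pullback_atlas p A" unfolding pullback_atlas_def d_def using c V by blast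
  define f where "f = F \<circ> param d"
  have sm: "smooth_on (chart_image d) f"
    and inn: "\<And>x i j. x \<in> chart_image d \<Longrightarrow> lorentz (coord_deriv i f x) (coord_deriv j f x) = gram d x $ i $ j"
    and sff: "\<And>x i j. x \<in> chart_image d \<Longrightarrow> second_fundamental_form (gram d) f i j x = 0"
    using F d unfolding totally_geodesic_isometric_immersion_def Let_def f_def by blast+
  have im: "coord c (p y) \<in> chart_image d" if "y \<in> V" for y
    using that by (simp add: chart_image_def d_def)
  have "inj_on (coord c) (chart_dom c)"
    using c(2) unfolding riemannian_chart_def homeomorphism_def by (metis inj_on_inverseI)
  then have inj: "inj_on (coord d) (chart_dom d)"
    using V(2,3) by (simp add: d_def comp_inj_on inj_on_subset)
  have "F y = f (coord c (p y))" if "y \<in> V" for y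
    using inv_into_f_f[OF inj, of y] that by (simp add: f_def param_def d_def)
  moreover have "f differentiable at x" "coord_deriv j f differentiable at x" if x: "x \<in> chart_image d" for x j
  proof -
    have "Ck_on (Suc (Suc 0)) (chart_image d) f" using sm unfolding smooth_on_def by blast
    then show "f differentiable at x" "coord_deriv j f differentiable at x"
      using x Basis_axis[of j] unfolding Ck_on.simps by blast+
  qed
  ultimately show ?thesis
    using that[of f] im inn sff by (simp add: d_def)
qed

text \<open>The chain rule expresses the acceleration of \<open>F \<circ> G\<close> by second
  derivatives of \<open>f\<close>. The vanishing second fundamental form turns their tangential part
  into Christoffel terms, which the geodesic equation cancels; only a multiple of the position
  vector is left.\<close>

lemma geodesic_local:
  fixes F :: "'u::topological_space \<Rightarrow> (real^'m::finite) \<times> real"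
    and A :: "('a::topological_space, 'k::finite) rchart set"
  assumes p: "covering_space UNIV p UNIV"
    and F: "totally_geodesic_isometric_immersion (pullback_atlas p A) F"
    and c: "c \<in> A" "riemannian_chart c"
    and G: "continuous_on {0..1} G" "\<And>s. s \<in> {0..1} \<Longrightarrow> p (G s) = \<gamma> s"
    and t: "t \<in> {0..1}" "\<gamma> t \<in> chart_dom c"
    and v: "\<And>s. \<gamma> s \<in> chart_dom c \<Longrightarrow> ((coord c \<circ> \<gamma>) has_vector_derivative v s) (at s)"
    and a: "\<And>s. \<gamma> s \<in> chart_dom c \<Longrightarrow> (v has_vector_derivative a s) (at s)"
    and ode: "\<And>s l. \<gamma> s \<in> chart_dom c \<Longrightarrow> a s $ l + (\<Sum>i\<in>UNIV. \<Sum>j\<in>UNIV.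
           christoffel (gram c) l i j (coord c (\<gamma> s)) * v s $ i * v s $ j) = 0"
  obtains \<delta> D q where "\<delta> > 0"
    "\<And>s. s \<in> {0..1} \<Longrightarrow> dist s t < \<delta> \<Longrightarrow> ((F \<circ> G) has_vector_derivative D s) (at s within {0..1})"
    "(D has_vector_derivative q *\<^sub>R F (G t)) (at t within {0..1})"
    "lorentz (D t) (D t) = metric_inner (gram c (coord c (\<gamma> t))) (v t) (v t)"
proof -
  let ?I = "{0..1::real}"
  obtain T \<V> where T: "p (G t) \<in> T" "open T" and sheets: "\<Union>\<V> = p -` T" "\<forall>V\<in>\<V>. open V"
    and homeo: "\<forall>V\<in>\<V>. \<exists>q. homeomorphism V T p q"
    by (rule covering_sheets[OF p, of "p (G t)"])
  obtain V0 where V0: "V0 \<in> \<V>" "G t \<in> V0" using T(1) sheets(1) by (metis UnionE vimageI)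
  define V where "V = V0 \<inter> p -` chart_dom c"
  have "continuous_on UNIV p" using p by (simp add: covering_space_def)
  then have "open (p -` chart_dom c)" using c(2) by (simp add: open_vimage riemannian_chart_def)
  moreover have "open V0" using V0(1) sheets(2) by blast
  ultimately have V1: "open V" unfolding V_def by (rule open_Int[rotated])
  obtain q where "homeomorphism V0 T p q" using homeo V0(1) by blast
  then have "inj_on p V0" unfolding homeomorphism_def by (metis inj_on_inverseI)
  then have V: "open V" "inj_on p V" "p ` V \<subseteq> chart_dom c"
    using V1 by (auto simp: V_def intro: inj_on_subset)
  have GV: "G t \<in> V" using V0(2) t(2) G(2)[OF t(1)] by (simp add: V_def)
  obtain f where f: "\<And>y. y \<in> V \<Longrightarrow> F y = f (coord c (p y))"
    "\<And>y. y \<in> V \<Longrightarrow> f differentiable at (coord c (p y))"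
    "\<And>y j. y \<in> V \<Longrightarrow> coord_deriv j f differentiable at (coord c (p y))"
    "\<And>y i j. y \<in> V \<Longrightarrow> lorentz (coord_deriv i f (coord c (p y))) (coord_deriv j f (coord c (p y)))
      = gram c (coord c (p y)) $ i $ j"
    "\<And>y i j. y \<in> V \<Longrightarrow> second_fundamental_form (gram c) f i j (coord c (p y)) = 0"
    using immersion_chart[OF F c V] by blast
  obtain B where B: "open B" "t \<in> B" "\<forall>s\<in>?I. s \<in> B \<longrightarrow> G s \<in> V"
    using G(1) t(1) V(1) GV unfolding continuous_on_topological by blast
  then obtain \<delta> where \<delta>: "\<delta> > 0" "ball t \<delta> \<subseteq> B" using openE by blast
  have near: "G s \<in> V" "\<gamma> s \<in> chart_dom c" if "s \<in> ?I" "dist s t < \<delta>" for s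
  proof -
    have "s \<in> ball t \<delta>" using that(2) by (simp add: dist_commute)
    then show "G s \<in> V" using that(1) B(3) \<delta>(2) by blast
    then show "\<gamma> s \<in> chart_dom c" using V(3) G(2)[OF that(1)] by auto
  qed
  define \<xi> where "\<xi> = coord c \<circ> \<gamma>"
  have \<xi>G: "coord c (p (G s)) = \<xi> s" if "s \<in> ?I" for s using G(2)[OF that] by (simp add: \<xi>_def)
  have \<xi>: "(\<xi> has_vector_derivative v s) (at s within ?I)" if "s \<in> ?I" "dist s t < \<delta>" for s
    unfolding \<xi>_def by (rule has_vector_derivative_at_within[OF v[OF near(2)[OF that]]])
  define D where "D = (\<lambda>s. \<Sum>j\<in>UNIV. v s $ j *\<^sub>R coord_deriv j f (\<xi> s))"
  have 1: "((F \<circ> G) has_vector_derivative D s) (at s within ?I)" if s: "s \<in> ?I" "dist s t < \<delta>" for s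
  proof (rule has_vector_derivative_transform_within[where d = "\<delta> - dist s t"])
    show "((\<lambda>s. f (\<xi> s)) has_vector_derivative D s) (at s within ?I)"
      unfolding D_def using f(2)[OF near(1)[OF s]] \<xi>[OF s] \<xi>G[OF s(1)]
      by (intro has_vector_derivative_coord_deriv) simp_all
    show "0 < \<delta> - dist s t" "s \<in> ?I" using s by simp_all
    fix r assume r: "r \<in> ?I" "dist r s < \<delta> - dist s t"
    then have "dist r t < \<delta>" using dist_triangle[of r t s] by linarith
    then show "f (\<xi> r) = (F \<circ> G) r" using f(1)[OF near(1)[OF r(1)]] \<xi>G[OF r(1)] by simp
  qed
  have tt: "dist t t < \<delta>" using \<delta> by simp
  note Gt = near(1)[OF t(1) tt] and \<xi>t = \<xi>G[OF t(1)]
  define x where "x = \<xi> t"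
  define X2 where "X2 = (\<Sum>j\<in>UNIV. v t $ j *\<^sub>R (\<Sum>i\<in>UNIV. v t $ i *\<^sub>R coord_deriv i (coord_deriv j f) x)
      + a t $ j *\<^sub>R coord_deriv j f x)"
  have 2: "(D has_vector_derivative X2) (at t within ?I)"
    unfolding D_def X2_def x_def
  proof (intro has_vector_derivative_sum has_vector_derivative_scaleR)
    fix j
    have "((\<lambda>s. v s $ j) has_vector_derivative a t $ j) (at t within ?I)"
      by (rule bounded_linear.has_vector_derivative[OF bounded_linear_vec_nth])
        (rule has_vector_derivative_at_within[OF a[OF t(2)]])
    then show "((\<lambda>s. v s $ j) has_real_derivative a t $ j) (at t within ?I)"
      by (simp add: has_real_derivative_iff_has_vector_derivative)
    show "((\<lambda>s. coord_deriv j f (\<xi> s)) has_vector_derivative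
        (\<Sum>i\<in>UNIV. v t $ i *\<^sub>R coord_deriv i (coord_deriv j f) (\<xi> t))) (at t within ?I)"
      using f(3)[OF Gt] \<xi>t \<xi>[OF t(1) tt] by (intro has_vector_derivative_coord_deriv) simp_all
  qed
  let ?H = "\<lambda>i j. coord_deriv i (coord_deriv j f) x"
  \<comment> \<open>The normal component that \<open>tangent_proj\<close> removes from the second
    derivatives. Its exact value is immaterial here; the constraint to the hyperboloid determines it
    later.\<close>
  define q where "q = - (\<Sum>j\<in>UNIV. \<Sum>i\<in>UNIV. v t $ j * v t $ i * lorentz (?H i j) (f x))"
  have H: "?H i j = (\<Sum>l\<in>UNIV. christoffel (gram c) l i j x *\<^sub>R coord_deriv l f x)
      - lorentz (?H i j) (f x) *\<^sub>R f x" for i j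
    using f(5)[OF Gt, of i j] unfolding \<xi>t x_def second_fundamental_form_def tangent_proj_def
    by (simp add: algebra_simps)
  have "(\<Sum>j\<in>UNIV. v t $ j *\<^sub>R (\<Sum>i\<in>UNIV. v t $ i *\<^sub>R ?H i j))
      = (\<Sum>j\<in>UNIV. \<Sum>i\<in>UNIV. (v t $ j * v t $ i) *\<^sub>R ?H i j)"
    by (simp add: scaleR_sum_right)
  also have "\<dots> = (\<Sum>j\<in>UNIV. \<Sum>i\<in>UNIV.
        (\<Sum>l\<in>UNIV. (christoffel (gram c) l i j x * v t $ i * v t $ j) *\<^sub>R coord_deriv l f x)
      - (v t $ j * v t $ i * lorentz (?H i j) (f x)) *\<^sub>R f x)"
    by (subst H) (simp add: scaleR_diff_right scaleR_sum_right mult_ac)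
  also have "\<dots> = (\<Sum>j\<in>UNIV. \<Sum>i\<in>UNIV. \<Sum>l\<in>UNIV.
        (christoffel (gram c) l i j x * v t $ i * v t $ j) *\<^sub>R coord_deriv l f x) + q *\<^sub>R f x"
    by (simp add: q_def sum_subtractf scaleR_sum_left)
  also have "(\<Sum>j\<in>UNIV. \<Sum>i\<in>UNIV. \<Sum>l\<in>UNIV.
        (christoffel (gram c) l i j x * v t $ i * v t $ j) *\<^sub>R coord_deriv l f x) =
      (\<Sum>j\<in>UNIV. \<Sum>l\<in>UNIV. \<Sum>i\<in>UNIV.
        (christoffel (gram c) l i j x * v t $ i * v t $ j) *\<^sub>R coord_deriv l f x)"
    by (intro sum.cong HOL.refl sum.swap)
  also have "\<dots> = (\<Sum>l\<in>UNIV. \<Sum>j\<in>UNIV. \<Sum>i\<in>UNIV.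
        (christoffel (gram c) l i j x * v t $ i * v t $ j) *\<^sub>R coord_deriv l f x)"
    by (rule sum.swap)
  also have "\<dots> = (\<Sum>l\<in>UNIV. (\<Sum>i\<in>UNIV. \<Sum>j\<in>UNIV.
        christoffel (gram c) l i j x * v t $ i * v t $ j) *\<^sub>R coord_deriv l f x)"
    by (intro sum.cong HOL.refl) (subst sum.swap, simp add: scaleR_sum_left)
  also have "\<dots> = (\<Sum>l\<in>UNIV. - a t $ l *\<^sub>R coord_deriv l f x)"
    using ode[OF t(2)] by (intro sum.cong HOL.refl arg_cong2[where f = scaleR])
      (simp_all add: x_def \<xi>_def eq_neg_iff_add_eq_0 add.commute)
  finally have "X2 = q *\<^sub>R f x" unfolding X2_def by (simp add: sum.distrib sum_negf)
  moreover have "f x = F (G t)" using f(1)[OF Gt] \<xi>t by (simp add: x_def)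
  moreover have "lorentz (D t) (D t) = metric_inner (gram c (coord c (\<gamma> t))) (v t) (v t)"
  proof -
    have "lorentz (D t) (D t) = (\<Sum>j\<in>UNIV. \<Sum>i\<in>UNIV. v t $ j * (v t $ i * gram c x $ i $ j))"
      unfolding D_def lorentz.sum_left lorentz.sum_right lorentz.scaleR_left lorentz.scaleR_right
      using f(4)[OF Gt] \<xi>t by (simp add: x_def sum_distrib_left)
    also have "\<dots> = (\<Sum>i\<in>UNIV. \<Sum>j\<in>UNIV. v t $ j * (v t $ i * gram c x $ i $ j))" by (rule sum.swap)
    also have "\<dots> = metric_inner (gram c x) (v t) (v t)"
      by (simp add: metric_inner_def inner_vec_def matrix_vector_mult_def sum_distrib_left mult_ac)
    finally show ?thesis by (simp add: x_def \<xi>_def)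
  qed
  ultimately show ?thesis using that[OF \<delta>(1) 1] 2 by simp
qed

text \<open>Both \<open>\<kappa> * y t * cosh (\<kappa> * t) - y' t * sinh (\<kappa> * t)\<close>
  and the expression with \<open>sinh\<close> and \<open>cosh\<close> exchanged are constant along
  solutions; eliminating \<open>y'\<close> leaves \<open>y\<close>, up to the factor
  \<open>\<kappa>\<close>, so \<open>\<kappa> = 0\<close> is treated separately.\<close>

lemma oscillation_cosh:
  fixes y y' :: "real \<Rightarrow> real"
  assumes y: "\<And>t. t \<in> {0..1} \<Longrightarrow> (y has_real_derivative y' t) (at t within {0..1})"
    and y': "\<And>t. t \<in> {0..1} \<Longrightarrow> (y' has_real_derivative \<kappa>\<^sup>2 * y t) (at t within {0..1})"
    and 0: "y 0 = 1" "y' 0 = 0" and t: "t \<in> {0..1}"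
  shows "y t = cosh (\<kappa> * t)"
proof -
  have const: "g t = g 0" if "\<And>t. t \<in> {0..1} \<Longrightarrow> (g has_real_derivative 0) (at t within {0..1})" for g :: "real \<Rightarrow> real"
    using has_field_derivative_zero_constant[of "{0..1}" g] that t by force
  have "\<kappa> * y t * cosh (\<kappa> * t) - y' t * sinh (\<kappa> * t) = \<kappa> * y 0 * cosh (\<kappa> * 0) - y' 0 * sinh (\<kappa> * 0)"
    by (rule const) (auto intro!: derivative_eq_intros y y' simp: power2_eq_square)
  moreover have "\<kappa> * y t * sinh (\<kappa> * t) - y' t * cosh (\<kappa> * t) = \<kappa> * y 0 * sinh (\<kappa> * 0) - y' 0 * cosh (\<kappa> * 0)"
    by (rule const) (auto intro!: derivative_eq_intros y y' simp: power2_eq_square)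
  ultimately have 1: "\<kappa> * y t * cosh (\<kappa> * t) - y' t * sinh (\<kappa> * t) = \<kappa>"
    and 2: "\<kappa> * y t * sinh (\<kappa> * t) = y' t * cosh (\<kappa> * t)" using 0 by simp_all
  show ?thesis
  proof (cases "\<kappa> = 0")
    case True
    then have "y' s = y' 0" if "s \<in> {0..1}" for s
      using has_field_derivative_zero_constant[of "{0..1}" y'] y' that by force
    then have "y t = y 0" using y 0 by (intro const) auto
    then show ?thesis using True 0 by simp
  next
    case False
    have "\<kappa> * y t * ((cosh (\<kappa> * t))\<^sup>2 - (sinh (\<kappa> * t))\<^sup>2)
        = (\<kappa> * y t * cosh (\<kappa> * t)) * cosh (\<kappa> * t) - (\<kappa> * y t * sinh (\<kappa> * t)) * sinh (\<kappa> * t)"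
      by (simp add: algebra_simps power2_eq_square)
    also have "\<dots> = (\<kappa> * y t * cosh (\<kappa> * t) - y' t * sinh (\<kappa> * t)) * cosh (\<kappa> * t)"
      unfolding 2 by (simp add: algebra_simps)
    also have "\<dots> = \<kappa> * cosh (\<kappa> * t)" unfolding 1 ..
    finally have "\<kappa> * y t * ((cosh (\<kappa> * t))\<^sup>2 - (sinh (\<kappa> * t))\<^sup>2) = \<kappa> * cosh (\<kappa> * t)" .
    then show ?thesis using False by (simp add: cosh_square_eq)
  qed
qed

lemma geodesic_displacement:
  fixes F :: "'u::topological_space \<Rightarrow> (real^'m::finite) \<times> real"
    and A :: "('a::topological_space, 'k::finite) rchart set"
  assumes A: "riemannian_atlas A" and p: "covering_space UNIV p UNIV"
    and F: "totally_geodesic_isometric_immersion (pullback_atlas p A) F"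
    and \<gamma>: "geodesic_line A \<gamma>"
    and G: "continuous_on {0..1} G" "\<And>s. s \<in> {0..1} \<Longrightarrow> p (G s) = \<gamma> s"
    and nonconst: "\<exists>t\<in>{0..1}. \<gamma> t \<noteq> \<gamma> 0"
  shows "F (G 1) \<noteq> F (G 0)" "hyperbolic_dist (F (G 0)) (F (G 1)) = curve_length A \<gamma>"
proof -
  let ?I = "{0..1::real}"
  define X where "X = F \<circ> G"
  \<comment> \<open>Defined without reference to charts, so that the derivatives obtained chart by
    chart are values of one function on the whole interval.\<close>
  define X1 where "X1 = (\<lambda>t. vector_derivative X (at t within ?I))"
  have H: "X t \<in> hyperbolic_space" for t
    using F unfolding totally_geodesic_isometric_immersion_def X_def by auto
  have XX: "lorentz (X t) (X t) = -1" for t by (rule hyperbolic_spaceD(1)[OF H])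
  have chart: "\<exists>c\<in>A. \<gamma> t \<in> chart_dom c" for t
    using A unfolding riemannian_atlas_def by blast
  have rc: "riemannian_chart c" if "c \<in> A" for c using A that unfolding riemannian_atlas_def by blast
  have local: "\<exists>v q. (\<forall>s. \<gamma> s \<in> chart_dom c \<longrightarrow> ((coord c \<circ> \<gamma>) has_vector_derivative v s) (at s)) \<and>
      (\<forall>t\<in>?I. \<gamma> t \<in> chart_dom c \<longrightarrow>
        (X has_vector_derivative X1 t) (at t within ?I) \<and>
        (X1 has_vector_derivative q t *\<^sub>R X t) (at t within ?I) \<and>
        lorentz (X1 t) (X1 t) = metric_inner (gram c (coord c (\<gamma> t))) (v t) (v t))" if c: "c \<in> A" for c
  proof -
    obtain v a where va: "\<forall>t. \<gamma> t \<in> chart_dom c \<longrightarrow>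
        ((coord c \<circ> \<gamma>) has_vector_derivative v t) (at t) \<and>
        (v has_vector_derivative a t) (at t) \<and>
        (\<forall>l. a t $ l + (\<Sum>i\<in>UNIV. \<Sum>j\<in>UNIV.
           christoffel (gram c) l i j (coord c (\<gamma> t)) * v t $ i * v t $ j) = 0)"
      using \<gamma> c unfolding geodesic_line_def by blast
    have "\<exists>q. (X has_vector_derivative X1 t) (at t within ?I) \<and>
        (X1 has_vector_derivative q *\<^sub>R X t) (at t within ?I) \<and>
        lorentz (X1 t) (X1 t) = metric_inner (gram c (coord c (\<gamma> t))) (v t) (v t)"
      if t: "t \<in> ?I" "\<gamma> t \<in> chart_dom c" for t
    proof -
      obtain \<delta> D q where \<delta>: "\<delta> > 0"
        and D: "\<And>s. s \<in> ?I \<Longrightarrow> dist s t < \<delta> \<Longrightarrow> ((F \<circ> G) has_vector_derivative D s) (at s within ?I)"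
        and D': "(D has_vector_derivative q *\<^sub>R F (G t)) (at t within ?I)"
        and sp: "lorentz (D t) (D t) = metric_inner (gram c (coord c (\<gamma> t))) (v t) (v t)"
        by (rule geodesic_local[OF p F c rc[OF c] G t, of v a]) (use va in blast)+
      have X1: "X1 s = D s" if "s \<in> ?I" "dist s t < \<delta>" for s
        unfolding X1_def X_def using that(1) by (intro vector_derivative_within_closed_interval D that) auto
      have "(X1 has_vector_derivative q *\<^sub>R X t) (at t within ?I)"
        using D' X1 \<delta> t(1) unfolding X_def comp_def
        by (intro has_vector_derivative_transform_within[OF D' \<delta> t(1), of X1]) auto
      then show ?thesis using D[OF t(1)] sp X1[OF t(1)] \<delta> by (intro exI[of _ q]) (simp add: X_def)
    qed
    then obtain q where "\<forall>t\<in>?I. \<gamma> t \<in> chart_dom c \<longrightarrow>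
        (X has_vector_derivative X1 t) (at t within ?I) \<and>
        (X1 has_vector_derivative q t *\<^sub>R X t) (at t within ?I) \<and>
        lorentz (X1 t) (X1 t) = metric_inner (gram c (coord c (\<gamma> t))) (v t) (v t)" by metis
    then show ?thesis using va by blast
  qed
  have X: "(X has_vector_derivative X1 t) (at t within ?I)" if "t \<in> ?I" for t
    using chart[of t] local that by blast
  have X1X: "lorentz (X1 t) (X t) = 0" if t: "t \<in> ?I" for t
  proof -
    have "((\<lambda>s. lorentz (X s) (X s)) has_vector_derivative lorentz (X t) (X1 t) + lorentz (X1 t) (X t))
        (at t within ?I)"
      by (rule lorentz.has_vector_derivative[OF X[OF t] X[OF t]])
    moreover have "((\<lambda>s. lorentz (X s) (X s)) has_vector_derivative 0) (at t within ?I)"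
      unfolding XX by (rule has_vector_derivative_const)
    ultimately have "lorentz (X t) (X1 t) + lorentz (X1 t) (X t) = 0"
      using t by (intro vector_derivative_unique_within[of t ?I]) (auto simp: trivial_limit_within islimpt_Icc)
    then show ?thesis by (simp add: lorentz_commute[of "X t" "X1 t"])
  qed
  \<comment> \<open>Differentiating the relation \<open>lorentz (X1 t) (X t) = 0\<close> identifies
    the unknown factor \<open>q\<close> with the squared speed, which is then seen to be
    constant.\<close>
  have X2: "(X1 has_vector_derivative lorentz (X1 t) (X1 t) *\<^sub>R X t) (at t within ?I)" if t: "t \<in> ?I" for t
  proof -
    obtain q where q: "(X1 has_vector_derivative q *\<^sub>R X t) (at t within ?I)"
      using chart[of t] local t by blast
    have "((\<lambda>s. lorentz (X1 s) (X s)) has_vector_derivative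
        lorentz (X1 t) (X1 t) + lorentz (q *\<^sub>R X t) (X t)) (at t within ?I)"
      by (rule lorentz.has_vector_derivative[OF q X[OF t]])
    moreover have "((\<lambda>s. lorentz (X1 s) (X s)) has_vector_derivative 0) (at t within ?I)"
      by (rule has_vector_derivative_transform[OF t _ has_vector_derivative_const]) (rule X1X)
    ultimately have "lorentz (X1 t) (X1 t) + lorentz (q *\<^sub>R X t) (X t) = 0"
      using t by (intro vector_derivative_unique_within[of t ?I]) (auto simp: trivial_limit_within islimpt_Icc)
    then have "q = lorentz (X1 t) (X1 t)" by (simp add: lorentz_simps XX)
    with q show ?thesis by simp
  qed
  define \<kappa> where "\<kappa> = sqrt (lorentz (X1 0) (X1 0))"
  have const: "lorentz (X1 t) (X1 t) = lorentz (X1 0) (X1 0)" if t: "t \<in> ?I" for t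
  proof -
    have "((\<lambda>s. lorentz (X1 s) (X1 s)) has_derivative (\<lambda>h. 0)) (at s within ?I)" if s: "s \<in> ?I" for s
    proof -
      have "((\<lambda>s. lorentz (X1 s) (X1 s)) has_vector_derivative
          lorentz (X1 s) (lorentz (X1 s) (X1 s) *\<^sub>R X s) + lorentz (lorentz (X1 s) (X1 s) *\<^sub>R X s) (X1 s))
          (at s within ?I)"
        by (rule lorentz.has_vector_derivative[OF X2[OF s] X2[OF s]])
      then show ?thesis
        using X1X[OF s] by (simp add: lorentz_simps lorentz_commute[of "X s" "X1 s"] has_vector_derivative_def)
    qed
    then obtain k where "\<forall>s\<in>?I. lorentz (X1 s) (X1 s) = k"
      using has_derivative_zero_constant[of ?I "\<lambda>s. lorentz (X1 s) (X1 s)"] by auto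
    then show ?thesis using t by simp
  qed
  have pos: "metric_inner (gram c (coord c (\<gamma> t))) u u \<ge> 0" "metric_inner (gram c (coord c (\<gamma> t))) u u = 0 \<Longrightarrow> u = 0"
    if "c \<in> A" "\<gamma> t \<in> chart_dom c" for c t u
  proof -
    have "coord c (\<gamma> t) \<in> chart_image c" using that by (simp add: chart_image_def)
    then have *: "u \<noteq> 0 \<Longrightarrow> metric_inner (gram c (coord c (\<gamma> t))) u u > 0"
      using rc[OF that(1)] unfolding riemannian_chart_def by blast
    then show "metric_inner (gram c (coord c (\<gamma> t))) u u \<ge> 0"
      by (cases "u = 0") (auto simp: metric_inner_def less_imp_le)
    show "metric_inner (gram c (coord c (\<gamma> t))) u u = 0 \<Longrightarrow> u = 0" using * by auto
  qed
  have \<kappa>: "\<kappa> \<ge> 0" "\<kappa>\<^sup>2 = lorentz (X1 0) (X1 0)"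
  proof -
    obtain c where c: "c \<in> A" "\<gamma> 0 \<in> chart_dom c" using chart by blast
    then have "lorentz (X1 0) (X1 0) \<ge> 0" using local[OF c(1)] pos(1)[OF c] by fastforce
    then show "\<kappa> \<ge> 0" "\<kappa>\<^sup>2 = lorentz (X1 0) (X1 0)" by (simp_all add: \<kappa>_def)
  qed
  have sp: "speed A \<gamma> t = \<kappa>" if t: "t \<in> ?I" for t
  proof -
    define c where "c = (SOME c. c \<in> A \<and> \<gamma> t \<in> chart_dom c)"
    have c: "c \<in> A" "\<gamma> t \<in> chart_dom c" using someI_ex[of "\<lambda>c. c \<in> A \<and> \<gamma> t \<in> chart_dom c"] chart[of t]
      unfolding c_def by blast+
    then obtain v where v: "((coord c \<circ> \<gamma>) has_vector_derivative v t) (at t)"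
      "lorentz (X1 t) (X1 t) = metric_inner (gram c (coord c (\<gamma> t))) (v t) (v t)"
      using local[OF c(1)] t by blast
    have "vector_derivative (coord c \<circ> \<gamma>) (at t) = v t" by (rule vector_derivative_at[OF v(1)])
    then show ?thesis unfolding speed_def Let_def c_def[symmetric] using v(2) const[OF t] by (simp add: \<kappa>_def)
  qed
  have len: "curve_length A \<gamma> = \<kappa>"
  proof -
    have "integral ?I (speed A \<gamma>) = integral ?I (\<lambda>_. \<kappa>)" by (rule integral_cong) (rule sp)
    then show ?thesis by (simp add: curve_length_def)
  qed
  have "\<kappa> \<noteq> 0"
  proof
    assume "\<kappa> = 0"
    \<comment> \<open>With zero speed the curve is locally constant in every chart, hence constant
      on the connected interval, which \<open>nonconst\<close> excludes.\<close>
    have "eventually (\<lambda>s. \<gamma> t = \<gamma> s) (at t within ?I)" if t: "t \<in> ?I" for t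
    proof -
      obtain c where c: "c \<in> A" "\<gamma> t \<in> chart_dom c" using chart by blast
      obtain v where v: "\<forall>s. \<gamma> s \<in> chart_dom c \<longrightarrow> ((coord c \<circ> \<gamma>) has_vector_derivative v s) (at s)"
        "\<forall>s\<in>?I. \<gamma> s \<in> chart_dom c \<longrightarrow> lorentz (X1 s) (X1 s) = metric_inner (gram c (coord c (\<gamma> s))) (v s) (v s)"
        using local[OF c(1)] by blast
      have "open (\<gamma> -` chart_dom c)"
        using \<gamma> rc[OF c(1)] by (intro open_vimage) (auto simp: geodesic_line_def riemannian_chart_def)
      then obtain \<delta> where \<delta>: "\<delta> > 0" "ball t \<delta> \<subseteq> \<gamma> -` chart_dom c" using c(2) openE by blast
      have "((coord c \<circ> \<gamma>) has_derivative (\<lambda>h. 0)) (at s within ?I \<inter> ball t \<delta>)" if s: "s \<in> ?I \<inter> ball t \<delta>" for s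
      proof -
        have sc: "\<gamma> s \<in> chart_dom c" using s \<delta>(2) by blast
        then have "metric_inner (gram c (coord c (\<gamma> s))) (v s) (v s) = 0"
          using v(2) s const[of s] \<kappa>(2) \<open>\<kappa> = 0\<close> by simp
        then have "v s = 0" by (rule pos(2)[OF c(1) sc])
        then have "((coord c \<circ> \<gamma>) has_derivative (\<lambda>h. 0)) (at s)"
          using v(1)[rule_format, OF sc] by (simp add: has_vector_derivative_def)
        then show ?thesis by (rule has_derivative_at_withinI)
      qed
      then obtain k where k: "\<forall>s\<in>?I \<inter> ball t \<delta>. (coord c \<circ> \<gamma>) s = k"
        using has_derivative_zero_constant[of "?I \<inter> ball t \<delta>" "coord c \<circ> \<gamma>"] by (auto simp: convex_Int)
      have "inj_on (coord c) (chart_dom c)"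
        using rc[OF c(1)] unfolding riemannian_chart_def homeomorphism_def by (metis inj_on_inverseI)
      then have "\<gamma> t = \<gamma> s" if "s \<in> ?I \<inter> ball t \<delta>" for s
        using k that t \<delta> c(2) by (intro inj_onD[of "coord c" "chart_dom c"]) auto
      then show ?thesis unfolding eventually_at using \<delta>(1) by (intro exI[of _ \<delta>]) (auto simp: dist_commute)
    qed
    then have "\<gamma> t = \<gamma> 0" if "t \<in> ?I" for t
      using connected_local_const[of ?I t 0 \<gamma>] that by auto
    then show False using nonconst by blast
  qed
  with \<kappa>(1) have \<kappa>0: "\<kappa> > 0" by simp
  have "- lorentz (X 1) (X 0) = cosh (\<kappa> * 1)"
  proof (rule oscillation_cosh[where y' = "\<lambda>t. - lorentz (X1 t) (X 0)"])
    have bl: "bounded_linear (\<lambda>x. - lorentz x (X 0))"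
      by (intro bounded_linear_minus lorentz.bounded_linear_left)
    show "((\<lambda>t. - lorentz (X t) (X 0)) has_real_derivative - lorentz (X1 t) (X 0)) (at t within ?I)" if "t \<in> ?I" for t
      unfolding has_real_derivative_iff_has_vector_derivative
      by (rule bounded_linear.has_vector_derivative[OF bl X[OF that]])
    show "((\<lambda>t. - lorentz (X1 t) (X 0)) has_real_derivative \<kappa>\<^sup>2 * - lorentz (X t) (X 0)) (at t within ?I)" if "t \<in> ?I" for t
      using bounded_linear.has_vector_derivative[OF bl X2[OF that]] const[OF that] \<kappa>(2)
      unfolding has_real_derivative_iff_has_vector_derivative by (simp add: lorentz_simps)
  qed (use XX X1X[of 0] in auto)
  then have c: "- lorentz (X 0) (X 1) = cosh \<kappa>" by (simp add: lorentz_commute[of "X 0" "X 1"])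
  show "hyperbolic_dist (F (G 0)) (F (G 1)) = curve_length A \<gamma>"
    using c \<kappa>0 by (simp add: hyperbolic_dist_def len X_def arcosh_cosh_real)
  show "F (G 1) \<noteq> F (G 0)"
  proof
    assume "F (G 1) = F (G 0)"
    then have "cosh \<kappa> = 1" using c XX[of 0] by (simp add: X_def)
    then show False using \<kappa>0 cosh_real_strict_mono[of 0 \<kappa>] by simp
  qed
qed

section \<open>The linear bound\<close>

theorem corollary4p4:
  fixes A :: "('a::{t2_space, second_countable_topology}, 'k::finite) rchart set"
    and p :: "'u::topological_space \<Rightarrow> 'a"
    and b :: 'u
    and P :: "((real^'m::finite) \<times> real) set"
    and f :: "'a \<Rightarrow> ((real^'m) \<times> real) set"
  assumes "hyperbolic_manifold A"
    and "universal_covering p"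
    and "CARD('m) = 3 \<or> CARD('m) = 4"
    and "all_right_polyhedron P"
    and "compact P"
    and "totally_geodesic_immersion A p b P f"
  shows "growth_le (geodesic_rf A (p b)) (\<lambda>n. n)"
proof -
  let ?\<pi> = "fundamental_group (p b)" and ?\<Gamma> = "reflection_group P"
  have A: "riemannian_atlas A" using assms(1) by (simp add: hyperbolic_manifold_def)
  have p: "covering_space UNIV p UNIV" using assms(2) by (simp add: universal_covering_def)
  obtain F \<phi> where F: "totally_geodesic_isometric_immersion (pullback_atlas p A) F"
    and \<phi>: "\<phi> \<in> hom ?\<pi> ?\<Gamma>"
    and equivariant: "\<And>\<alpha> y z. \<alpha> \<in> carrier ?\<pi> \<Longrightarrow> deck_action p b \<alpha> y z \<Longrightarrow> F z = \<phi> \<alpha> (F y)"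
    using assms(6) unfolding totally_geodesic_immersion_def by blast
  have "CARD('m) \<ge> 2" using assms(3) by auto
  then obtain o' where "compact_polyhedron P {v. facet_normal P v} o'"
    using all_right_polyhedron_facets[OF assms(4,5)] by blast
  then interpret compact_polyhedron P "{v. facet_normal P v}" o' .
  obtain C where C: "C > 0" and sep: "\<forall>\<gamma>\<in>carrier ?\<Gamma>. \<forall>x\<in>hyperbolic_space. \<gamma> x \<noteq> x \<longrightarrow>
    (\<exists>K. subgroup K ?\<Gamma> \<and> \<gamma> \<notin> K \<and> finite (rcosets\<^bsub>?\<Gamma>\<^esub> K) \<and>
      real (card (rcosets\<^bsub>?\<Gamma>\<^esub> K)) \<le> C * (hyperbolic_dist x (\<gamma> x) + 1))"
    using reflection_group_separation[OF HOL.refl] by (elim exE conjE)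
  have bound: "divisibility ?\<pi> \<alpha> \<le> enat (nat \<lfloor>C * (r + 2)\<rfloor>)"
    if \<alpha>: "\<alpha> \<in> carrier ?\<pi>" "\<alpha> \<noteq> \<one>\<^bsub>?\<pi>\<^esub>" and len: "geodesic_length A \<alpha> \<le> ereal r" for \<alpha> r
  proof -
    \<comment> \<open>The length is an infimum: a finite upper bound yields a geodesic
      representative, and the slack 1 avoids asking whether the infimum is attained. With the 1 in
      the index bound this gives \<open>r + 2\<close>.\<close>
    have "geodesic_length A \<alpha> < ereal (r + 1)" using len by (rule le_less_trans) simp
    then obtain \<gamma> where \<gamma>: "geodesic_representative A \<alpha> \<gamma>" and "curve_length A \<gamma> < r + 1"
      unfolding geodesic_length_def INF_less_iff by auto
    then obtain c where line: "geodesic_line A \<gamma>" and c: "c \<in> \<alpha>" "homotopic_loops UNIV c \<gamma>"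
      unfolding geodesic_representative_def by blast
    obtain G where G: "continuous_on {0..1} G" "\<And>t. t \<in> {0..1} \<Longrightarrow> p (G t) = \<gamma> t"
      and deck: "deck_action p b \<alpha> (G 0) (G 1)"
      using homotopic_loops_lift[OF p c(1) \<alpha>(1) c(2)] by blast
    have "\<exists>t\<in>{0..1}. \<gamma> t \<noteq> \<gamma> 0" using homotopic_loops_const_imp_one[OF \<alpha>(1) c] \<alpha>(2) by blast
    note disp = geodesic_displacement[OF A p F line G this]
    have eq: "F (G 1) = \<phi> \<alpha> (F (G 0))" by (rule equivariant[OF \<alpha>(1) deck])
    have "\<phi> \<alpha> \<in> carrier ?\<Gamma>" using \<phi> \<alpha>(1) by (auto simp: hom_def)
    moreover have "F (G 0) \<in> hyperbolic_space"
      using F unfolding totally_geodesic_isometric_immersion_def by blast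
    moreover have "\<phi> \<alpha> (F (G 0)) \<noteq> F (G 0)" using disp(1) unfolding eq .
    ultimately obtain K where K: "subgroup K ?\<Gamma>" "\<phi> \<alpha> \<notin> K" "finite (rcosets\<^bsub>?\<Gamma>\<^esub> K)"
      and card: "real (card (rcosets\<^bsub>?\<Gamma>\<^esub> K)) \<le> C * (hyperbolic_dist (F (G 0)) (\<phi> \<alpha> (F (G 0))) + 1)"
      using sep by blast
    have "C * (hyperbolic_dist (F (G 0)) (\<phi> \<alpha> (F (G 0))) + 1) \<le> C * (r + 2)"
      using disp(2)[unfolded eq] \<open>curve_length A \<gamma> < r + 1\<close> C by simp
    then have "card (rcosets\<^bsub>?\<Gamma>\<^esub> K) \<le> nat \<lfloor>C * (r + 2)\<rfloor>" using card by (simp add: le_nat_floor)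
    moreover have "divisibility ?\<pi> \<alpha> \<le> enat (card (rcosets\<^bsub>?\<Gamma>\<^esub> K))"
      by (rule divisibility_hom[OF \<phi> group_fundamental_group group_reflection_group K(1,3) \<alpha>(1) K(2)])
    ultimately show ?thesis by (meson enat_ord_simps(1) order_trans)
  qed
  \<comment> \<open>For \<open>n \<ge> 1\<close> the bound \<open>C * (n + 2)\<close> is at most
    \<open>3 * C * n\<close>; the added 1 makes \<open>B\<close> at least 1, which covers the
    default value 1 for an empty set of classes and the second factor \<open>B\<close> in
    \<open>growth_le\<close>.\<close>
  define B where "B = 3 * C + 1"
  have "ereal_of_enat (geodesic_rf A (p b) (real n)) \<le> ereal (B * (B * real n))" if n: "n \<ge> 1" for n :: nat
  proof -
    let ?S = "{\<alpha> \<in> carrier ?\<pi>. \<alpha> \<noteq> \<one>\<^bsub>?\<pi>\<^esub> \<and> geodesic_length A \<alpha> \<le> ereal (real n)}"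
    have n1: "real n \<ge> 1" using n by simp
    have B1: "B \<ge> 1" using C by (simp add: B_def)
    have "B * real n \<le> B * (B * real n)" using B1 n1 by (simp add: mult_le_cancel_left)
    moreover have "C * (real n + 2) \<le> B * real n" "1 \<le> B * real n"
    proof -
      have "C * 1 \<le> C * real n" using C n1 by (intro mult_left_mono) auto
      then show "C * (real n + 2) \<le> B * real n" using n1 by (simp add: B_def algebra_simps)
      show "1 \<le> B * real n" using mult_mono[OF B1 n1] B1 by simp
    qed
    ultimately have le: "C * (real n + 2) \<le> B * (B * real n)" "1 \<le> B * (B * real n)" by linarith+
    show ?thesis
    proof (cases "?S = {}")
      case True
      then have "geodesic_rf A (p b) (real n) = 1" unfolding geodesic_rf_def Let_def by (rule if_P)
      then show ?thesis using le(2) by (simp add: one_enat_def)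
    next
      case False
      then have "geodesic_rf A (p b) (real n) = (SUP \<alpha>\<in>?S. divisibility ?\<pi> \<alpha>)"
        unfolding geodesic_rf_def Let_def by (rule if_not_P)
      also have "\<dots> \<le> enat (nat \<lfloor>C * (real n + 2)\<rfloor>)" using bound by (intro SUP_least) blast
      finally have "ereal_of_enat (geodesic_rf A (p b) (real n)) \<le> ereal_of_enat (enat (nat \<lfloor>C * (real n + 2)\<rfloor>))"
        by (simp only: ereal_of_enat_le_iff)
      also have "\<dots> \<le> ereal (B * (B * real n))"
      proof -
        have "C * (real n + 2) \<ge> 0" using C by simp
        then have "real (nat \<lfloor>C * (real n + 2)\<rfloor>) \<le> C * (real n + 2)" by simp
        then show ?thesis using le(1) by simp
      qed
      finally show ?thesis .
    qed
  qed
  moreover have "B > 0" using C by (simp add: B_def)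
  ultimately show ?thesis unfolding growth_le_def by blast
qed

end
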